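(* Fix $\beta_0>0$ and let $G_N\sim\mathcal{G}(N,p(N))$ be a sequence of Erdős–Rényi random graphs with $\frac{\log N}{N}\ll p(N)\le1$ (i.e. $\frac{\log N}{Np(N)}\to0$). Let $\{\hat\beta_N\}_{N\ge1}$ be the maximum pseudolikelihood estimators for the Ising model with sufficient statistic $H_N(\tau)=\frac{1}{Np(N)}\tau'A(G_N)\tau$, where $A(G_N)$ is the adjacency matrix of $G_N$. (a) If $0<\beta_0<1$, then $\{\hat\beta_N\}_{N\ge1}$ is $\sqrt{1/p(N)}$-consistent at $\beta_0$. (b) If $\beta_0>1$, then $\{\hat\beta_N\}_{N\ge1}$ is $\sqrt N$-consistent at $\beta_0$.
   Context: $\mathcal G(N,p)$ is the random simple graph on $\{1,\dots,N\}$ with each edge present independently with probability $p$. Put $J_N=\frac1{Np(N)}A(G_N)$, $S_N=\{-1,1\}^N$, $H_N(\tau)=\tau'J_N\tau$. For $\beta\ge0$, conditionally on $G_N$, $$\mathbb{P}_\beta(\sigma=\tau)=2^{-N}\exp\{\tfrac12\beta H_N(\tau)-F_N(\beta)\},\qquad F_N(\beta)=\log\Big\{2^{-N}\sum_{\tau\in S_N}e^{\frac12\beta H_N(\tau)}\Big\}.$$ With $m_i(\tau)=\sum_jJ_N(i,j)\tau_j$ and $L_\tau(x)=\frac1N\sum_{i=1}^Nm_i(\tau)(\tau_i-\tanh(x\,m_i(\tau)))$ (nonincreasing in $x\ge0$; it is $\frac1N$ times the derivative of the log-pseudolikelihood $\sum_i\log\mathbb{P}_x(\sigma_i=\tau_i\mid(\sigma_j)_{j\ne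 i}=(\tau_j)_{j\ne i})$), the maximum pseudolikelihood estimator based on a single observation $\sigma$ (and the known graph $G_N$) is $\hat\beta_N=\inf\{x\ge0:L_\sigma(x)=0\}$, with the conventions $\hat\beta_N=0$ if $L_\sigma(0)<0$ (the pseudolikelihood is then maximized over $[0,\infty)$ at $0$) and $\hat\beta_N=\infty$ if $L_\sigma(x)>0$ for all $x\ge0$. It is $b_N$-consistent at $\beta_0$ if $\limsup_{K\to\infty}\limsup_{N\to\infty}\mathbb{P}_{\beta_0}(b_N|\hat\beta_N-\beta_0|>K)=0$, where the probability is over the joint law of $G_N$ and $\sigma$. *)

theory Defs
  imports "HOL-Probability.Probability"
begin

text \<open>A simple graph on the vertex set \<open>{1..N}\<close> is represented by its set of edges,
  a set of two-element subsets of \<open>{1..N}\<close>.\<close>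

definition vertex_pairs :: "nat \<Rightarrow> nat set set" where
  "vertex_pairs N = {e. e \<subseteq> {1..N} \<and> card e = 2}"

definition erdos_renyi :: "nat \<Rightarrow> real \<Rightarrow> nat set set pmf" where
  "erdos_renyi N p =
     map_pmf (\<lambda>X. {e \<in> vertex_pairs N. X e})
       (Pi_pmf (vertex_pairs N) False (\<lambda>_. bernoulli_pmf p))"

text \<open>The diagonal vanishes: \<open>{i, i}\<close> is a singleton, hence never an edge.\<close>

definition adjacency :: "nat set set \<Rightarrow> nat \<Rightarrow> nat \<Rightarrow> real" where
  "adjacency E i j = (if {i, j} \<in> E then 1 else 0)"

definition coupling :: "nat \<Rightarrow> real \<Rightarrow> nat set set \<Rightarrow> nat \<Rightarrow> nat \<Rightarrow> real" where
  "coupling N p E i j = 1 / (real N * p) * adjacency E i j"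

definition spins :: "nat \<Rightarrow> (nat \<Rightarrow> real) set" where
  "spins N = {1..N} \<rightarrow>\<^sub>E {-1, 1}"

definition hamiltonian :: "nat \<Rightarrow> (nat \<Rightarrow> nat \<Rightarrow> real) \<Rightarrow> (nat \<Rightarrow> real) \<Rightarrow> real" where
  "hamiltonian N J \<tau> = (\<Sum>i\<in>{1..N}. \<Sum>j\<in>{1..N}. \<tau> i * J i j * \<tau> j)"

definition log_partition :: "nat \<Rightarrow> (nat \<Rightarrow> nat \<Rightarrow> real) \<Rightarrow> real \<Rightarrow> real" where
  "log_partition N J \<beta> =
     ln ((1 / 2) ^ N * (\<Sum>\<tau>\<in>spins N. exp (1 / 2 * \<beta> * hamiltonian N J \<tau>)))"

definition ising :: "nat \<Rightarrow> (nat \<Rightarrow> nat \<Rightarrow> real) \<Rightarrow> real \<Rightarrow> (nat \<Rightarrow> real) pmf" where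
  "ising N J \<beta> = embed_pmf (\<lambda>\<tau>.
     if \<tau> \<in> spins N
     then (1 / 2) ^ N * exp (1 / 2 * \<beta> * hamiltonian N J \<tau> - log_partition N J \<beta>)
     else 0)"

lemma finite_spins: "finite (spins N)"
  unfolding spins_def by (intro finite_PiE) auto

lemma spins_nonempty: "spins N \<noteq> {}"
  unfolding spins_def by (auto simp: PiE_eq_empty_iff)

text \<open>The weights are a probability mass function, so \<open>embed_pmf\<close> is used within its
  domain.\<close>

lemma pmf_ising:
  "pmf (ising N J \<beta>) \<tau> =
     (if \<tau> \<in> spins N
      then (1 / 2) ^ N * exp (1 / 2 * \<beta> * hamiltonian N J \<tau> - log_partition N J \<beta>)
      else 0)"
proof -
  define w where "w = (\<lambda>\<tau>. if \<tau> \<in> spins N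
     then (1 / 2) ^ N * exp (1 / 2 * \<beta> * hamiltonian N J \<tau> - log_partition N J \<beta>)
     else 0)"
  define Z where "Z = (\<Sum>\<tau>\<in>spins N. exp (1 / 2 * \<beta> * hamiltonian N J \<tau>))"
  have Z: "Z > 0"
    unfolding Z_def by (intro sum_pos finite_spins spins_nonempty) auto
  have nn: "w \<tau> \<ge> 0" for \<tau>
    by (simp add: w_def)
  have e: "exp (log_partition N J \<beta>) = (1 / 2) ^ N * Z"
    using Z by (simp add: log_partition_def Z_def)
  have "(\<Sum>\<tau>\<in>spins N. w \<tau>) = (1 / 2) ^ N * Z / exp (log_partition N J \<beta>)"
    by (simp add: w_def Z_def exp_diff sum_divide_distrib sum_distrib_left)
  also have "\<dots> = 1"
    unfolding e using Z by simp
  finally have s: "(\<Sum>\<tau>\<in>spins N. w \<tau>) = 1" .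
  have "(\<integral>\<^sup>+\<tau>. ennreal (w \<tau>) \<partial>count_space UNIV) = (\<Sum>\<tau>\<in>spins N. ennreal (w \<tau>))"
    by (intro nn_integral_count_space'[OF finite_spins]) (auto simp: w_def)
  also have "\<dots> = 1"
    using nn s by (simp add: sum_ennreal)
  finally have "pmf (embed_pmf w) \<tau> = w \<tau>"
    by (intro pmf_embed_pmf nn)
  then show ?thesis
    by (simp add: ising_def w_def)
qed

definition local_field :: "nat \<Rightarrow> (nat \<Rightarrow> nat \<Rightarrow> real) \<Rightarrow> (nat \<Rightarrow> real) \<Rightarrow> nat \<Rightarrow> real" where
  "local_field N J \<tau> i = (\<Sum>j\<in>{1..N}. J i j * \<tau> j)"

text \<open>\<open>1 / N\<close> times the derivative at \<open>x\<close> of the log-pseudolikelihood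
  \<open>\<Sum>i. log P\<^sub>x(\<sigma>\<^sub>i = \<tau>\<^sub>i | \<sigma>\<^sub>j = \<tau>\<^sub>j for all j \<noteq> i)\<close>.\<close>

definition score :: "nat \<Rightarrow> (nat \<Rightarrow> nat \<Rightarrow> real) \<Rightarrow> (nat \<Rightarrow> real) \<Rightarrow> real \<Rightarrow> real" where
  "score N J \<tau> x =
     1 / real N * (\<Sum>i\<in>{1..N}. local_field N J \<tau> i * (\<tau> i - tanh (x * local_field N J \<tau> i)))"

text \<open>As the score is continuous and nonincreasing on \<open>[0, \<infinity>)\<close>, it has a zero there
  whenever neither of the first two cases applies.\<close>

definition mple :: "nat \<Rightarrow> (nat \<Rightarrow> nat \<Rightarrow> real) \<Rightarrow> (nat \<Rightarrow> real) \<Rightarrow> ereal" where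
  "mple N J \<sigma> =
     (if score N J \<sigma> 0 < 0 then 0
      else if \<forall>x\<ge>0. score N J \<sigma> x > 0 then \<infinity>
      else Inf (ereal ` {x. 0 \<le> x \<and> score N J \<sigma> x = 0}))"

text \<open>Joint law of the graph and of the spin configuration observed on it.\<close>

definition joint_law :: "nat \<Rightarrow> real \<Rightarrow> real \<Rightarrow> (nat set set \<times> (nat \<Rightarrow> real)) pmf" where
  "joint_law N p \<beta> =
     bind_pmf (erdos_renyi N p) (\<lambda>E. map_pmf (Pair E) (ising N (coupling N p E) \<beta>))"

definition er_mple :: "nat \<Rightarrow> real \<Rightarrow> nat set set \<times> (nat \<Rightarrow> real) \<Rightarrow> ereal" where
  "er_mple N p = (\<lambda>(E, \<sigma>). mple N (coupling N p E) \<sigma>)"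

definition rate_consistent ::
  "(nat \<Rightarrow> real) \<Rightarrow> (nat \<Rightarrow> 'a pmf) \<Rightarrow> (nat \<Rightarrow> 'a \<Rightarrow> ereal) \<Rightarrow> real \<Rightarrow> bool" where
  "rate_consistent b M est \<beta>\<^sub>0 \<longleftrightarrow>
     Limsup at_top (\<lambda>K::real. limsup (\<lambda>N.
       ereal (measure_pmf.prob (M N) {\<omega>. ereal (b N) * \<bar>est N \<omega> - ereal \<beta>\<^sub>0\<bar> > ereal K}))) = 0"

end

theory Submission
  imports Defs
begin

text \<open>
  Write \<open>m i\<close> for the local fields and \<open>Q = \<Sum>i. m i (\<tau> i - tanh (\<beta> m i))\<close> for \<open>N\<close> times the score at
  the true parameter. If the estimator is off by more than \<open>h\<close>, then monotonicity of the score gives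
  \<open>\<bar>Q\<bar> \<ge> h \<Sum>i. (m i)\<^sup>2 (1 - tanh\<^sup>2 ((\<beta> + h) m i))\<close>; so with \<open>a = 1/p\<close> for \<open>\<beta> < 1\<close> and \<open>a = N\<close> for
  \<open>\<beta> > 1\<close> one needs \<open>E Q\<^sup>2 = O(a)\<close> and \<open>\<Sum>i. (m i)\<^sup>2 \<ge> c a\<close> with high probability.

  Only the regularity of the graph is used: by a Chernoff bound all row sums of \<open>J\<close> lie in
  \<open>[1 - \<epsilon>, 1 + \<epsilon>]\<close>. All moment bounds come from \<open>E[\<tau> i | rest] = tanh (\<beta> m i)\<close>: they bound
  \<open>E Q\<^sup>2\<close> by \<open>E (\<Sum>i. (m i)\<^sup>2)\<close> and \<open>\<Sum>i,j. (J i j)\<^sup>2\<close>, and for \<open>\<beta> (1 + \<epsilon>) < 1\<close> they close up to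
  \<open>E (\<Sum>i. (m i)\<^sup>2) = O(1/p)\<close> and \<open>E (\<Sum>i. (m i)^4) = o(1/p)\<close>.

  For the lower bound, \<open>H \<le> \<bar>Q\<bar> + \<beta> \<Sum>i. (m i)\<^sup>2\<close>, and \<open>P(H \<le> x) \<le> exp (\<beta> x / 2 - F)\<close> makes \<open>H\<close> large
  once \<open>F \<ge> c a\<close>. For \<open>\<beta> > 1\<close> this is the mean-field lower bound for \<open>F\<close>; for \<open>\<beta> < 1\<close> Griffiths'
  inequality gives \<open>F \<ge> c/p\<close>, which suffices when \<open>p\<close> is small. When \<open>p\<close> is bounded below, the
  Gibbs measure is comparable to the uniform one, under which the normalised total field
  \<open>N\<^sup>-\<^sup>1\<^sup>/\<^sup>2 \<Sum>i. m i\<close> has a small-ball estimate.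
\<close>

section \<open>Gibbs averages\<close>

lemma spins_range: "\<tau> \<in> spins N \<Longrightarrow> i \<in> {1..N} \<Longrightarrow> \<tau> i = 1 \<or> \<tau> i = - 1"
  unfolding spins_def by (auto simp: PiE_iff)

lemma spins_square: "\<tau> \<in> spins N \<Longrightarrow> i \<in> {1..N} \<Longrightarrow> \<tau> i * \<tau> i = 1"
  using spins_range[of \<tau> N i] by auto

lemma spins_abs: "\<tau> \<in> spins N \<Longrightarrow> i \<in> {1..N} \<Longrightarrow> \<bar>\<tau> i\<bar> = 1"
  using spins_range[of \<tau> N i] by auto

definition flip :: "nat \<Rightarrow> (nat \<Rightarrow> real) \<Rightarrow> nat \<Rightarrow> real" where
  "flip i \<tau> = \<tau>(i := - \<tau> i)"

lemma flip_spins: "\<tau> \<in> spins N \<Longrightarrow> i \<in> {1..N} \<Longrightarrow> flip i \<tau> \<in> spins N"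
  unfolding spins_def flip_def by (auto simp: PiE_iff extensional_def)

lemma flip_flip [simp]: "flip i (flip i \<tau>) = \<tau>"
  by (simp add: flip_def)

lemma flip_same [simp]: "flip i \<tau> i = - \<tau> i"
  by (simp add: flip_def)

lemma hamiltonian_local_field:
  "hamiltonian N J \<tau> = (\<Sum>i\<in>{1..N}. \<tau> i * local_field N J \<tau> i)"
  by (simp add: hamiltonian_def local_field_def sum_distrib_left mult.assoc)

lemma local_field_flip:
  assumes "i \<in> {1..N}"
  shows "local_field N J (flip i \<tau>) k = local_field N J \<tau> k - 2 * J k i * \<tau> i"
proof -
  have "local_field N J (flip i \<tau>) k =
      (\<Sum>j\<in>{1..N}. J k j * \<tau> j - (if j = i then 2 * J k i * \<tau> i else 0))"
    unfolding local_field_def flip_def by (intro sum.cong) auto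
  then show ?thesis
    using assms by (simp add: local_field_def sum_subtractf)
qed

text \<open>A finite sum over the support, so that linearity and monotonicity come without
  integrability conditions; \<open>gibbs_expectation\<close> identifies it with the
  expectation.\<close>

definition gibbs :: "nat \<Rightarrow> (nat \<Rightarrow> nat \<Rightarrow> real) \<Rightarrow> real \<Rightarrow> ((nat \<Rightarrow> real) \<Rightarrow> real) \<Rightarrow> real" where
  "gibbs N J \<beta> f = (\<Sum>\<tau>\<in>spins N. pmf (ising N J \<beta>) \<tau> * f \<tau>)"

lemma gibbs_add: "gibbs N J \<beta> (\<lambda>\<tau>. f \<tau> + g \<tau>) = gibbs N J \<beta> f + gibbs N J \<beta> g"
  by (simp add: gibbs_def distrib_left sum.distrib)

lemma gibbs_diff: "gibbs N J \<beta> (\<lambda>\<tau>. f \<tau> - g \<tau>) = gibbs N J \<beta> f - gibbs N J \<beta> g"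
  by (simp add: gibbs_def right_diff_distrib sum_subtractf)

lemma gibbs_sum: "gibbs N J \<beta> (\<lambda>\<tau>. \<Sum>i\<in>A. f i \<tau>) = (\<Sum>i\<in>A. gibbs N J \<beta> (f i))"
  unfolding gibbs_def sum_distrib_left by (rule sum.swap)

lemma gibbs_cmult: "gibbs N J \<beta> (\<lambda>\<tau>. c * f \<tau>) = c * gibbs N J \<beta> f"
  by (simp add: gibbs_def sum_distrib_left mult_ac)

lemma gibbs_mono: "(\<And>\<tau>. \<tau> \<in> spins N \<Longrightarrow> f \<tau> \<le> g \<tau>) \<Longrightarrow> gibbs N J \<beta> f \<le> gibbs N J \<beta> g"
  unfolding gibbs_def by (intro sum_mono mult_left_mono) auto

lemma gibbs_cong: "(\<And>\<tau>. \<tau> \<in> spins N \<Longrightarrow> f \<tau> = g \<tau>) \<Longrightarrow> gibbs N J \<beta> f = gibbs N J \<beta> g"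
  unfolding gibbs_def by (intro sum.cong) auto

lemma set_pmf_ising: "set_pmf (ising N J \<beta>) = spins N"
  by (auto simp: set_pmf_eq pmf_ising)

lemma gibbs_expectation: "gibbs N J \<beta> f = measure_pmf.expectation (ising N J \<beta>) f"
  unfolding gibbs_def
  by (subst integral_measure_pmf[of "spins N"]) (auto simp: finite_spins set_pmf_ising)

lemma gibbs_const [simp]: "gibbs N J \<beta> (\<lambda>_. c) = c"
  by (simp add: gibbs_expectation)

lemma prob_ising: "measure_pmf.prob (ising N J \<beta>) S = (\<Sum>\<tau>\<in>S \<inter> spins N. pmf (ising N J \<beta>) \<tau>)"
proof -
  have "measure_pmf.prob (ising N J \<beta>) S = measure_pmf.prob (ising N J \<beta>) (S \<inter> spins N)"
    by (metis measure_Int_set_pmf set_pmf_ising)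
  then show ?thesis
    by (simp add: measure_measure_pmf_finite finite_spins)
qed

lemma gibbs_markov:
  assumes "\<And>\<tau>. \<tau> \<in> spins N \<Longrightarrow> 0 \<le> f \<tau>" and "0 < a"
    and "\<And>\<tau>. \<tau> \<in> spins N \<Longrightarrow> \<tau> \<in> S \<Longrightarrow> a \<le> f \<tau>"
  shows "measure_pmf.prob (ising N J \<beta>) S \<le> gibbs N J \<beta> f / a"
proof -
  have "a * measure_pmf.prob (ising N J \<beta>) S = (\<Sum>\<tau>\<in>S \<inter> spins N. pmf (ising N J \<beta>) \<tau> * a)"
    by (simp add: prob_ising sum_distrib_left mult_ac)
  also have "\<dots> \<le> (\<Sum>\<tau>\<in>S \<inter> spins N. pmf (ising N J \<beta>) \<tau> * f \<tau>)"
    using assms by (intro sum_mono mult_left_mono) auto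
  also have "\<dots> \<le> gibbs N J \<beta> f"
    unfolding gibbs_def using assms(1) by (intro sum_mono2) (auto simp: finite_spins)
  finally show ?thesis
    using assms(2) by (simp add: field_simps)
qed

text \<open>In a field \<open>y\<close> a single spin is +1 or -1 with probability
  \<open>(1 + tanh y) / 2\<close> or \<open>(1 - tanh y) / 2\<close>; the identity is the ratio of
  the two, that is, detailed balance for one flip.\<close>

lemma one_minus_tanh: "1 - tanh y = exp (- (2 * y)) * (1 + tanh y)" for y :: real
proof -
  have "(1 - tanh y) * cosh y = exp (- y)" "(1 + tanh y) * cosh y = exp y"
    by (simp_all add: left_diff_distrib distrib_right tanh_def cosh_minus_sinh cosh_plus_sinh)
  then have "(1 - tanh y) * cosh y = exp (- (2 * y)) * (1 + tanh y) * cosh y"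
    by (simp add: mult.assoc flip: exp_add)
  then show ?thesis
    by simp
qed

section \<open>Lipschitz and boundedness estimates for tanh\<close>

lemma abs_tanh_le: "\<bar>tanh x\<bar> \<le> \<bar>x\<bar>" for x :: real
proof -
  have *: "tanh x \<le> x" if "0 \<le> x" for x :: real
  proof -
    have "(\<lambda>y. y - tanh y) 0 \<le> (\<lambda>y. y - tanh y) x"
      by (rule DERIV_nonneg_imp_nondecreasing[OF that])
        (auto intro!: derivative_eq_intros exI simp: power_le_one)
    then show ?thesis by simp
  qed
  show ?thesis
    using *[of x] *[of "- x"] by (cases "0 \<le> x") (auto simp: abs_if)
qed

lemma abs_tanh_le_1: "\<bar>tanh x\<bar> \<le> 1" for x :: real
  using tanh_real_lt_1[of x] tanh_real_gt_neg1[of x] by auto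

lemma abs_tanh_diff_le: "\<bar>tanh x - tanh y\<bar> \<le> \<bar>x - y\<bar>" for x y :: real
proof -
  have *: "tanh x - tanh y \<le> x - y" if "y \<le> x" for x y :: real
  proof -
    have "(\<lambda>z. z - tanh z) y \<le> (\<lambda>z. z - tanh z) x"
      by (rule DERIV_nonneg_imp_nondecreasing[OF that])
        (auto intro!: derivative_eq_intros exI)
    then show ?thesis by simp
  qed
  show ?thesis
    using *[of x y] *[of y x] tanh_real_le_iff[of x y] tanh_real_le_iff[of y x]
    by (cases "y \<le> x") auto
qed

text \<open>For a symmetric nonnegative matrix the row-sum bound \<open>R\<close> also bounds the
  operator norm; \<open>\<beta> * R < 1\<close> is the contraction condition under which the moment
  bounds close up.\<close>

locale ising_system =
  fixes N :: nat and J :: "nat \<Rightarrow> nat \<Rightarrow> real" and \<beta> R :: real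
  assumes J_nonneg: "0 \<le> J i j"
    and J_sym: "J i j = J j i"
    and J_diag: "J i i = 0"
    and row_sum: "i \<in> {1..N} \<Longrightarrow> (\<Sum>j\<in>{1..N}. J i j) \<le> R"
    and \<beta>_nonneg: "0 \<le> \<beta>"
begin

abbreviation m :: "(nat \<Rightarrow> real) \<Rightarrow> nat \<Rightarrow> real" where
  "m \<equiv> local_field N J"

abbreviation H :: "(nat \<Rightarrow> real) \<Rightarrow> real" where
  "H \<equiv> hamiltonian N J"

abbreviation E :: "((nat \<Rightarrow> real) \<Rightarrow> real) \<Rightarrow> real" where
  "E \<equiv> gibbs N J \<beta>"

text \<open>By symmetry and the zero diagonal, spin \<open>i\<close> enters \<open>H\<close> only
  through \<open>2 * \<tau> i * m \<tau> i\<close>, and the flip reverses the sign of this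
  term.\<close>

lemma hamiltonian_flip:
  assumes "i \<in> {1..N}"
  shows "H (flip i \<tau>) = H \<tau> - 4 * \<tau> i * m \<tau> i"
proof -
  have "H (flip i \<tau>) = (\<Sum>k\<in>{1..N}. flip i \<tau> k * (m \<tau> k - 2 * J k i * \<tau> i))"
    by (simp add: hamiltonian_local_field local_field_flip[OF assms])
  also have "\<dots> = (\<Sum>k\<in>{1..N}. flip i \<tau> k * m \<tau> k) - 2 * \<tau> i * m (flip i \<tau>) i"
    by (simp add: local_field_def[of N J "flip i \<tau>"] sum_distrib_left sum_subtractf
        algebra_simps J_sym[of i])
  also have "(\<Sum>k\<in>{1..N}. flip i \<tau> k * m \<tau> k) =
      (\<Sum>k\<in>{1..N}. \<tau> k * m \<tau> k - (if k = i then 2 * \<tau> i * m \<tau> i else 0))"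
    unfolding flip_def by (intro sum.cong) auto
  also have "\<dots> = H \<tau> - 2 * \<tau> i * m \<tau> i"
    using assms by (simp add: hamiltonian_local_field sum_subtractf)
  also have "m (flip i \<tau>) i = m \<tau> i"
    using assms by (simp add: local_field_flip J_diag)
  finally show ?thesis by simp
qed

text \<open>The weak form of E[\<tau> i | other spins] = tanh (\<beta> m i), tested against
  functions that do not see spin \<open>i\<close>. Since \<open>J i i = 0\<close>, the flip
  preserves \<open>m \<tau> i\<close>, and by detailed balance the terms of \<open>\<tau>\<close>
  and \<open>flip i \<tau>\<close> cancel.\<close>

lemma conditional_mean_zero:
  assumes i: "i \<in> {1..N}" and g: "\<And>\<tau>. \<tau> \<in> spins N \<Longrightarrow> g (flip i \<tau>) = g \<tau>"
  shows "E (\<lambda>\<tau>. (\<tau> i - tanh (\<beta> * m \<tau> i)) * g \<tau>) = 0"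
proof -
  let ?P = "pmf (ising N J \<beta>)"
  let ?f = "\<lambda>\<tau>. ?P \<tau> * ((\<tau> i - tanh (\<beta> * m \<tau> i)) * g \<tau>)"
  have "(\<Sum>\<tau>\<in>spins N. ?f \<tau>) = (\<Sum>\<tau>\<in>spins N. ?f (flip i \<tau>))"
    by (rule sum.reindex_bij_witness[of _ "flip i" "flip i"]) (auto intro: flip_spins[OF _ i])
  moreover have "?f \<tau> + ?f (flip i \<tau>) = 0" if \<tau>: "\<tau> \<in> spins N" for \<tau>
  proof -
    have P: "?P (flip i \<tau>) = ?P \<tau> * exp (- (2 * \<beta> * \<tau> i * m \<tau> i))"
      using \<tau> i by (simp add: pmf_ising flip_spins hamiltonian_flip right_diff_distrib
          mult_ac flip: exp_add)
    have m: "m (flip i \<tau>) i = m \<tau> i"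
      using i by (simp add: local_field_flip J_diag)
    have "(\<tau> i - tanh (\<beta> * m \<tau> i)) =
        exp (- (2 * \<beta> * \<tau> i * m \<tau> i)) * (\<tau> i + tanh (\<beta> * m \<tau> i))"
      using spins_range[OF \<tau> i]
    proof
      assume "\<tau> i = 1"
      then show ?thesis
        using one_minus_tanh[of "\<beta> * m \<tau> i"] by (simp add: mult_ac)
    next
      assume "\<tau> i = - 1"
      then show ?thesis
        using one_minus_tanh[of "- (\<beta> * m \<tau> i)"] by (simp add: mult_ac algebra_simps)
    qed
    then have "?P \<tau> * (\<tau> i - tanh (\<beta> * m \<tau> i)) =
        ?P \<tau> * (exp (- (2 * \<beta> * \<tau> i * m \<tau> i)) * (\<tau> i + tanh (\<beta> * m \<tau> i)))"
      by (rule arg_cong)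
    then show ?thesis
      unfolding P m g[OF \<tau>] flip_same by algebra
  qed
  then have "(\<Sum>\<tau>\<in>spins N. ?f \<tau>) + (\<Sum>\<tau>\<in>spins N. ?f (flip i \<tau>)) = 0"
    by (simp flip: sum.distrib)
  ultimately show ?thesis
    by (simp add: gibbs_def)
qed

end

section \<open>Moment bounds\<close>

context ising_system
begin

definition M2 :: "(nat \<Rightarrow> real) \<Rightarrow> real" where
  "M2 \<tau> = (\<Sum>i\<in>{1..N}. (m \<tau> i)\<^sup>2)"

definition M4 :: "(nat \<Rightarrow> real) \<Rightarrow> real" where
  "M4 \<tau> = (\<Sum>i\<in>{1..N}. (m \<tau> i) ^ 4)"

definition Q :: "(nat \<Rightarrow> real) \<Rightarrow> real" where
  "Q \<tau> = (\<Sum>i\<in>{1..N}. m \<tau> i * (\<tau> i - tanh (\<beta> * m \<tau> i)))"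

text \<open>The squared Frobenius norm of \<open>J\<close>, which is also the average of
  \<open>M2\<close> under the uniform measure on spins.\<close>

definition J2 :: real where
  "J2 = (\<Sum>i\<in>{1..N}. \<Sum>j\<in>{1..N}. (J i j)\<^sup>2)"

text \<open>A Schur test: row sums control the \<open>a\<close> part and, by symmetry, column sums
  control the \<open>b\<close> part.\<close>

lemma weighted_sum_le:
  assumes "\<And>i. 0 \<le> a i" and "\<And>i. 0 \<le> b i"
  shows "(\<Sum>i\<in>{1..N}. \<Sum>j\<in>{1..N}. J i j * (a i + b j)) \<le>
    R * ((\<Sum>i\<in>{1..N}. a i) + (\<Sum>i\<in>{1..N}. b i))"
proof -
  have *: "(\<Sum>i\<in>{1..N}. (\<Sum>j\<in>{1..N}. J i j) * c i) \<le> R * (\<Sum>i\<in>{1..N}. c i)"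
    if "\<And>i. 0 \<le> c i" for c :: "nat \<Rightarrow> real"
    unfolding sum_distrib_left using that by (intro sum_mono mult_right_mono row_sum) auto
  have "(\<Sum>i\<in>{1..N}. \<Sum>j\<in>{1..N}. J i j * (a i + b j)) =
      (\<Sum>i\<in>{1..N}. \<Sum>j\<in>{1..N}. J i j * a i) + (\<Sum>i\<in>{1..N}. \<Sum>j\<in>{1..N}. J j i * b j)"
    by (simp add: distrib_left sum.distrib J_sym)
  also have "(\<Sum>i\<in>{1..N}. \<Sum>j\<in>{1..N}. J j i * b j) =
      (\<Sum>i\<in>{1..N}. \<Sum>j\<in>{1..N}. J i j * b i)"
    by (rule sum.swap)
  finally show ?thesis
    using *[of a] *[of b] assms by (simp add: sum_distrib_right distrib_left)
qed

text \<open>Subtracting \<open>J i j * \<tau> j\<close> removes spin \<open>j\<close> from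
  \<open>m \<tau> i\<close>, so that \<open>\<tau> j\<close> can be replaced by its conditional
  mean. Restoring the field costs \<open>D \<tau>\<close> times the bound 2 on the difference of
  \<open>\<tau> j\<close> and its mean.\<close>

lemma spin_times_field_le:
  assumes j: "j \<in> {1..N}"
    and D: "\<And>\<tau>. \<tau> \<in> spins N \<Longrightarrow> \<bar>f (m \<tau> i) - f (m \<tau> i - J i j * \<tau> j)\<bar> \<le> D \<tau>"
  shows "E (\<lambda>\<tau>. \<tau> j * f (m \<tau> i)) \<le> E (\<lambda>\<tau>. tanh (\<beta> * m \<tau> j) * f (m \<tau> i) + 2 * D \<tau>)"
proof -
  have "E (\<lambda>\<tau>. (\<tau> j - tanh (\<beta> * m \<tau> j)) * f (m \<tau> i - J i j * \<tau> j)) = 0"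
    by (rule conditional_mean_zero[OF j]) (simp add: local_field_flip[OF j] mult.commute)
  moreover have "E (\<lambda>\<tau>. \<tau> j * f (m \<tau> i)) \<le> E (\<lambda>\<tau>.
      (\<tau> j - tanh (\<beta> * m \<tau> j)) * f (m \<tau> i - J i j * \<tau> j) +
      (tanh (\<beta> * m \<tau> j) * f (m \<tau> i) + 2 * D \<tau>))"
  proof (rule gibbs_mono)
    fix \<tau> assume \<tau>: "\<tau> \<in> spins N"
    have "\<bar>\<tau> j - tanh (\<beta> * m \<tau> j)\<bar> \<le> 2"
      using spins_abs[OF \<tau> j] abs_tanh_le_1[of "\<beta> * m \<tau> j"] by linarith
    then have "\<bar>(\<tau> j - tanh (\<beta> * m \<tau> j)) * (f (m \<tau> i) - f (m \<tau> i - J i j * \<tau> j))\<bar> \<le> 2 * D \<tau>"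
      unfolding abs_mult using D[OF \<tau>] by (intro mult_mono) auto
    then have "(\<tau> j - tanh (\<beta> * m \<tau> j)) * (f (m \<tau> i) - f (m \<tau> i - J i j * \<tau> j)) \<le> 2 * D \<tau>"
      by linarith
    then show "\<tau> j * f (m \<tau> i) \<le> (\<tau> j - tanh (\<beta> * m \<tau> j)) * f (m \<tau> i - J i j * \<tau> j) +
        (tanh (\<beta> * m \<tau> j) * f (m \<tau> i) + 2 * D \<tau>)"
      by (simp add: algebra_simps)
  qed
  ultimately show ?thesis
    by (simp add: gibbs_add)
qed

lemma abs_tanh_field_le: "\<bar>tanh (\<beta> * x)\<bar> \<le> \<beta> * \<bar>x\<bar>"
  using abs_tanh_le[of "\<beta> * x"] \<beta>_nonneg by (simp add: abs_mult)

text \<open>Expand one factor of each \<open>(m \<tau> i)\<^sup>2\<close> into spins and replace the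
  spins by their conditional means. As |tanh (\<beta> m j)| is at most \<beta> |m j|, AM-GM and the
  Schur test return \<open>\<beta> * R\<close> times the same moment, and the replacement errors add
  up to \<open>2 * J2\<close>.\<close>

lemma second_moment_le: "(1 - \<beta> * R) * E M2 \<le> 2 * J2"
proof -
  have "E M2 = E (\<lambda>\<tau>. \<Sum>i\<in>{1..N}. \<Sum>j\<in>{1..N}. J i j * (\<tau> j * m \<tau> i))"
    unfolding M2_def power2_eq_square
    by (simp add: local_field_def[of N J _ "_::nat"] sum_distrib_right sum_distrib_left mult_ac)
  also have "\<dots> = (\<Sum>i\<in>{1..N}. \<Sum>j\<in>{1..N}. J i j * E (\<lambda>\<tau>. \<tau> j * m \<tau> i))"
    by (simp add: gibbs_sum gibbs_cmult)
  also have "\<dots> \<le> (\<Sum>i\<in>{1..N}. \<Sum>j\<in>{1..N}. J i j *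
      E (\<lambda>\<tau>. tanh (\<beta> * m \<tau> j) * m \<tau> i + 2 * J i j))"
    by (intro sum_mono mult_left_mono J_nonneg
        spin_times_field_le[where f = "\<lambda>x. x" and D = "\<lambda>_. J i j" for i j, simplified])
      (auto simp: abs_mult J_nonneg spins_abs)
  also have "\<dots> \<le> (\<Sum>i\<in>{1..N}. \<Sum>j\<in>{1..N}. J i j *
      E (\<lambda>\<tau>. \<beta> / 2 * ((m \<tau> i)\<^sup>2 + (m \<tau> j)\<^sup>2) + 2 * J i j))"
  proof (intro sum_mono mult_left_mono J_nonneg gibbs_mono add_right_mono)
    fix i j \<tau>
    have "tanh (\<beta> * m \<tau> j) * m \<tau> i \<le> \<bar>tanh (\<beta> * m \<tau> j)\<bar> * \<bar>m \<tau> i\<bar>"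
      by (simp flip: abs_mult)
    also have "\<dots> \<le> \<beta> * \<bar>m \<tau> j\<bar> * \<bar>m \<tau> i\<bar>"
      by (intro mult_right_mono abs_tanh_field_le) auto
    also have "\<dots> \<le> \<beta> * (((m \<tau> i)\<^sup>2 + (m \<tau> j)\<^sup>2) / 2)"
      using sum_squares_bound[of "\<bar>m \<tau> j\<bar>" "\<bar>m \<tau> i\<bar>"] \<beta>_nonneg
      unfolding mult.assoc by (intro mult_left_mono) auto
    finally show "tanh (\<beta> * m \<tau> j) * m \<tau> i \<le> \<beta> / 2 * ((m \<tau> i)\<^sup>2 + (m \<tau> j)\<^sup>2)"
      by simp
  qed
  also have "\<dots> = E (\<lambda>\<tau>. \<beta> / 2 * (\<Sum>i\<in>{1..N}. \<Sum>j\<in>{1..N}. J i j * ((m \<tau> i)\<^sup>2 + (m \<tau> j)\<^sup>2))) + 2 * J2"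
    unfolding gibbs_sum gibbs_cmult gibbs_add gibbs_const distrib_left sum.distrib J2_def
    by (simp add: sum_distrib_left power2_eq_square mult_ac)
  also have "\<dots> \<le> E (\<lambda>\<tau>. \<beta> / 2 * (R * (M2 \<tau> + M2 \<tau>))) + 2 * J2"
    unfolding M2_def using \<beta>_nonneg
    by (intro add_right_mono gibbs_mono mult_left_mono weighted_sum_le) auto
  also have "\<dots> = \<beta> * R * E M2 + 2 * J2"
    by (simp add: gibbs_cmult gibbs_add)
  finally show ?thesis
    by (simp add: algebra_simps)
qed

text \<open>The scheme of the second moment with the cube in place of the identity. Each replacement
  error carries a further factor \<open>\<kappa>\<close>, and this is what makes the fourth moment
  of smaller order than the second.\<close>

lemma fourth_moment_le:
  assumes J_le: "\<And>i j. J i j \<le> \<kappa>"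
  shows "(1 - \<beta> * R) * E M4 \<le> 10 * \<kappa> * R * E M2 + 6 * \<kappa> ^ 3 * R * N"
proof -
  have \<kappa>: "0 \<le> \<kappa>"
    using J_le[of 0 0] J_nonneg[of 0 0] by linarith
  \<comment> \<open>Bounding 3|x d| by 3/2 (x^2 + d^2) gives the coefficients 9/2 and 5/2, rounded
    up to 5 and 3.\<close>
  have cube: "\<bar>x ^ 3 - (x - d) ^ 3\<bar> \<le> \<bar>d\<bar> * (5 * x\<^sup>2 + 3 * d\<^sup>2)" for x d :: real
  proof -
    have "x ^ 3 - (x - d) ^ 3 = d * (3 * x\<^sup>2 - 3 * x * d + d\<^sup>2)"
      by (simp add: power2_eq_square power3_eq_cube algebra_simps)
    moreover have "\<bar>3 * x\<^sup>2 - 3 * x * d + d\<^sup>2\<bar> \<le> 5 * x\<^sup>2 + 3 * d\<^sup>2"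
    proof -
      have "2 * (x * d) \<le> x\<^sup>2 + d\<^sup>2" "- (2 * (x * d)) \<le> x\<^sup>2 + d\<^sup>2"
        using sum_squares_bound[of x d] sum_squares_bound[of "- x" d] by auto
      moreover have "0 \<le> x\<^sup>2" "0 \<le> d\<^sup>2" by auto
      ultimately show ?thesis
        unfolding abs_le_iff mult.assoc by linarith
    qed
    ultimately show ?thesis
      by (simp add: abs_mult mult_left_mono)
  qed
  \<comment> \<open>Young's inequality with exponents 4/3 and 4, through an explicit factorisation
    of \<open>3 * a ^ 4 + b ^ 4 - 4 * (b * a ^ 3)\<close>. The weights 3/4 and 1/4 sum to one, so
    the Schur test again yields exactly \<open>\<beta> * R\<close>.\<close>
  have young: "b * a ^ 3 \<le> 3 / 4 * a ^ 4 + 1 / 4 * b ^ 4" if "0 \<le> a" "0 \<le> b" for a b :: real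
  proof -
    have "0 \<le> (a - b)\<^sup>2 * (3 * a\<^sup>2 + 2 * a * b + b\<^sup>2)"
      using that by (intro mult_nonneg_nonneg add_nonneg_nonneg) auto
    also have "\<dots> = 3 * a ^ 4 + b ^ 4 - 4 * (b * a ^ 3)"
      by (simp add: power2_eq_square power3_eq_cube power4_eq_xxxx algebra_simps)
    finally show ?thesis by simp
  qed
  have "E M4 = E (\<lambda>\<tau>. \<Sum>i\<in>{1..N}. \<Sum>j\<in>{1..N}. J i j * (\<tau> j * (m \<tau> i) ^ 3))"
  proof (intro gibbs_cong)
    fix \<tau>
    have "(m \<tau> i) ^ 4 = (\<Sum>j\<in>{1..N}. J i j * (\<tau> j * (m \<tau> i) ^ 3))" for i
    proof -
      have "(m \<tau> i) ^ 4 = m \<tau> i * (m \<tau> i) ^ 3"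
        by (simp add: power4_eq_xxxx power3_eq_cube)
      also have "\<dots> = (\<Sum>j\<in>{1..N}. J i j * \<tau> j) * (m \<tau> i) ^ 3"
        by (simp only: local_field_def)
      finally show ?thesis
        by (simp add: sum_distrib_right mult.assoc)
    qed
    then show "M4 \<tau> = (\<Sum>i\<in>{1..N}. \<Sum>j\<in>{1..N}. J i j * (\<tau> j * (m \<tau> i) ^ 3))"
      by (simp add: M4_def)
  qed
  also have "\<dots> = (\<Sum>i\<in>{1..N}. \<Sum>j\<in>{1..N}. J i j * E (\<lambda>\<tau>. \<tau> j * (m \<tau> i) ^ 3))"
    by (simp add: gibbs_sum gibbs_cmult)
  also have "\<dots> \<le> (\<Sum>i\<in>{1..N}. \<Sum>j\<in>{1..N}. J i j *
      E (\<lambda>\<tau>. tanh (\<beta> * m \<tau> j) * (m \<tau> i) ^ 3 + 2 * (J i j * (5 * (m \<tau> i)\<^sup>2 + 3 * (J i j)\<^sup>2))))"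
  proof (intro sum_mono mult_left_mono J_nonneg)
    fix i j assume j: "j \<in> {1..N}"
    show "E (\<lambda>\<tau>. \<tau> j * (m \<tau> i) ^ 3) \<le>
        E (\<lambda>\<tau>. tanh (\<beta> * m \<tau> j) * (m \<tau> i) ^ 3 + 2 * (J i j * (5 * (m \<tau> i)\<^sup>2 + 3 * (J i j)\<^sup>2)))"
    proof (rule spin_times_field_le[OF j])
      fix \<tau> assume \<tau>: "\<tau> \<in> spins N"
      show "\<bar>(m \<tau> i) ^ 3 - (m \<tau> i - J i j * \<tau> j) ^ 3\<bar> \<le> J i j * (5 * (m \<tau> i)\<^sup>2 + 3 * (J i j)\<^sup>2)"
        using cube[of "m \<tau> i" "J i j * \<tau> j"] spins_abs[OF \<tau> j] spins_square[OF \<tau> j]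
        by (simp add: abs_mult J_nonneg power_mult_distrib flip: power2_eq_square)
    qed
  qed
  also have "\<dots> \<le> (\<Sum>i\<in>{1..N}. \<Sum>j\<in>{1..N}. J i j *
      E (\<lambda>\<tau>. \<beta> * (3 / 4 * (m \<tau> i) ^ 4 + 1 / 4 * (m \<tau> j) ^ 4)
         + (10 * \<kappa> * (m \<tau> i)\<^sup>2 + 6 * \<kappa> ^ 3)))"
  proof (intro sum_mono mult_left_mono J_nonneg gibbs_mono add_mono)
    fix i j \<tau>
    have "tanh (\<beta> * m \<tau> j) * (m \<tau> i) ^ 3 \<le> \<bar>tanh (\<beta> * m \<tau> j)\<bar> * \<bar>m \<tau> i\<bar> ^ 3"
      by (simp flip: abs_mult power_abs)
    also have "\<dots> \<le> \<beta> * \<bar>m \<tau> j\<bar> * \<bar>m \<tau> i\<bar> ^ 3"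
      by (intro mult_right_mono abs_tanh_field_le) auto
    also have "\<dots> \<le> \<beta> * (3 / 4 * \<bar>m \<tau> i\<bar> ^ 4 + 1 / 4 * \<bar>m \<tau> j\<bar> ^ 4)"
      unfolding mult.assoc using young[of "\<bar>m \<tau> i\<bar>" "\<bar>m \<tau> j\<bar>"]
      by (intro mult_left_mono \<beta>_nonneg) auto
    finally show "tanh (\<beta> * m \<tau> j) * (m \<tau> i) ^ 3 \<le> \<beta> * (3 / 4 * (m \<tau> i) ^ 4 + 1 / 4 * (m \<tau> j) ^ 4)"
      by simp
    have "J i j * (5 * (m \<tau> i)\<^sup>2 + 3 * (J i j)\<^sup>2) \<le> \<kappa> * (5 * (m \<tau> i)\<^sup>2 + 3 * \<kappa>\<^sup>2)"
      using \<kappa> J_nonneg J_le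
      by (intro mult_mono add_left_mono mult_left_mono power_mono) (auto intro!: add_nonneg_nonneg)
    then show "2 * (J i j * (5 * (m \<tau> i)\<^sup>2 + 3 * (J i j)\<^sup>2)) \<le> 10 * \<kappa> * (m \<tau> i)\<^sup>2 + 6 * \<kappa> ^ 3"
      by (simp add: algebra_simps power2_eq_square power3_eq_cube)
  qed
  also have "\<dots> = E (\<lambda>\<tau>.
      \<beta> * (\<Sum>i\<in>{1..N}. \<Sum>j\<in>{1..N}. J i j * (3 / 4 * (m \<tau> i) ^ 4 + 1 / 4 * (m \<tau> j) ^ 4)) +
      (\<Sum>i\<in>{1..N}. \<Sum>j\<in>{1..N}. J i j * (10 * \<kappa> * (m \<tau> i)\<^sup>2 + 6 * \<kappa> ^ 3)))"
    unfolding gibbs_sum gibbs_cmult gibbs_add gibbs_const distrib_left sum.distrib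
    by (simp add: sum_distrib_left mult_ac)
  also have "\<dots> \<le> E (\<lambda>\<tau>. \<beta> * (R * (3 / 4 * M4 \<tau> + 1 / 4 * M4 \<tau>)) +
      R * (10 * \<kappa> * M2 \<tau> + 6 * (N * \<kappa> ^ 3)))"
  proof (intro gibbs_mono add_mono mult_left_mono \<beta>_nonneg)
    fix \<tau>
    show "(\<Sum>i\<in>{1..N}. \<Sum>j\<in>{1..N}. J i j * (3 / 4 * (m \<tau> i) ^ 4 + 1 / 4 * (m \<tau> j) ^ 4)) \<le>
        R * (3 / 4 * M4 \<tau> + 1 / 4 * M4 \<tau>)"
      using weighted_sum_le[of "\<lambda>i. 3 / 4 * (m \<tau> i) ^ 4" "\<lambda>j. 1 / 4 * (m \<tau> j) ^ 4"]
      unfolding M4_def sum_distrib_left[symmetric] by simp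
    show "(\<Sum>i\<in>{1..N}. \<Sum>j\<in>{1..N}. J i j * (10 * \<kappa> * (m \<tau> i)\<^sup>2 + 6 * \<kappa> ^ 3)) \<le>
        R * (10 * \<kappa> * M2 \<tau> + 6 * (N * \<kappa> ^ 3))"
      using weighted_sum_le[of "\<lambda>i. 10 * \<kappa> * (m \<tau> i)\<^sup>2" "\<lambda>j. 6 * \<kappa> ^ 3"] \<kappa>
      unfolding M2_def sum_distrib_left[symmetric] by simp
  qed
  also have "\<dots> = \<beta> * R * E M4 + (10 * \<kappa> * R * E M2 + 6 * \<kappa> ^ 3 * R * N)"
    unfolding gibbs_add gibbs_cmult gibbs_const by (simp add: algebra_simps)
  finally show ?thesis
    by (simp add: algebra_simps)
qed

text \<open>Write one factor \<open>Q\<close> as the sum of the \<open>m i * r i\<close>. Each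
  residual \<open>r i\<close> has conditional mean zero, so the other factor matters only through
  its change when spin \<open>i\<close> is removed; \<open>B\<close> bounds this change by local
  quantities, which the Schur test sums.\<close>

lemma score_second_moment_le:
  assumes J_le: "\<And>i j. J i j \<le> 1"
  shows "E (\<lambda>\<tau>. (Q \<tau>)\<^sup>2) \<le> (6 + 5 * \<beta> * R) * E M2 + \<beta> * J2"
proof -
  define r where "r \<tau> i = \<tau> i - tanh (\<beta> * m \<tau> i)" for \<tau> i
  \<comment> \<open>\<open>mm i\<close> is the field without spin \<open>i\<close>,
    \<open>rr i\<close> the residual in that field, and \<open>QQ i\<close> the resulting version of
    \<open>Q\<close>. The index \<open>j = i\<close> is left out of \<open>QQ i\<close> because its
    residual contains \<open>\<tau> i\<close>.\<close>
  define mm where "mm i \<tau> j = m \<tau> j - J j i * \<tau> i" for i \<tau> j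
  define rr where "rr i \<tau> j = \<tau> j - tanh (\<beta> * mm i \<tau> j)" for i \<tau> j
  define QQ where "QQ i \<tau> = (\<Sum>j\<in>{1..N} - {i}. mm i \<tau> j * rr i \<tau> j)" for i \<tau>
  define B where "B \<tau> i = 3 * \<bar>m \<tau> i\<bar> + 2 * \<beta> * (\<Sum>j\<in>{1..N}. J i j * \<bar>m \<tau> j\<bar>) +
    \<beta> * (\<Sum>j\<in>{1..N}. (J i j)\<^sup>2)" for \<tau> i
  have r_le: "\<bar>r \<tau> i\<bar> \<le> 2" if "\<tau> \<in> spins N" "i \<in> {1..N}" for \<tau> i
    using spins_abs[OF that] abs_tanh_le_1[of "\<beta> * m \<tau> i"] unfolding r_def by linarith
  have QQ_le: "\<bar>Q \<tau> - QQ i \<tau>\<bar> \<le> B \<tau> i" if \<tau>: "\<tau> \<in> spins N" and i: "i \<in> {1..N}" for \<tau> i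
  proof -
    have "Q \<tau> - QQ i \<tau> = m \<tau> i * r \<tau> i +
        (\<Sum>j\<in>{1..N} - {i}. m \<tau> j * r \<tau> j - mm i \<tau> j * rr i \<tau> j)"
      unfolding Q_def QQ_def r_def sum_subtractf
      by (subst sum.remove[OF finite_atLeastAtMost i]) simp
    \<comment> \<open>The term \<open>j = i\<close> may be put back: \<open>J i i = 0\<close> makes
      the two products equal there.\<close>
    also have "(\<Sum>j\<in>{1..N} - {i}. m \<tau> j * r \<tau> j - mm i \<tau> j * rr i \<tau> j) =
        (\<Sum>j\<in>{1..N}. m \<tau> j * r \<tau> j - mm i \<tau> j * rr i \<tau> j)"
      by (subst sum.remove[OF finite_atLeastAtMost i]) (simp add: mm_def rr_def r_def J_diag)
    also have "\<dots> = (\<Sum>j\<in>{1..N}. \<tau> i * (J i j * rr i \<tau> j) + m \<tau> j * (r \<tau> j - rr i \<tau> j))"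
      by (intro sum.cong) (auto simp: mm_def J_sym[of i] algebra_simps)
    also have "\<dots> = \<tau> i * (\<Sum>j\<in>{1..N}. J i j * rr i \<tau> j) +
        (\<Sum>j\<in>{1..N}. m \<tau> j * (r \<tau> j - rr i \<tau> j))"
      by (simp add: sum.distrib sum_distrib_left)
    also have "(\<Sum>j\<in>{1..N}. J i j * rr i \<tau> j) =
        m \<tau> i - (\<Sum>j\<in>{1..N}. J i j * tanh (\<beta> * mm i \<tau> j))"
      by (simp add: rr_def local_field_def[of N J \<tau> i] right_diff_distrib sum_subtractf)
    finally have eq: "Q \<tau> - QQ i \<tau> = m \<tau> i * r \<tau> i +
        (\<tau> i * (m \<tau> i - (\<Sum>j\<in>{1..N}. J i j * tanh (\<beta> * mm i \<tau> j))) +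
        (\<Sum>j\<in>{1..N}. m \<tau> j * (r \<tau> j - rr i \<tau> j)))" .
    have 1: "\<bar>m \<tau> i * r \<tau> i\<bar> \<le> 2 * \<bar>m \<tau> i\<bar>"
      using mult_left_mono[OF r_le[OF \<tau> i], of "\<bar>m \<tau> i\<bar>"] by (simp add: abs_mult)
    have 2: "\<bar>\<Sum>j\<in>{1..N}. J i j * tanh (\<beta> * mm i \<tau> j)\<bar> \<le>
        \<beta> * (\<Sum>j\<in>{1..N}. J i j * \<bar>m \<tau> j\<bar>) + \<beta> * (\<Sum>j\<in>{1..N}. (J i j)\<^sup>2)"
    proof -
      have "\<bar>J i j * tanh (\<beta> * mm i \<tau> j)\<bar> \<le> J i j * (\<beta> * (\<bar>m \<tau> j\<bar> + J i j))" for j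
      proof -
        have "\<bar>mm i \<tau> j\<bar> \<le> \<bar>m \<tau> j\<bar> + J i j"
          using abs_triangle_ineq4[of "m \<tau> j" "J j i * \<tau> i"] spins_abs[OF \<tau> i]
          by (simp add: mm_def abs_mult J_nonneg J_sym[of i])
        then have "\<bar>tanh (\<beta> * mm i \<tau> j)\<bar> \<le> \<beta> * (\<bar>m \<tau> j\<bar> + J i j)"
          by (intro order_trans[OF abs_tanh_field_le] mult_left_mono \<beta>_nonneg)
        then show ?thesis
          by (simp add: abs_mult J_nonneg mult_left_mono)
      qed
      then have "\<bar>\<Sum>j\<in>{1..N}. J i j * tanh (\<beta> * mm i \<tau> j)\<bar> \<le>
          (\<Sum>j\<in>{1..N}. J i j * (\<beta> * (\<bar>m \<tau> j\<bar> + J i j)))"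
        by (intro order_trans[OF sum_abs] sum_mono) auto
      then show ?thesis
        by (simp add: distrib_left sum.distrib sum_distrib_left power2_eq_square mult_ac)
    qed
    have 3: "\<bar>\<Sum>j\<in>{1..N}. m \<tau> j * (r \<tau> j - rr i \<tau> j)\<bar> \<le>
        \<beta> * (\<Sum>j\<in>{1..N}. J i j * \<bar>m \<tau> j\<bar>)"
    proof -
      have "\<bar>m \<tau> j * (r \<tau> j - rr i \<tau> j)\<bar> \<le> \<beta> * (J i j * \<bar>m \<tau> j\<bar>)" for j
      proof -
        have "\<bar>r \<tau> j - rr i \<tau> j\<bar> \<le> \<bar>\<beta> * mm i \<tau> j - \<beta> * m \<tau> j\<bar>"
          unfolding r_def rr_def
          using abs_tanh_diff_le[of "\<beta> * mm i \<tau> j" "\<beta> * m \<tau> j"] by linarith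
        also have "\<dots> = \<beta> * J i j"
          using spins_abs[OF \<tau> i] \<beta>_nonneg
          by (simp add: mm_def right_diff_distrib abs_mult J_nonneg J_sym[of i])
        finally have "\<bar>m \<tau> j\<bar> * \<bar>r \<tau> j - rr i \<tau> j\<bar> \<le> \<bar>m \<tau> j\<bar> * (\<beta> * J i j)"
          by (intro mult_left_mono) auto
        then show ?thesis
          by (simp add: abs_mult mult_ac)
      qed
      then show ?thesis
        unfolding sum_distrib_left by (intro order_trans[OF sum_abs] sum_mono) auto
    qed
    have 4: "\<bar>\<tau> i * x\<bar> = \<bar>x\<bar>" for x
      using spins_abs[OF \<tau> i] by (simp add: abs_mult)
    show ?thesis
      unfolding eq B_def using 1 2 3 4[of "m \<tau> i - (\<Sum>j\<in>{1..N}. J i j * tanh (\<beta> * mm i \<tau> j))"]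
      unfolding mult.assoc by linarith
  qed
  have "E (\<lambda>\<tau>. (Q \<tau>)\<^sup>2) = E (\<lambda>\<tau>. \<Sum>i\<in>{1..N}. r \<tau> i * (m \<tau> i * Q \<tau>))"
    unfolding power2_eq_square by (subst Q_def) (simp add: r_def sum_distrib_left mult_ac)
  also have "\<dots> = (\<Sum>i\<in>{1..N}. E (\<lambda>\<tau>. r \<tau> i * (m \<tau> i * Q \<tau>)))"
    by (rule gibbs_sum)
  also have "\<dots> = (\<Sum>i\<in>{1..N}. E (\<lambda>\<tau>. r \<tau> i * (m \<tau> i * (Q \<tau> - QQ i \<tau>))))"
  proof (intro sum.cong refl)
    fix i assume i: "i \<in> {1..N}"
    have "E (\<lambda>\<tau>. r \<tau> i * (m \<tau> i * QQ i \<tau>)) = 0"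
      unfolding r_def
    proof (rule conditional_mean_zero[OF i])
      fix \<tau>
      have mm: "mm i (flip i \<tau>) j = mm i \<tau> j" for j
        by (simp add: mm_def local_field_flip[OF i])
      have "QQ i (flip i \<tau>) = QQ i \<tau>"
        unfolding QQ_def rr_def mm by (intro sum.cong) (auto simp: flip_def)
      then show "m (flip i \<tau>) i * QQ i (flip i \<tau>) = m \<tau> i * QQ i \<tau>"
        by (simp add: local_field_flip[OF i] J_diag)
    qed
    then show "E (\<lambda>\<tau>. r \<tau> i * (m \<tau> i * Q \<tau>)) = E (\<lambda>\<tau>. r \<tau> i * (m \<tau> i * (Q \<tau> - QQ i \<tau>)))"
      by (simp add: right_diff_distrib gibbs_diff)
  qed
  also have "\<dots> \<le> (\<Sum>i\<in>{1..N}. E (\<lambda>\<tau>. 2 * (\<bar>m \<tau> i\<bar> * B \<tau> i)))"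
  proof (intro sum_mono gibbs_mono)
    fix i \<tau> assume i: "i \<in> {1..N}" and \<tau>: "\<tau> \<in> spins N"
    have "\<bar>r \<tau> i\<bar> * (\<bar>m \<tau> i\<bar> * \<bar>Q \<tau> - QQ i \<tau>\<bar>) \<le> 2 * (\<bar>m \<tau> i\<bar> * B \<tau> i)"
      using r_le[OF \<tau> i] QQ_le[OF \<tau> i] by (intro mult_mono) auto
    then show "r \<tau> i * (m \<tau> i * (Q \<tau> - QQ i \<tau>)) \<le> 2 * (\<bar>m \<tau> i\<bar> * B \<tau> i)"
      by (simp flip: abs_mult)
  qed
  also have "\<dots> = E (\<lambda>\<tau>. \<Sum>i\<in>{1..N}. 2 * (\<bar>m \<tau> i\<bar> * B \<tau> i))"
    by (rule gibbs_sum[symmetric])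
  also have "\<dots> \<le> E (\<lambda>\<tau>. (6 + 5 * \<beta> * R) * M2 \<tau> + \<beta> * J2)"
  proof (rule gibbs_mono)
    fix \<tau>
    have eq: "(\<Sum>i\<in>{1..N}. 2 * (\<bar>m \<tau> i\<bar> * B \<tau> i)) = 6 * M2 \<tau> +
        4 * \<beta> * (\<Sum>i\<in>{1..N}. \<Sum>j\<in>{1..N}. J i j * (\<bar>m \<tau> i\<bar> * \<bar>m \<tau> j\<bar>)) +
        2 * \<beta> * (\<Sum>i\<in>{1..N}. \<Sum>j\<in>{1..N}. (J i j)\<^sup>2 * \<bar>m \<tau> i\<bar>)"
      unfolding B_def M2_def
      by (simp add: distrib_left sum.distrib sum_distrib_left power2_eq_square mult_ac)
    have "(\<Sum>i\<in>{1..N}. \<Sum>j\<in>{1..N}. J i j * (\<bar>m \<tau> i\<bar> * \<bar>m \<tau> j\<bar>)) \<le>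
        (\<Sum>i\<in>{1..N}. \<Sum>j\<in>{1..N}. J i j * ((m \<tau> i)\<^sup>2 / 2 + (m \<tau> j)\<^sup>2 / 2))"
    proof (intro sum_mono mult_left_mono J_nonneg)
      fix i j
      show "\<bar>m \<tau> i\<bar> * \<bar>m \<tau> j\<bar> \<le> (m \<tau> i)\<^sup>2 / 2 + (m \<tau> j)\<^sup>2 / 2"
        using sum_squares_bound[of "\<bar>m \<tau> i\<bar>" "\<bar>m \<tau> j\<bar>"] by simp
    qed
    also have "\<dots> \<le> R * M2 \<tau>"
      using weighted_sum_le[of "\<lambda>i. (m \<tau> i)\<^sup>2 / 2" "\<lambda>i. (m \<tau> i)\<^sup>2 / 2"]
      unfolding M2_def sum_divide_distrib[symmetric] by simp
    finally have 1: "4 * \<beta> * (\<Sum>i\<in>{1..N}. \<Sum>j\<in>{1..N}. J i j * (\<bar>m \<tau> i\<bar> * \<bar>m \<tau> j\<bar>)) \<le>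
        4 * \<beta> * (R * M2 \<tau>)"
      using \<beta>_nonneg by (intro mult_left_mono) auto
    \<comment> \<open>After AM-GM a cubic term in \<open>J\<close> is left over, and
      \<open>J_le\<close> lowers it to \<open>J2\<close>. The summand 0 fits the shape of
      \<open>weighted_sum_le\<close>.\<close>
    have "(\<Sum>i\<in>{1..N}. \<Sum>j\<in>{1..N}. (J i j)\<^sup>2 * \<bar>m \<tau> i\<bar>) \<le>
        (\<Sum>i\<in>{1..N}. \<Sum>j\<in>{1..N}. (J i j)\<^sup>2 / 2 + J i j * ((m \<tau> i)\<^sup>2 / 2 + 0))"
    proof (intro sum_mono)
      fix i j
      have "(J i j)\<^sup>2 * \<bar>m \<tau> i\<bar> = J i j * (J i j * \<bar>m \<tau> i\<bar>)"
        by (simp add: power2_eq_square)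
      also have "\<dots> \<le> J i j * ((J i j)\<^sup>2 / 2 + (m \<tau> i)\<^sup>2 / 2)"
        using sum_squares_bound[of "J i j" "\<bar>m \<tau> i\<bar>"] by (intro mult_left_mono J_nonneg) simp
      also have "\<dots> \<le> (J i j)\<^sup>2 / 2 + J i j * ((m \<tau> i)\<^sup>2 / 2 + 0)"
        using mult_right_mono[OF J_le[of i j], of "(J i j)\<^sup>2 / 2"] by (simp add: algebra_simps)
      finally show "(J i j)\<^sup>2 * \<bar>m \<tau> i\<bar> \<le> (J i j)\<^sup>2 / 2 + J i j * ((m \<tau> i)\<^sup>2 / 2 + 0)" .
    qed
    also have "\<dots> \<le> J2 / 2 + R * (M2 \<tau> / 2)"
      using weighted_sum_le[of "\<lambda>i. (m \<tau> i)\<^sup>2 / 2" "\<lambda>i. 0"]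
      unfolding M2_def J2_def sum.distrib sum_divide_distrib[symmetric] by simp
    finally have 2: "2 * \<beta> * (\<Sum>i\<in>{1..N}. \<Sum>j\<in>{1..N}. (J i j)\<^sup>2 * \<bar>m \<tau> i\<bar>) \<le>
        2 * \<beta> * (J2 / 2 + R * (M2 \<tau> / 2))"
      using \<beta>_nonneg by (intro mult_left_mono) auto
    show "(\<Sum>i\<in>{1..N}. 2 * (\<bar>m \<tau> i\<bar> * B \<tau> i)) \<le> (6 + 5 * \<beta> * R) * M2 \<tau> + \<beta> * J2"
      using 1 2 unfolding eq by (simp add: algebra_simps)
  qed
  also have "\<dots> = (6 + 5 * \<beta> * R) * E M2 + \<beta> * J2"
    by (simp add: gibbs_add gibbs_cmult)
  finally show ?thesis .
qed

end

section \<open>Lower bounds for the free energy\<close>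

definition spin_avg :: "nat \<Rightarrow> ((nat \<Rightarrow> real) \<Rightarrow> real) \<Rightarrow> real" where
  "spin_avg N f = (\<Sum>\<tau>\<in>spins N. f \<tau>) / 2 ^ N"

lemma card_spins: "card (spins N) = 2 ^ N"
  unfolding spins_def by (subst card_PiE) (auto simp: card_insert_if numeral_2_eq_2)

lemma spin_avg_const: "spin_avg N (\<lambda>_. c) = c"
  by (simp add: spin_avg_def card_spins)

lemma spin_avg_add: "spin_avg N (\<lambda>\<tau>. f \<tau> + g \<tau>) = spin_avg N f + spin_avg N g"
  by (simp add: spin_avg_def sum.distrib add_divide_distrib)

lemma spin_avg_diff: "spin_avg N (\<lambda>\<tau>. f \<tau> - g \<tau>) = spin_avg N f - spin_avg N g"
  by (simp add: spin_avg_def sum_subtractf diff_divide_distrib)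

lemma spin_avg_cmult: "spin_avg N (\<lambda>\<tau>. c * f \<tau>) = c * spin_avg N f"
  by (simp add: spin_avg_def sum_distrib_left)

lemma spin_avg_sum: "spin_avg N (\<lambda>\<tau>. \<Sum>i\<in>A. f i \<tau>) = (\<Sum>i\<in>A. spin_avg N (f i))"
  unfolding spin_avg_def by (subst sum.swap) (simp add: sum_divide_distrib)

lemma spin_avg_mono:
  "(\<And>\<tau>. \<tau> \<in> spins N \<Longrightarrow> f \<tau> \<le> g \<tau>) \<Longrightarrow> spin_avg N f \<le> spin_avg N g"
  unfolding spin_avg_def by (intro divide_right_mono sum_mono) auto

lemma spin_avg_cong:
  "(\<And>\<tau>. \<tau> \<in> spins N \<Longrightarrow> f \<tau> = g \<tau>) \<Longrightarrow> spin_avg N f = spin_avg N g"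
  unfolding spin_avg_def by (intro arg_cong2[where f = "(/)"] sum.cong) auto

text \<open>Independence of the spins under the uniform measure.\<close>

lemma spin_avg_prod:
  "spin_avg N (\<lambda>\<tau>. \<Prod>k\<in>{1..N}. f k (\<tau> k)) = (\<Prod>k\<in>{1..N}. (f k 1 + f k (- 1)) / 2)"
proof -
  have "(\<Sum>\<tau>\<in>spins N. \<Prod>k\<in>{1..N}. f k (\<tau> k)) = (\<Prod>k\<in>{1..N}. \<Sum>s\<in>{-1, 1}. f k s)"
    unfolding spins_def by (rule prod_sum_PiE[symmetric]) auto
  then show ?thesis
    by (simp add: spin_avg_def prod_dividef add.commute)
qed

lemma exp_log_partition:
  "exp (log_partition N J \<beta>) = spin_avg N (\<lambda>\<tau>. exp (1 / 2 * \<beta> * hamiltonian N J \<tau>))"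
proof -
  have "0 < (1 / 2) ^ N * (\<Sum>\<tau>\<in>spins N. exp (1 / 2 * \<beta> * hamiltonian N J \<tau>))"
    by (intro mult_pos_pos sum_pos finite_spins spins_nonempty) auto
  then show ?thesis
    by (simp add: log_partition_def spin_avg_def power_one_over)
qed

text \<open>On \<open>{H \<le> C}\<close> the Gibbs weight is at most \<open>exp (\<beta> C / 2 - F)\<close> times the uniform one.\<close>

lemma prob_ising_le_card:
  assumes "0 \<le> \<beta>"
  shows "measure_pmf.prob (ising N J \<beta>) {\<tau>. \<tau> \<in> A \<and> hamiltonian N J \<tau> \<le> C} \<le>
    exp (1 / 2 * \<beta> * C - log_partition N J \<beta>) * (card (A \<inter> spins N) / 2 ^ N)"
proof -
  let ?S = "{\<tau>. \<tau> \<in> A \<and> hamiltonian N J \<tau> \<le> C} \<inter> spins N"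
  have "measure_pmf.prob (ising N J \<beta>) {\<tau>. \<tau> \<in> A \<and> hamiltonian N J \<tau> \<le> C} \<le>
      (\<Sum>\<tau>\<in>?S. (1 / 2) ^ N * exp (1 / 2 * \<beta> * C - log_partition N J \<beta>))"
    unfolding prob_ising using assms
    by (intro sum_mono) (auto simp: pmf_ising intro!: mult_left_mono)
  also have "\<dots> \<le> (\<Sum>\<tau>\<in>A \<inter> spins N. (1 / 2) ^ N * exp (1 / 2 * \<beta> * C - log_partition N J \<beta>))"
    by (intro sum_mono2) (auto simp: finite_spins)
  finally show ?thesis
    by (simp add: power_one_over field_simps)
qed

lemma sinh_ge_self:
  fixes x :: real
  assumes "0 \<le> x"
  shows "x \<le> sinh x"
proof -
  have "(\<lambda>y. sinh y - y) 0 \<le> (\<lambda>y. sinh y - y) x"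
    by (rule DERIV_nonneg_imp_nondecreasing[OF assms])
      (auto intro!: derivative_eq_intros exI simp: cosh_real_ge_1)
  then show ?thesis by simp
qed

text \<open>Since cosh x = 1 + 2 sinh^2 (x/2) is at least 1 + x^2/2, the smaller exponent x^2/4
  leaves room for the quadratic error of the exponential on the unit interval.\<close>

lemma cosh_ge_exp_square:
  fixes x :: real
  assumes "0 \<le> x" "x \<le> 1"
  shows "exp (x\<^sup>2 / 4) \<le> cosh x"
proof -
  have x2: "x\<^sup>2 \<le> 1"
    using assms by (simp add: power_le_one)
  have x4: "(x\<^sup>2)\<^sup>2 \<le> x\<^sup>2"
    using mult_left_mono[OF x2, of "x\<^sup>2"] unfolding power2_eq_square[of "x\<^sup>2"] by simp
  have "exp (x\<^sup>2 / 4) \<le> 1 + x\<^sup>2 / 4 + (x\<^sup>2 / 4)\<^sup>2"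
    using x2 by (intro exp_bound) auto
  also have "\<dots> \<le> 1 + x\<^sup>2 / 4 + x\<^sup>2 / 4"
    using x4 unfolding power_divide by simp (use zero_le_power2[of x] in linarith)
  also have "\<dots> = 1 + 2 * (x / 2)\<^sup>2"
    by (simp add: power2_eq_square)
  also have "\<dots> \<le> 1 + 2 * (sinh (x / 2))\<^sup>2"
    using assms sinh_ge_self[of "x / 2"] by (intro add_left_mono mult_left_mono power_mono) auto
  also have "\<dots> = cosh x"
    using cosh_double[of "x / 2"] cosh_square_eq[of "x / 2"] by simp
  finally show ?thesis .
qed

text \<open>Griffiths' first inequality: expanding the product gives monomials in the spins, each of
  nonnegative average.\<close>

lemma griffiths_prod_ge:
  fixes n :: "nat \<Rightarrow> nat" and c :: "nat \<times> nat \<Rightarrow> real"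
  assumes "finite S" "S \<subseteq> {1..N} \<times> {1..N}" and "\<And>e. 0 \<le> c e"
  shows "0 \<le> spin_avg N (\<lambda>\<tau>. \<Prod>k\<in>{1..N}. \<tau> k ^ n k) \<and>
    spin_avg N (\<lambda>\<tau>. \<Prod>k\<in>{1..N}. \<tau> k ^ n k) \<le>
    spin_avg N (\<lambda>\<tau>. (\<Prod>k\<in>{1..N}. \<tau> k ^ n k) * (\<Prod>e\<in>S. 1 + c e * (\<tau> (fst e) * \<tau> (snd e))))"
  using assms(1,2)
proof (induction S arbitrary: n rule: finite_induct)
  case empty
  have "0 \<le> (\<Prod>k\<in>{1..N}. (1 ^ n k + (- 1) ^ n k) / (2 :: real))"
  proof (intro prod_nonneg)
    fix k
    show "0 \<le> (1 ^ n k + (- 1) ^ n k) / (2 :: real)"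
      \<comment> \<open>An odd exponent gives the factor 0 and an even one the factor 1.\<close>
      by (cases "even (n k)") auto
  qed
  then have "0 \<le> spin_avg N (\<lambda>\<tau>. \<Prod>k\<in>{1..N}. \<tau> k ^ n k)"
    by (subst spin_avg_prod[where f = "\<lambda>k s. s ^ n k"])
  then show ?case
    by simp
next
  case (insert e S)
  obtain i j where e: "e = (i, j)" by (cases e)
  have i: "i \<in> {1..N}" and j: "j \<in> {1..N}"
    using insert.prems e by auto
  define P where "P \<tau> = (\<Prod>e\<in>S. 1 + c e * (\<tau> (fst e) * \<tau> (snd e)))" for \<tau> :: "nat \<Rightarrow> real"
  \<comment> \<open>The edge monomial is absorbed into the exponents, which rise by two when
    \<open>i = j\<close>. The induction keeps \<open>n\<close> arbitrary so that its hypothesis also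
    applies to \<open>n'\<close>.\<close>
  define n' where "n' k = n k + (if k = i then 1 else 0) + (if k = j then 1 else 0)" for k
  have mono: "(\<Prod>k\<in>{1..N}. \<tau> k ^ n' k) = (\<Prod>k\<in>{1..N}. \<tau> k ^ n k) * (\<tau> i * \<tau> j)"
    for \<tau> :: "nat \<Rightarrow> real"
  proof -
    have "\<tau> k ^ n' k = \<tau> k ^ n k * (if k = i then \<tau> i else 1) * (if k = j then \<tau> j else 1)" for k
      by (auto simp: n'_def)
    then show ?thesis
      using i j by (simp add: prod.distrib mult.assoc)
  qed
  have "spin_avg N (\<lambda>\<tau>. (\<Prod>k\<in>{1..N}. \<tau> k ^ n k) * (\<Prod>e\<in>insert e S. 1 + c e * (\<tau> (fst e) * \<tau> (snd e)))) =
      spin_avg N (\<lambda>\<tau>. (\<Prod>k\<in>{1..N}. \<tau> k ^ n k) * P \<tau> + c e * ((\<Prod>k\<in>{1..N}. \<tau> k ^ n' k) * P \<tau>))"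
    using insert.hyps unfolding mono P_def e by (intro spin_avg_cong) (simp add: algebra_simps)
  also have "\<dots> = spin_avg N (\<lambda>\<tau>. (\<Prod>k\<in>{1..N}. \<tau> k ^ n k) * P \<tau>) +
      c e * spin_avg N (\<lambda>\<tau>. (\<Prod>k\<in>{1..N}. \<tau> k ^ n' k) * P \<tau>)"
    by (simp only: spin_avg_add spin_avg_cmult)
  finally have eq: "spin_avg N (\<lambda>\<tau>. (\<Prod>k\<in>{1..N}. \<tau> k ^ n k) *
        (\<Prod>e\<in>insert e S. 1 + c e * (\<tau> (fst e) * \<tau> (snd e)))) = \<dots>" .
  have "0 \<le> c e * spin_avg N (\<lambda>\<tau>. (\<Prod>k\<in>{1..N}. \<tau> k ^ n' k) * P \<tau>)"
    using insert.IH[of n'] insert.prems assms(3) unfolding P_def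
    by (intro mult_nonneg_nonneg) auto
  then show ?case
    unfolding eq using insert.IH[of n] insert.prems unfolding P_def by auto
qed

text \<open>The difference of the two sides has derivative y^3 / (1 + y), which has the sign of y,
  so its minimum is the value 0 at the origin. It controls the entropy in the mean-field
  bound.\<close>

lemma ln_one_plus_le:
  fixes x :: real
  assumes "- 1 < x"
  shows "ln (1 + x) \<le> x - x\<^sup>2 / 2 + x ^ 3 / 3"
proof -
  define h where "h y = y - y\<^sup>2 / 2 + y ^ 3 / 3 - ln (1 + y)" for y :: real
  have D: "DERIV h y :> y ^ 3 / (1 + y)" if "- 1 < y" for y
    unfolding h_def using that
    by (auto intro!: derivative_eq_intros simp: field_simps power2_eq_square power3_eq_cube)
  have "h 0 \<le> h x"
  proof (cases "0 \<le> x")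
    case True
    show ?thesis
    proof (rule DERIV_nonneg_imp_nondecreasing[OF True])
      fix y :: real assume "0 \<le> y"
      then show "\<exists>d. DERIV h y :> d \<and> 0 \<le> d"
        using D[of y] by (intro exI[of _ "y ^ 3 / (1 + y)"]) auto
    qed
  next
    case False
    then have "x \<le> 0" by simp
    then show ?thesis
    proof (rule DERIV_nonpos_imp_nonincreasing)
      fix y assume y: "x \<le> y" "y \<le> 0"
      then have "y ^ 3 \<le> 0"
        by (simp add: power3_eq_cube mult_nonneg_nonpos)
      then show "\<exists>d. DERIV h y :> d \<and> d \<le> 0"
        using D[of y] y assms by (intro exI[of _ "y ^ 3 / (1 + y)"]) (auto simp: divide_le_0_iff)
    qed
  qed
  then show ?thesis
    by (simp add: h_def)
qed

context ising_system
begin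

text \<open>For a sign \<open>s\<close>, exp (x s) = cosh x (1 + s tanh x). Griffiths' inequality
  bounds the average of the product of the second factors below by one, and the hyperbolic cosines
  give the exponent: with \<open>x = \<beta> * J / 2\<close>, \<open>x\<^sup>2 / 4\<close> is
  \<open>\<beta>\<^sup>2 / 16\<close> times the squared coupling.\<close>

lemma log_partition_ge:
  assumes "\<And>i j. 1 / 2 * \<beta> * J i j \<le> 1"
  shows "\<beta>\<^sup>2 / 16 * J2 \<le> log_partition N J \<beta>"
proof -
  define x where "x e = 1 / 2 * \<beta> * J (fst e) (snd e)" for e
  let ?S = "{1..N} \<times> {1..N}"
  have x: "0 \<le> x e" "x e \<le> 1" for e
    using assms J_nonneg \<beta>_nonneg by (auto simp: x_def)
  have exp_spin: "exp (y * s) = cosh y * (1 + tanh y * s)" if "s = 1 \<or> s = - 1" for y s :: real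
    using that
  proof
    assume "s = 1"
    then show ?thesis
      by (simp add: tanh_def distrib_left cosh_plus_sinh)
  next
    assume "s = - 1"
    then show ?thesis
      by (simp add: tanh_def right_diff_distrib cosh_minus_sinh)
  qed
  have "exp (\<beta>\<^sup>2 / 16 * J2) = (\<Prod>e\<in>?S. exp ((x e)\<^sup>2 / 4))"
    by (simp add: J2_def x_def sum.cartesian_product' sum_distrib_left power_mult_distrib
        power_divide mult_ac flip: exp_sum)
  also have "\<dots> \<le> (\<Prod>e\<in>?S. cosh (x e))"
    using x by (intro prod_mono) (auto intro: cosh_ge_exp_square)
  \<comment> \<open>The empty monomial, of average one, is the starting point for
    \<open>griffiths_prod_ge\<close>.\<close>
  also have "\<dots> = (\<Prod>e\<in>?S. cosh (x e)) * spin_avg N (\<lambda>\<tau>. \<Prod>k\<in>{1..N}. \<tau> k ^ 0)"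
    by (simp add: spin_avg_const)
  also have "\<dots> \<le> (\<Prod>e\<in>?S. cosh (x e)) * spin_avg N (\<lambda>\<tau>. (\<Prod>k\<in>{1..N}. \<tau> k ^ 0) *
      (\<Prod>e\<in>?S. 1 + tanh (x e) * (\<tau> (fst e) * \<tau> (snd e))))"
    using griffiths_prod_ge[of ?S N "\<lambda>e. tanh (x e)" "\<lambda>_. 0"] x
    by (intro mult_left_mono prod_nonneg) auto
  also have "\<dots> = spin_avg N (\<lambda>\<tau>. \<Prod>e\<in>?S. cosh (x e) * (1 + tanh (x e) * (\<tau> (fst e) * \<tau> (snd e))))"
    by (simp add: prod.distrib spin_avg_cmult)
  also have "\<dots> = spin_avg N (\<lambda>\<tau>. exp (1 / 2 * \<beta> * H \<tau>))"
  proof (rule spin_avg_cong)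
    fix \<tau> assume \<tau>: "\<tau> \<in> spins N"
    have "(\<Prod>e\<in>?S. cosh (x e) * (1 + tanh (x e) * (\<tau> (fst e) * \<tau> (snd e)))) =
        (\<Prod>e\<in>?S. exp (x e * (\<tau> (fst e) * \<tau> (snd e))))"
    proof (intro prod.cong refl exp_spin[symmetric])
      fix e assume "e \<in> ?S"
      then have "fst e \<in> {1..N}" "snd e \<in> {1..N}" by auto
      then show "\<tau> (fst e) * \<tau> (snd e) = 1 \<or> \<tau> (fst e) * \<tau> (snd e) = - 1"
        using spins_range[OF \<tau>, of "fst e"] spins_range[OF \<tau>, of "snd e"] by auto
    qed
    also have "\<dots> = exp (1 / 2 * \<beta> * H \<tau>)"
      by (simp add: hamiltonian_def x_def sum.cartesian_product' sum_distrib_left mult_ac flip: exp_sum)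
    finally show "(\<Prod>e\<in>?S. cosh (x e) * (1 + tanh (x e) * (\<tau> (fst e) * \<tau> (snd e)))) =
      exp (1 / 2 * \<beta> * H \<tau>)" .
  qed
  also have "\<dots> = exp (log_partition N J \<beta>)"
    by (simp add: exp_log_partition)
  finally show ?thesis by simp
qed

text \<open>Gibbs' variational principle for the product measure with mean spin \<open>t\<close>.\<close>

lemma log_partition_ge_mean_field:
  assumes t: "0 < t" "t < 1"
  shows "1 / 2 * \<beta> * t\<^sup>2 * (\<Sum>i\<in>{1..N}. \<Sum>j\<in>{1..N}. J i j) - N * (t\<^sup>2 / 2 + t ^ 4 / 3)
    \<le> log_partition N J \<beta>"
proof -
  \<comment> \<open>The density, relative to the uniform measure, of independent spins that are +1
    with probability \<open>(1 + t) / 2\<close>.\<close>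
  define w where "w \<tau> = (\<Prod>k\<in>{1..N}. 1 + t * \<tau> k)" for \<tau> :: "nat \<Rightarrow> real"
  have pos: "0 < 1 + t * \<tau> k" if "\<tau> \<in> spins N" "k \<in> {1..N}" for \<tau> k
    using spins_range[OF that] t by auto
  have w_pos: "0 < w \<tau>" if "\<tau> \<in> spins N" for \<tau>
    unfolding w_def using pos[OF that] by (intro prod_pos) auto
  have w_one: "spin_avg N w = 1"
    unfolding w_def by (subst spin_avg_prod[where f = "\<lambda>k s. 1 + t * s"]) simp
  have w_single: "spin_avg N (\<lambda>\<tau>. w \<tau> * g (\<tau> k)) = ((1 + t) * g 1 + (1 - t) * g (- 1)) / 2"
    if k: "k \<in> {1..N}" for g k
  proof -
    have "spin_avg N (\<lambda>\<tau>. w \<tau> * g (\<tau> k)) =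
        spin_avg N (\<lambda>\<tau>. \<Prod>l\<in>{1..N}. (1 + t * \<tau> l) * (if l = k then g (\<tau> l) else 1))"
      using k by (intro spin_avg_cong) (simp add: w_def prod.distrib)
    also have "\<dots> = (\<Prod>l\<in>{1..N}. ((1 + t * 1) * (if l = k then g 1 else 1) +
        (1 + t * (- 1)) * (if l = k then g (- 1) else 1)) / 2)"
      by (rule spin_avg_prod[where f = "\<lambda>l s. (1 + t * s) * (if l = k then g s else 1)"])
    also have "\<dots> = (\<Prod>l\<in>{1..N}. if l = k then ((1 + t) * g 1 + (1 - t) * g (- 1)) / 2 else 1)"
      by (intro prod.cong) auto
    also have "\<dots> = ((1 + t) * g 1 + (1 - t) * g (- 1)) / 2"
      using k by simp
    finally show ?thesis .
  qed
  have w_pair: "spin_avg N (\<lambda>\<tau>. w \<tau> * (\<tau> i * \<tau> j)) = t\<^sup>2"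
    if i: "i \<in> {1..N}" and j: "j \<in> {1..N}" and "i \<noteq> j" for i j
  proof -
    let ?f = "\<lambda>l s. (1 + t * s) * (if l = i then s else 1) * (if l = j then s else 1)"
    have "spin_avg N (\<lambda>\<tau>. w \<tau> * (\<tau> i * \<tau> j)) = spin_avg N (\<lambda>\<tau>. \<Prod>l\<in>{1..N}. ?f l (\<tau> l))"
      using i j by (intro spin_avg_cong) (simp add: w_def prod.distrib mult.assoc)
    also have "\<dots> = (\<Prod>l\<in>{1..N}. (?f l 1 + ?f l (- 1)) / 2)"
      by (rule spin_avg_prod)
    also have "\<dots> = (\<Prod>l\<in>{1..N}. (if l = i then t else 1) * (if l = j then t else 1))"
      using \<open>i \<noteq> j\<close> by (intro prod.cong) auto
    also have "\<dots> = t\<^sup>2"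
      using i j by (simp add: prod.distrib power2_eq_square)
    finally show ?thesis .
  qed
  \<comment> \<open>\<open>X\<close> is the log-ratio of the Gibbs integrand and \<open>w\<close>;
    its mean \<open>a\<close> under the product measure is energy minus relative entropy.\<close>
  define X where "X \<tau> = 1 / 2 * \<beta> * H \<tau> - ln (w \<tau>)" for \<tau>
  define a where "a = spin_avg N (\<lambda>\<tau>. w \<tau> * X \<tau>)"
  \<comment> \<open>Jensen's inequality via the tangent line at \<open>a\<close>: exp X is at least
    exp a (1 + X - a), and the right side has mean exp a under \<open>w\<close>.\<close>
  have "exp a = exp a * spin_avg N (\<lambda>\<tau>. w \<tau> + w \<tau> * X \<tau> - a * w \<tau>)"
    by (simp only: spin_avg_add spin_avg_diff spin_avg_cmult w_one flip: a_def) simp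
  also have "\<dots> = spin_avg N (\<lambda>\<tau>. w \<tau> * (exp a * (1 + (X \<tau> - a))))"
    unfolding spin_avg_cmult[symmetric] by (intro spin_avg_cong) (simp add: algebra_simps)
  also have "\<dots> \<le> spin_avg N (\<lambda>\<tau>. exp (1 / 2 * \<beta> * H \<tau>))"
  proof (rule spin_avg_mono)
    fix \<tau> assume \<tau>: "\<tau> \<in> spins N"
    have "w \<tau> * (exp a * (1 + (X \<tau> - a))) \<le> w \<tau> * (exp a * exp (X \<tau> - a))"
      using w_pos[OF \<tau>] exp_ge_add_one_self[of "X \<tau> - a"] by (intro mult_left_mono) auto
    also have "\<dots> = w \<tau> * exp (X \<tau>)"
      by (simp flip: exp_add)
    also have "\<dots> = exp (1 / 2 * \<beta> * H \<tau>)"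
      using w_pos[OF \<tau>] by (simp add: X_def exp_diff)
    finally show "w \<tau> * (exp a * (1 + (X \<tau> - a))) \<le> exp (1 / 2 * \<beta> * H \<tau>)" .
  qed
  finally have "a \<le> log_partition N J \<beta>"
    unfolding exp_log_partition[symmetric] by simp
  moreover have "1 / 2 * \<beta> * t\<^sup>2 * (\<Sum>i\<in>{1..N}. \<Sum>j\<in>{1..N}. J i j) - N * (t\<^sup>2 / 2 + t ^ 4 / 3) \<le> a"
  proof -
    have "a = spin_avg N (\<lambda>\<tau>. 1 / 2 * \<beta> * (\<Sum>i\<in>{1..N}. \<Sum>j\<in>{1..N}. J i j * (w \<tau> * (\<tau> i * \<tau> j))) -
        (\<Sum>k\<in>{1..N}. w \<tau> * ln (1 + t * \<tau> k)))"
      unfolding a_def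
    proof (rule spin_avg_cong)
      fix \<tau> assume \<tau>: "\<tau> \<in> spins N"
      have "ln (w \<tau>) = (\<Sum>k\<in>{1..N}. ln (1 + t * \<tau> k))"
        unfolding w_def using pos[OF \<tau>] by (intro ln_prod finite_atLeastAtMost) (metis less_irrefl)
      moreover have "w \<tau> * H \<tau> = (\<Sum>i\<in>{1..N}. \<Sum>j\<in>{1..N}. J i j * (w \<tau> * (\<tau> i * \<tau> j)))"
        by (simp add: hamiltonian_def sum_distrib_left mult_ac)
      ultimately show "w \<tau> * X \<tau> = 1 / 2 * \<beta> * (\<Sum>i\<in>{1..N}. \<Sum>j\<in>{1..N}. J i j * (w \<tau> * (\<tau> i * \<tau> j))) -
          (\<Sum>k\<in>{1..N}. w \<tau> * ln (1 + t * \<tau> k))"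
        by (simp add: X_def right_diff_distrib flip: sum_distrib_left)
    qed
    also have "\<dots> = 1 / 2 * \<beta> * (\<Sum>i\<in>{1..N}. \<Sum>j\<in>{1..N}. J i j * spin_avg N (\<lambda>\<tau>. w \<tau> * (\<tau> i * \<tau> j))) -
        (\<Sum>k\<in>{1..N}. spin_avg N (\<lambda>\<tau>. w \<tau> * ln (1 + t * \<tau> k)))"
      by (simp only: spin_avg_diff spin_avg_cmult spin_avg_sum)
    \<comment> \<open>On the diagonal the spin product has mean 1 instead of
      \<open>t\<^sup>2\<close>, but \<open>J i i = 0\<close> hides this.\<close>
    also have "(\<Sum>i\<in>{1..N}. \<Sum>j\<in>{1..N}. J i j * spin_avg N (\<lambda>\<tau>. w \<tau> * (\<tau> i * \<tau> j))) =
        (\<Sum>i\<in>{1..N}. \<Sum>j\<in>{1..N}. J i j * t\<^sup>2)"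
    proof (intro sum.cong refl)
      fix i j assume "i \<in> {1..N}" "j \<in> {1..N}"
      then show "J i j * spin_avg N (\<lambda>\<tau>. w \<tau> * (\<tau> i * \<tau> j)) = J i j * t\<^sup>2"
        using w_pair[of i j] by (cases "i = j") (auto simp: J_diag)
    qed
    also have "(\<Sum>k\<in>{1..N}. spin_avg N (\<lambda>\<tau>. w \<tau> * ln (1 + t * \<tau> k))) =
        N * (((1 + t) * ln (1 + t) + (1 - t) * ln (1 - t)) / 2)"
      by (subst sum.cong[OF refl w_single[where g = "\<lambda>s. ln (1 + t * s)"]]) auto
    finally have a: "a = 1 / 2 * \<beta> * (\<Sum>i\<in>{1..N}. \<Sum>j\<in>{1..N}. J i j * t\<^sup>2) -
        N * (((1 + t) * ln (1 + t) + (1 - t) * ln (1 - t)) / 2)" .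
    \<comment> \<open>Third-order bounds on both logarithms; in the sum the odd powers of
      \<open>t\<close> cancel.\<close>
    have "(1 + t) * ln (1 + t) \<le> (1 + t) * (t - t\<^sup>2 / 2 + t ^ 3 / 3)"
      using t by (intro mult_left_mono ln_one_plus_le) auto
    moreover have "(1 - t) * ln (1 - t) \<le> (1 - t) * (- t - t\<^sup>2 / 2 - t ^ 3 / 3)"
      using t ln_one_plus_le[of "- t"] by (intro mult_left_mono) auto
    moreover have "(1 + t) * (t - t\<^sup>2 / 2 + t ^ 3 / 3) + (1 - t) * (- t - t\<^sup>2 / 2 - t ^ 3 / 3) =
        t\<^sup>2 + 2 * t ^ 4 / 3"
      by (simp add: field_simps power2_eq_square power3_eq_cube power4_eq_xxxx)
    moreover have "(x + y) / 2 \<le> t\<^sup>2 / 2 + t ^ 4 / 3"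
      if "x \<le> u" "y \<le> v" "u + v = t\<^sup>2 + 2 * t ^ 4 / 3" for x y u v :: real
      using that by (simp add: field_simps)
    ultimately have "((1 + t) * ln (1 + t) + (1 - t) * ln (1 - t)) / 2 \<le> t\<^sup>2 / 2 + t ^ 4 / 3"
      by blast
    then have "N * (((1 + t) * ln (1 + t) + (1 - t) * ln (1 - t)) / 2) \<le> N * (t\<^sup>2 / 2 + t ^ 4 / 3)"
      by (intro mult_left_mono) auto
    moreover have "(\<Sum>i\<in>{1..N}. \<Sum>j\<in>{1..N}. J i j * t\<^sup>2) = t\<^sup>2 * (\<Sum>i\<in>{1..N}. \<Sum>j\<in>{1..N}. J i j)"
      by (simp add: sum_distrib_left mult.commute)
    ultimately show ?thesis
      unfolding a by (simp add: mult.assoc)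
  qed
  ultimately show ?thesis by linarith
qed

end

section \<open>A small-ball estimate\<close>

lemma cos_ge_quadratic: "1 - u\<^sup>2 / 2 \<le> cos u" for u :: real
proof -
  have "(sin (u / 2))\<^sup>2 \<le> (u / 2)\<^sup>2"
    using abs_sin_x_le_abs_x[of "u / 2"] by (simp only: abs_le_square_iff)
  then show ?thesis
    using cos_double_sin[of "u / 2"] by (simp add: power_divide)
qed

text \<open>With half angle v at most 1/2, cos is at least 7/8 on [0, v], hence sin v is at least
  3v/4; cos (2v) = 1 - 2 sin^2 v then gives the quadratic decay.\<close>

lemma abs_cos_le_exp:
  fixes u :: real
  assumes "\<bar>u\<bar> \<le> 1"
  shows "\<bar>cos u\<bar> \<le> exp (- (u\<^sup>2 / 4))"
proof -
  define v where "v = \<bar>u\<bar> / 2"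
  have v: "0 \<le> v" "v \<le> 1 / 2"
    using assms by (auto simp: v_def)
  have "sin 0 - 3 / 4 * 0 \<le> sin v - 3 / 4 * v"
  proof (rule DERIV_nonneg_imp_nondecreasing[OF v(1), of "\<lambda>y. sin y - 3 / 4 * y"])
    fix y assume y: "0 \<le> y" "y \<le> v"
    then have "y\<^sup>2 \<le> (1 / 2)\<^sup>2"
      using v by (intro power_mono) auto
    then have "3 / 4 \<le> cos y"
      using cos_ge_quadratic[of y] by (simp add: power_divide)
    then show "\<exists>d. ((\<lambda>y. sin y - 3 / 4 * y) has_real_derivative d) (at y) \<and> 0 \<le> d"
      by (intro exI[of _ "cos y - 3 / 4"]) (auto intro!: derivative_eq_intros)
  qed
  then have "(3 / 4 * v)\<^sup>2 \<le> (sin v)\<^sup>2"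
    using v by (intro power_mono) auto
  then have "cos (2 * v) \<le> 1 - 2 * (3 / 4 * v)\<^sup>2"
    by (simp add: cos_double_sin)
  also have "\<dots> \<le> 1 - u\<^sup>2 / 4"
    by (simp add: v_def power_mult_distrib power_divide)
  also have "\<dots> \<le> exp (- (u\<^sup>2 / 4))"
    using exp_ge_add_one_self[of "- (u\<^sup>2 / 4)"] by simp
  finally have "cos u \<le> exp (- (u\<^sup>2 / 4))"
    by (simp add: v_def abs_if split: if_splits)
  moreover have "0 \<le> cos u"
    using cos_ge_quadratic[of u] power_mono[OF assms, of 2] by simp
  ultimately show ?thesis by simp
qed

text \<open>The characteristic function of a weighted sum of independent signs, from the real part
  of the product formula for \<open>cis\<close>.\<close>

lemma spin_avg_cos:
  "spin_avg N (\<lambda>\<tau>. cos (\<Sum>j\<in>{1..N}. c j * \<tau> j)) = (\<Prod>j\<in>{1..N}. cos (c j))"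
proof -
  have "(\<Sum>\<tau>\<in>spins N. cis (\<Sum>j\<in>{1..N}. c j * \<tau> j)) =
      (\<Sum>\<tau>\<in>spins N. \<Prod>j\<in>{1..N}. cis (c j * \<tau> j))"
    by (simp add: cis_conv_exp sum_distrib_left flip: exp_sum)
  also have "\<dots> = (\<Prod>j\<in>{1..N}. \<Sum>s\<in>{-1, 1}. cis (c j * s))"
    unfolding spins_def by (rule prod_sum_PiE[symmetric]) auto
  also have "\<dots> = (\<Prod>j\<in>{1..N}. complex_of_real (2 * cos (c j)))"
    by (intro prod.cong) (auto simp: complex_eq_iff)
  also have "\<dots> = complex_of_real (2 ^ N * (\<Prod>j\<in>{1..N}. cos (c j)))"
    by (simp add: prod.distrib)
  finally have "Re (\<Sum>\<tau>\<in>spins N. cis (\<Sum>j\<in>{1..N}. c j * \<tau> j)) = 2 ^ N * (\<Prod>j\<in>{1..N}. cos (c j))"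
    by (metis Re_complex_of_real)
  then show ?thesis
    by (simp add: spin_avg_def)
qed

text \<open>Two one-sided geometric series, each at most 2.\<close>

lemma geometric_row_sum_le:
  assumes "k < K"
  shows "(\<Sum>l<K. (1 / 2) ^ nat \<bar>int k - int l\<bar>) \<le> (4 :: real)"
proof -
  have geo: "(\<Sum>l<n. (1 / 2) ^ l) \<le> (2 :: real)" for n
    by (simp add: sum_gp_strict)
  have split: "{..<K} = {..k} \<union> {k<..<K}"
    using assms by auto
  have "(\<Sum>l<K. (1 / 2) ^ nat \<bar>int k - int l\<bar>) =
      (\<Sum>l\<le>k. (1 / 2) ^ nat \<bar>int k - int l\<bar>) + (\<Sum>l\<in>{k<..<K}. (1 / 2 :: real) ^ nat \<bar>int k - int l\<bar>)"
    unfolding split by (rule sum.union_disjoint) auto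
  also have "(\<Sum>l\<le>k. (1 / 2 :: real) ^ nat \<bar>int k - int l\<bar>) = (\<Sum>l<Suc k. (1 / 2) ^ l)"
    by (rule sum.reindex_bij_witness[of _ "\<lambda>l. k - l" "\<lambda>l. k - l"])
      (auto intro!: arg_cong2[where f = "(^)"])
  also have "(\<Sum>l\<in>{k<..<K}. (1 / 2 :: real) ^ nat \<bar>int k - int l\<bar>) = (\<Sum>l\<in>{1..<K - k}. (1 / 2) ^ l)"
    by (rule sum.reindex_bij_witness[of _ "\<lambda>l. k + l" "\<lambda>l. l - k"])
      (auto intro!: arg_cong2[where f = "(^)"])
  also have "\<dots> \<le> (\<Sum>l<K - k. (1 / 2) ^ l)"
    by (intro sum_mono2) auto
  finally show ?thesis
    using geo[of "Suc k"] geo[of "K - k"] by linarith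
qed

text \<open>If \<open>\<bar>X\<bar> \<le> 1 / K\<close> then the exponential sum
  \<open>\<Sum>k<K. exp (\<i> k X)\<close> has modulus of order \<open>K\<close>, while the average of its squared modulus
  is only of order \<open>K\<close> because the characteristic function of \<open>X\<close> decays.\<close>

lemma spin_sum_small_ball:
  fixes c :: "nat \<Rightarrow> real" and N K :: nat
  defines "X \<equiv> \<lambda>\<tau>. \<Sum>j\<in>{1..N}. c j * \<tau> j"
  assumes K: "0 < K" and c: "\<And>j. j \<in> {1..N} \<Longrightarrow> \<bar>c j\<bar> * K \<le> 1"
    and var: "4 \<le> (\<Sum>j\<in>{1..N}. (c j)\<^sup>2)"
  shows "card ({\<tau>. \<bar>X \<tau>\<bar> \<le> 1 / K} \<inter> spins N) / 2 ^ N \<le> 16 / K"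
proof -
  define S where "S \<tau> = (\<Sum>k<K. cos (k * X \<tau>))\<^sup>2 + (\<Sum>k<K. sin (k * X \<tau>))\<^sup>2" for \<tau>
  have S_ge: "(K / 2)\<^sup>2 \<le> S \<tau>" if "\<bar>X \<tau>\<bar> \<le> 1 / K" for \<tau>
  proof -
    have "1 / 2 \<le> cos (k * X \<tau>)" if "k < K" for k
    proof -
      have "\<bar>k * X \<tau>\<bar> \<le> K * (1 / K)"
        unfolding abs_mult using that \<open>\<bar>X \<tau>\<bar> \<le> 1 / K\<close> by (intro mult_mono) auto
      then have "(k * X \<tau>)\<^sup>2 \<le> 1"
        using K by (simp add: abs_square_le_1)
      then show ?thesis
        using cos_ge_quadratic[of "k * X \<tau>"] by simp
    qed
    then have "(\<Sum>k<K. 1 / 2) \<le> (\<Sum>k<K. cos (k * X \<tau>))"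
      by (intro sum_mono) auto
    then have "(K / 2)\<^sup>2 \<le> (\<Sum>k<K. cos (k * X \<tau>))\<^sup>2"
      by (intro power_mono) auto
    then show ?thesis
      by (simp add: S_def add_increasing2)
  qed
  have S_eq: "S \<tau> = (\<Sum>k<K. \<Sum>l<K. cos (\<Sum>j\<in>{1..N}. (real k - real l) * c j * \<tau> j))" for \<tau>
  proof -
    have "(\<Sum>j\<in>{1..N}. (real k - real l) * c j * \<tau> j) = k * X \<tau> - l * X \<tau>" for k l
      unfolding X_def by (simp add: sum_distrib_left mult.assoc left_diff_distrib sum_subtractf)
    then show ?thesis
      by (simp add: S_def power2_eq_square sum_product cos_diff sum.distrib)
  qed
  have prod_le: "(\<Prod>j\<in>{1..N}. cos ((real k - real l) * c j)) \<le> (1 / 2) ^ nat \<bar>int k - int l\<bar>"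
    if k: "k < K" and l: "l < K" for k l
  proof -
    let ?d = "real k - real l"
    have d: "\<bar>?d\<bar> = nat \<bar>int k - int l\<bar>"
      by (simp add: abs_if)
    have "(\<Prod>j\<in>{1..N}. cos (?d * c j)) \<le> (\<Prod>j\<in>{1..N}. \<bar>cos (?d * c j)\<bar>)"
      by (simp flip: abs_prod)
    also have "\<dots> \<le> (\<Prod>j\<in>{1..N}. exp (- ((?d * c j)\<^sup>2 / 4)))"
    proof (intro prod_mono conjI abs_cos_le_exp)
      fix j assume j: "j \<in> {1..N}"
      have "\<bar>?d * c j\<bar> \<le> K * \<bar>c j\<bar>"
        unfolding abs_mult using k l by (intro mult_right_mono) auto
      then show "\<bar>?d * c j\<bar> \<le> 1"
        using c[OF j] by (simp add: mult.commute)
    qed auto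
    also have "\<dots> = exp (- (?d\<^sup>2 / 4 * (\<Sum>j\<in>{1..N}. (c j)\<^sup>2)))"
      by (simp add: power_mult_distrib sum_distrib_left sum_negf flip: exp_sum)
    also have "\<dots> \<le> exp (- \<bar>?d\<bar>)"
    proof -
      \<comment> \<open>\<open>?d\<close> is an integer, so Gaussian decay dominates geometric
        decay; the variance assumption 4 cancels the 1/4 in the exponent.\<close>
      have "\<bar>?d\<bar> \<le> ?d\<^sup>2"
      proof (cases "k = l")
        case False
        then have "1 \<le> \<bar>?d\<bar>" by (auto simp: abs_if)
        then have "\<bar>?d\<bar> * 1 \<le> \<bar>?d\<bar> * \<bar>?d\<bar>"
          by (intro mult_left_mono) auto
        then show ?thesis
          by (simp add: power2_eq_square)
      qed simp
      also have "\<dots> \<le> ?d\<^sup>2 / 4 * (\<Sum>j\<in>{1..N}. (c j)\<^sup>2)"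
        using mult_left_mono[OF var, of "?d\<^sup>2 / 4"] by simp
      finally show ?thesis by simp
    qed
    also have "\<dots> = exp (- 1) ^ nat \<bar>int k - int l\<bar>"
      unfolding d by (simp flip: exp_of_nat_mult)
    also have "\<dots> \<le> (1 / 2) ^ nat \<bar>int k - int l\<bar>"
      using exp_ge_add_one_self[of "1 :: real"]
      by (intro power_mono) (auto simp: exp_minus field_simps)
    finally show ?thesis .
  qed
  have "(K / 2)\<^sup>2 * (card ({\<tau>. \<bar>X \<tau>\<bar> \<le> 1 / K} \<inter> spins N) / 2 ^ N) =
      (\<Sum>\<tau>\<in>{\<tau>. \<bar>X \<tau>\<bar> \<le> 1 / K} \<inter> spins N. (K / 2)\<^sup>2) / 2 ^ N"
    by simp
  also have "\<dots> \<le> (\<Sum>\<tau>\<in>{\<tau>. \<bar>X \<tau>\<bar> \<le> 1 / K} \<inter> spins N. S \<tau>) / 2 ^ N"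
    using S_ge by (intro divide_right_mono sum_mono) auto
  also have "\<dots> \<le> spin_avg N S"
    unfolding spin_avg_def
    by (intro divide_right_mono sum_mono2) (auto simp: finite_spins S_def)
  also have "\<dots> = (\<Sum>k<K. \<Sum>l<K. \<Prod>j\<in>{1..N}. cos ((real k - real l) * c j))"
    unfolding S_eq by (simp only: spin_avg_sum spin_avg_cos)
  also have "\<dots> \<le> (\<Sum>k<K. \<Sum>l<K. (1 / 2) ^ nat \<bar>int k - int l\<bar>)"
    using prod_le by (intro sum_mono) auto
  also have "\<dots> \<le> (\<Sum>k<K. 4)"
    using geometric_row_sum_le by (intro sum_mono) auto
  finally show ?thesis
    using K by (simp add: power2_eq_square field_simps)
qed

section \<open>The score and the estimator\<close>

text \<open>The derivative of tanh decreases on the half-line, so the mean slope is at least the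
  slope at the right end.\<close>

lemma tanh_diff_ge:
  fixes a b :: real
  assumes "0 \<le> a" "a \<le> b"
  shows "(b - a) * (1 - (tanh b)\<^sup>2) \<le> tanh b - tanh a"
proof (cases "a = b")
  case False
  then have "a < b" using assms by simp
  moreover have "(tanh has_real_derivative 1 - (tanh x)\<^sup>2) (at x)" for x :: real
    by (auto intro!: derivative_eq_intros)
  ultimately obtain z where z: "a < z" "z < b" "tanh b - tanh a = (b - a) * (1 - (tanh z)\<^sup>2)"
    using MVT2[of a b tanh "\<lambda>x. 1 - (tanh x)\<^sup>2"] by blast
  have "(tanh z)\<^sup>2 \<le> (tanh b)\<^sup>2"
    using z assms by (intro power_mono) auto
  then show ?thesis
    unfolding z(3) using assms by (intro mult_left_mono) auto
qed auto

text \<open>The map u tanh (x u) depends on |u| only, which reduces the claim to the half-line. It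
  measures how far one summand of the score drops between two parameters.\<close>

lemma field_tanh_diff_ge:
  fixes u x y :: real
  assumes "0 \<le> y" "y \<le> x"
  shows "(x - y) * (u\<^sup>2 * (1 - (tanh (x * u))\<^sup>2)) \<le> u * tanh (x * u) - u * tanh (y * u)"
proof -
  have "(x * \<bar>u\<bar> - y * \<bar>u\<bar>) * (1 - (tanh (x * \<bar>u\<bar>))\<^sup>2) \<le> tanh (x * \<bar>u\<bar>) - tanh (y * \<bar>u\<bar>)"
    using assms by (intro tanh_diff_ge mult_right_mono) auto
  then have "\<bar>u\<bar> * ((x * \<bar>u\<bar> - y * \<bar>u\<bar>) * (1 - (tanh (x * \<bar>u\<bar>))\<^sup>2)) \<le>
      \<bar>u\<bar> * (tanh (x * \<bar>u\<bar>) - tanh (y * \<bar>u\<bar>))"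
    by (intro mult_left_mono) auto
  then show ?thesis
    by (cases "0 \<le> u") (simp_all add: power2_eq_square algebra_simps)
qed

section \<open>Monotonicity of the score and the position of its zero\<close>

lemma score_mono:
  assumes "0 \<le> y" "y \<le> x"
  shows "score N J \<tau> x \<le> score N J \<tau> y"
proof -
  have *: "u * tanh (y * u) \<le> u * tanh (x * u)" for u :: real
  proof -
    have "0 \<le> (x - y) * (u\<^sup>2 * (1 - (tanh (x * u))\<^sup>2))"
      using assms abs_tanh_le_1[of "x * u"] by (intro mult_nonneg_nonneg) (auto simp: abs_square_le_1)
    then show ?thesis
      using field_tanh_diff_ge[OF assms, of u] by linarith
  qed
  then show ?thesis
    unfolding score_def right_diff_distrib by (intro mult_left_mono sum_mono diff_left_mono *) auto
qed

lemma continuous_on_score: "continuous_on S (score N J \<tau>)"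
  unfolding score_def by (intro continuous_intros) (auto simp: less_imp_neq[symmetric])

text \<open>A nonpositive score at \<open>y\<close> either comes with a negative score at 0, making
  the estimator 0, or yields a zero in [0, y] by the intermediate value theorem, bounding the
  infimum by \<open>y\<close>.\<close>

lemma score_pos_if_mple_gt:
  assumes "0 \<le> y" "ereal y < mple N J \<tau>"
  shows "0 < score N J \<tau> y"
proof (rule ccontr)
  assume neg: "\<not> 0 < score N J \<tau> y"
  show False
  proof (cases "score N J \<tau> 0 < 0")
    case True
    then show ?thesis
      using assms by (simp add: mple_def)
  next
    case False
    then obtain z where z: "0 \<le> z" "z \<le> y" "score N J \<tau> z = 0"
      using IVT2'[of "score N J \<tau>" y 0 0] neg assms(1) continuous_on_score by auto
    then have "mple N J \<tau> = Inf (ereal ` {x. 0 \<le> x \<and> score N J \<tau> x = 0})"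
      using False by (auto simp: mple_def)
    also have "\<dots> \<le> ereal z"
      using z by (intro Inf_lower) auto
    also have "\<dots> \<le> ereal y"
      using z by simp
    finally show ?thesis
      using assms by simp
  qed
qed

text \<open>Either the score is already negative at 0, or some zero lies strictly below
  \<open>y\<close>; monotonicity does the rest.\<close>

lemma score_nonpos_if_mple_less:
  assumes "mple N J \<tau> < ereal y"
  shows "0 < y \<and> score N J \<tau> y \<le> 0"
proof (cases "score N J \<tau> 0 < 0")
  case True
  then have "0 < y"
    using assms by (simp add: mple_def)
  then show ?thesis
    using score_mono[of 0 y N J \<tau>] True by simp
next
  case False
  then have "mple N J \<tau> = Inf (ereal ` {x. 0 \<le> x \<and> score N J \<tau> x = 0})"
    using assms by (auto simp: mple_def split: if_splits)
  then obtain z where "0 \<le> z" "score N J \<tau> z = 0" "z < y"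
    using assms by (auto simp: Inf_less_iff)
  then show ?thesis
    using score_mono[of z y N J \<tau>] by auto
qed

text \<open>If both alternatives fail, the estimator lies within \<open>K / b\<close> of
  \<open>\<beta>\<close> and is in particular finite. The positivity in the second alternative is
  free, as the estimator is never negative.\<close>

lemma mple_error_cases:
  assumes "0 < b" "0 < K" "0 \<le> \<beta>" and "ereal K < ereal b * \<bar>mple N J \<tau> - ereal \<beta>\<bar>"
  shows "0 < score N J \<tau> (\<beta> + K / b) \<or> (0 < \<beta> - K / b \<and> score N J \<tau> (\<beta> - K / b) \<le> 0)"
proof (rule ccontr)
  assume contra: "\<not> ?thesis"
  have "mple N J \<tau> \<le> ereal (\<beta> + K / b)"
    using contra score_pos_if_mple_gt[of "\<beta> + K / b" N J \<tau>] assms by force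
  moreover have "ereal (\<beta> - K / b) \<le> mple N J \<tau>"
    using contra score_nonpos_if_mple_less[of N J \<tau> "\<beta> - K / b"] by force
  ultimately obtain r where r: "mple N J \<tau> = ereal r" "r \<le> \<beta> + K / b" "\<beta> - K / b \<le> r"
    by (cases "mple N J \<tau>") auto
  then have "\<bar>r - \<beta>\<bar> \<le> K / b"
    by (simp add: abs_le_iff)
  then have "b * \<bar>r - \<beta>\<bar> \<le> K"
    using assms(1) by (simp add: field_simps)
  then show False
    using assms(4) r(1) by simp
qed

context ising_system
begin

text \<open>\<open>N\<close> times minus the derivative of the score at \<open>x\<close>.\<close>

definition curvature :: "real \<Rightarrow> (nat \<Rightarrow> real) \<Rightarrow> real" where
  "curvature x \<tau> = (\<Sum>i\<in>{1..N}. (m \<tau> i)\<^sup>2 * (1 - (tanh (x * m \<tau> i))\<^sup>2))"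

text \<open>On the side of the error the score at distance \<open>K / b\<close> has not crossed
  zero, so at \<open>\<beta>\<close> it differs from zero by at least its drop over this distance,
  which the curvature at the right end bounds from below.\<close>

lemma mple_error_imp_score_large:
  assumes "0 < N" "0 < b" "0 < K"
    and "ereal K < ereal b * \<bar>mple N J \<tau> - ereal \<beta>\<bar>"
  shows "K / b * curvature (\<beta> + K / b) \<tau> \<le> \<bar>Q \<tau>\<bar>"
proof -
  let ?h = "K / b"
  have h: "0 < ?h" using assms by simp
  have N_score: "N * score N J \<tau> x = (\<Sum>i\<in>{1..N}. m \<tau> i * \<tau> i - m \<tau> i * tanh (x * m \<tau> i))" for x
    using assms(1) by (simp add: score_def right_diff_distrib)
  have Q: "Q \<tau> = N * score N J \<tau> \<beta>"
    by (simp add: N_score Q_def right_diff_distrib)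
  have diff: "(x - y) * curvature x \<tau> \<le> N * score N J \<tau> y - N * score N J \<tau> x"
    if "0 \<le> y" "y \<le> x" for x y
    unfolding N_score curvature_def sum_distrib_left sum_subtractf[symmetric]
  proof (intro sum_mono)
    fix i
    show "(x - y) * ((m \<tau> i)\<^sup>2 * (1 - (tanh (x * m \<tau> i))\<^sup>2)) \<le>
        m \<tau> i * \<tau> i - m \<tau> i * tanh (y * m \<tau> i) - (m \<tau> i * \<tau> i - m \<tau> i * tanh (x * m \<tau> i))"
      using field_tanh_diff_ge[OF that, of "m \<tau> i"] by linarith
  qed
  have "0 < score N J \<tau> (\<beta> + ?h) \<or> (0 < \<beta> - ?h \<and> score N J \<tau> (\<beta> - ?h) \<le> 0)"
    by (rule mple_error_cases[OF assms(2,3) \<beta>_nonneg assms(4)])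
  then show ?thesis
  proof
    assume "0 < score N J \<tau> (\<beta> + ?h)"
    then have "0 < N * score N J \<tau> (\<beta> + ?h)"
      using assms(1) by simp
    then show ?thesis
      using diff[of \<beta> "\<beta> + ?h"] h \<beta>_nonneg Q by simp
  next
    assume *: "0 < \<beta> - ?h \<and> score N J \<tau> (\<beta> - ?h) \<le> 0"
    then have "N * score N J \<tau> (\<beta> - ?h) \<le> 0"
      by (simp add: mult_nonneg_nonpos)
    then have "?h * curvature \<beta> \<tau> \<le> - Q \<tau>"
      using diff[of "\<beta> - ?h" \<beta>] h * Q by simp
    \<comment> \<open>On the left side the right end is \<open>\<beta>\<close> itself; curvature
      decreases in its argument, so the value at \<open>\<beta> + ?h\<close> serves both
      cases.\<close>
    moreover have "curvature (\<beta> + ?h) \<tau> \<le> curvature \<beta> \<tau>"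
      unfolding curvature_def
    proof (intro sum_mono mult_left_mono diff_left_mono)
      fix i
      have "\<bar>\<beta> * m \<tau> i\<bar> \<le> \<bar>(\<beta> + ?h) * m \<tau> i\<bar>"
        unfolding abs_mult using h \<beta>_nonneg by (intro mult_right_mono) auto
      then have "tanh \<bar>\<beta> * m \<tau> i\<bar> \<le> tanh \<bar>(\<beta> + ?h) * m \<tau> i\<bar>"
        by (simp only: tanh_real_le_iff)
      then show "(tanh (\<beta> * m \<tau> i))\<^sup>2 \<le> (tanh ((\<beta> + ?h) * m \<tau> i))\<^sup>2"
        by (simp only: tanh_real_abs abs_le_square_iff)
    qed auto
    ultimately have "?h * curvature (\<beta> + ?h) \<tau> \<le> - Q \<tau>"
      using h by (smt (verit) mult_left_mono)
    then show ?thesis by simp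
  qed
qed

text \<open>Sharp when the fields are small, as they are for \<beta> < 1.\<close>

lemma curvature_ge_moments: "M2 \<tau> - x\<^sup>2 * M4 \<tau> \<le> curvature x \<tau>"
  unfolding M2_def M4_def curvature_def sum_distrib_left sum_subtractf[symmetric]
proof (intro sum_mono)
  fix i
  have "(tanh (x * m \<tau> i))\<^sup>2 \<le> (x * m \<tau> i)\<^sup>2"
    using abs_tanh_le[of "x * m \<tau> i"] by (simp only: abs_le_square_iff)
  then have "(m \<tau> i)\<^sup>2 * (1 - (x * m \<tau> i)\<^sup>2) \<le> (m \<tau> i)\<^sup>2 * (1 - (tanh (x * m \<tau> i))\<^sup>2)"
    by (intro mult_left_mono) auto
  then show "(m \<tau> i)\<^sup>2 - x\<^sup>2 * (m \<tau> i) ^ 4 \<le> (m \<tau> i)\<^sup>2 * (1 - (tanh (x * m \<tau> i))\<^sup>2)"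
    by (simp add: power_mult_distrib algebra_simps flip: power_add)
qed

lemma abs_field_le:
  assumes "\<tau> \<in> spins N" "i \<in> {1..N}"
  shows "\<bar>m \<tau> i\<bar> \<le> R"
proof -
  have "\<bar>m \<tau> i\<bar> \<le> (\<Sum>j\<in>{1..N}. \<bar>J i j * \<tau> j\<bar>)"
    unfolding local_field_def by (rule sum_abs)
  also have "\<dots> = (\<Sum>j\<in>{1..N}. J i j)"
    using assms by (intro sum.cong) (auto simp: abs_mult J_nonneg spins_abs)
  finally show ?thesis
    using row_sum[OF assms(2)] by linarith
qed

text \<open>The version for fields of order one, used for \<beta> > 1: since |m i| is at most
  \<open>R\<close>, the tanh stays away from 1 uniformly.\<close>

lemma curvature_ge_bounded_field:
  assumes \<tau>: "\<tau> \<in> spins N" and x: "0 \<le> x" "x \<le> y"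
  shows "(1 - (tanh (y * R))\<^sup>2) * M2 \<tau> \<le> curvature x \<tau>"
  unfolding M2_def curvature_def sum_distrib_left
proof (intro sum_mono)
  fix i assume i: "i \<in> {1..N}"
  have "\<bar>x * m \<tau> i\<bar> \<le> \<bar>y * R\<bar>"
    using x abs_field_le[OF \<tau> i] unfolding abs_mult by (intro mult_mono) auto
  then have "tanh \<bar>x * m \<tau> i\<bar> \<le> tanh \<bar>y * R\<bar>"
    by (simp only: tanh_real_le_iff)
  then have "(tanh (x * m \<tau> i))\<^sup>2 \<le> (tanh (y * R))\<^sup>2"
    by (simp only: tanh_real_abs abs_le_square_iff)
  then have "(m \<tau> i)\<^sup>2 * (1 - (tanh (y * R))\<^sup>2) \<le> (m \<tau> i)\<^sup>2 * (1 - (tanh (x * m \<tau> i))\<^sup>2)"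
    by (intro mult_left_mono) auto
  then show "(1 - (tanh (y * R))\<^sup>2) * (m \<tau> i)\<^sup>2 \<le> (m \<tau> i)\<^sup>2 * (1 - (tanh (x * m \<tau> i))\<^sup>2)"
    by (simp add: mult.commute)
qed

text \<open>By symmetry of \<open>J\<close> the total field is the sum of the spins weighted by the
  row sums, and Cauchy-Schwarz bounds its square by \<open>N * M2\<close>. A small \<open>M2\<close>
  thus puts the normalised total field into a small ball.\<close>

lemma M2_small_ball:
  fixes K :: nat
  assumes K: "0 < K" "64 * K\<^sup>2 \<le> N"
    and rows: "\<And>i. i \<in> {1..N} \<Longrightarrow> 1 / 2 \<le> (\<Sum>j\<in>{1..N}. J i j)" and R: "R \<le> 2"
  shows "card ({\<tau>. M2 \<tau> < 1 / (16 * K\<^sup>2)} \<inter> spins N) / 2 ^ N \<le> 16 / K"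
proof -
  define r where "r i = (\<Sum>j\<in>{1..N}. J i j)" for i
  \<comment> \<open>The factor 4 turns row sums of at least 1/2 into total variance at least 4, as
    \<open>spin_sum_small_ball\<close> requires. Row sums of at most 2 give coefficients of at most
    \<open>8 / sqrt N\<close>, whence the assumption with 64.\<close>
  define c where "c i = 4 * r i / sqrt N" for i
  have N: "0 < real N"
    using K by (cases N) auto
  have r: "1 / 2 \<le> r i" "r i \<le> 2" if "i \<in> {1..N}" for i
    using rows[OF that] row_sum[OF that] R by (auto simp: r_def)
  have field_sum: "(\<Sum>i\<in>{1..N}. m \<tau> i) = (\<Sum>j\<in>{1..N}. r j * \<tau> j)" for \<tau>
    unfolding local_field_def r_def sum_distrib_right by (subst sum.swap) (simp add: J_sym)
  have sub: "{\<tau>. M2 \<tau> < 1 / (16 * K\<^sup>2)} \<subseteq> {\<tau>. \<bar>\<Sum>j\<in>{1..N}. c j * \<tau> j\<bar> \<le> 1 / K}"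
  proof
    fix \<tau> assume "\<tau> \<in> {\<tau>. M2 \<tau> < 1 / (16 * K\<^sup>2)}"
    then have M2: "M2 \<tau> < 1 / (16 * K\<^sup>2)" by simp
    have "(\<Sum>j\<in>{1..N}. c j * \<tau> j) = 4 / sqrt N * (\<Sum>i\<in>{1..N}. m \<tau> i)"
      unfolding field_sum by (simp add: c_def sum_distrib_left mult.assoc)
    then have "(\<Sum>j\<in>{1..N}. c j * \<tau> j)\<^sup>2 = 16 / N * (\<Sum>i\<in>{1..N}. m \<tau> i)\<^sup>2"
      by (simp add: power_mult_distrib power_divide)
    also have "\<dots> \<le> 16 / N * (M2 \<tau> * N)"
      using sum_squared_le_sum_of_squares[of "m \<tau>" "{1..N}"]
      by (intro mult_left_mono) (auto simp: M2_def mult.commute)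
    also have "\<dots> \<le> (1 / K)\<^sup>2"
      using M2 N K by (simp add: field_simps power_divide)
    finally show "\<tau> \<in> {\<tau>. \<bar>\<Sum>j\<in>{1..N}. c j * \<tau> j\<bar> \<le> 1 / K}"
      by (metis (mono_tags, lifting) abs_le_square_iff abs_of_nonneg mem_Collect_eq
          of_nat_0_le_iff zero_le_divide_1_iff)
  qed
  have "real (card ({\<tau>. M2 \<tau> < 1 / (16 * K\<^sup>2)} \<inter> spins N)) \<le>
      card ({\<tau>. \<bar>\<Sum>j\<in>{1..N}. c j * \<tau> j\<bar> \<le> 1 / K} \<inter> spins N)"
    using sub by (intro of_nat_mono card_mono) (auto simp: finite_spins)
  then have "card ({\<tau>. M2 \<tau> < 1 / (16 * K\<^sup>2)} \<inter> spins N) / 2 ^ N \<le>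
      card ({\<tau>. \<bar>\<Sum>j\<in>{1..N}. c j * \<tau> j\<bar> \<le> 1 / K} \<inter> spins N) / 2 ^ N"
    by (intro divide_right_mono) auto
  also have "\<dots> \<le> 16 / K"
  proof (rule spin_sum_small_ball[OF K(1)])
    fix j assume j: "j \<in> {1..N}"
    have "real (64 * K\<^sup>2) \<le> real N"
      using K(2) by (rule of_nat_mono)
    then have "(8 * real K)\<^sup>2 \<le> N"
      by (simp add: power_mult_distrib)
    then have "8 * real K \<le> sqrt N"
      by (rule real_le_rsqrt)
    moreover have "4 * r j * K \<le> 8 * real K"
      using r[OF j] by (intro mult_right_mono) auto
    ultimately show "\<bar>c j\<bar> * K \<le> 1"
      using r[OF j] N by (simp add: c_def abs_mult field_simps)
  next
    have "4 = (\<Sum>j\<in>{1..N}. 16 * (1 / 2)\<^sup>2 / N)"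
      using N by (simp add: power_divide)
    also have "\<dots> \<le> (\<Sum>j\<in>{1..N}. (c j)\<^sup>2)"
    proof (intro sum_mono)
      fix j assume "j \<in> {1..N}"
      then have "(1 / 2)\<^sup>2 \<le> (r j)\<^sup>2"
        using r by (intro power_mono) auto
      then show "16 * (1 / 2)\<^sup>2 / N \<le> (c j)\<^sup>2"
        using N by (simp add: c_def power_mult_distrib power_divide divide_right_mono)
    qed
    finally show "4 \<le> (\<Sum>j\<in>{1..N}. (c j)\<^sup>2)" .
  qed
  finally show ?thesis .
qed

end

section \<open>Regularity of the random graph\<close>

lemma finite_vertex_pairs: "finite (vertex_pairs N)"
  unfolding vertex_pairs_def by (rule finite_subset[of _ "Pow {1..N}"]) auto

lemma set_erdos_renyi: "E \<in> set_pmf (erdos_renyi N p) \<Longrightarrow> E \<subseteq> vertex_pairs N"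
  by (auto simp: erdos_renyi_def)

lemma finite_set_erdos_renyi: "finite (set_pmf (erdos_renyi N p))"
  by (rule finite_subset[of _ "Pow (vertex_pairs N)"])
    (auto dest: set_erdos_renyi simp: finite_vertex_pairs)

lemma adjacency_diag: "E \<subseteq> vertex_pairs N \<Longrightarrow> adjacency E i i = 0"
  by (auto simp: adjacency_def vertex_pairs_def)

definition vertex_degree :: "nat \<Rightarrow> nat set set \<Rightarrow> nat \<Rightarrow> real" where
  "vertex_degree N E i = (\<Sum>j\<in>{1..N}. adjacency E i j)"

lemma incident_pairs:
  assumes "i \<in> {1..N}"
  shows "{e \<in> vertex_pairs N. i \<in> e} = (\<lambda>j. {i, j}) ` ({1..N} - {i})"
proof (intro equalityI subsetI)
  fix e assume "e \<in> {e \<in> vertex_pairs N. i \<in> e}"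
  then have e: "e \<subseteq> {1..N}" "card e = 2" "i \<in> e"
    by (auto simp: vertex_pairs_def)
  then obtain x y where xy: "e = {x, y}" "x \<noteq> y"
    by (auto simp: card_2_iff)
  with e show "e \<in> (\<lambda>j. {i, j}) ` ({1..N} - {i})"
    by (cases "i = x") auto
next
  fix e assume "e \<in> (\<lambda>j. {i, j}) ` ({1..N} - {i})"
  then show "e \<in> {e \<in> vertex_pairs N. i \<in> e}"
    using assms by (auto simp: vertex_pairs_def)
qed

lemma inj_on_pair: "inj_on (\<lambda>j. {i, j}) (A - {i})"
  by (auto simp: inj_on_def doubleton_eq_iff)

text \<open>Indexing by edges instead of neighbours exhibits the degree as a sum of independent
  indicators.\<close>

lemma degree_eq_sum_incident:
  assumes i: "i \<in> {1..N}"
  shows "vertex_degree N {e \<in> vertex_pairs N. X e} i = (\<Sum>e | e \<in> vertex_pairs N \<and> i \<in> e. if X e then 1 else 0)"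
proof -
  let ?E = "{e \<in> vertex_pairs N. X e}"
  have "vertex_degree N ?E i = (\<Sum>j\<in>{1..N} - {i}. adjacency ?E i j)"
    unfolding vertex_degree_def using adjacency_diag[of ?E N i]
    by (subst sum.remove[OF finite_atLeastAtMost i]) auto
  also have "\<dots> = (\<Sum>j\<in>{1..N} - {i}. if X {i, j} then 1 else 0)"
    using i by (intro sum.cong) (auto simp: adjacency_def vertex_pairs_def)
  also have "\<dots> = (\<Sum>e\<in>(\<lambda>j. {i, j}) ` ({1..N} - {i}). if X e then 1 else 0)"
    by (subst sum.reindex[OF inj_on_pair]) simp
  also have "(\<lambda>j. {i, j}) ` ({1..N} - {i}) = {e \<in> vertex_pairs N. i \<in> e}"
    using incident_pairs[OF i] by simp
  finally show ?thesis .
qed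

text \<open>For negative \<open>s = - u\<close>, factor 1 + u^3 as (1 + u)(1 - u + u^2) and bound
  the first factor by exp u.\<close>

lemma exp_le_quadratic:
  fixes s :: real
  assumes "\<bar>s\<bar> \<le> 1"
  shows "exp s \<le> 1 + s + s\<^sup>2"
proof (cases "0 \<le> s")
  case True
  then show ?thesis
    using assms exp_bound by auto
next
  case False
  define u where "u = - s"
  have u: "0 < u" using False by (simp add: u_def)
  have "1 \<le> 1 + u ^ 3"
    using u by simp
  also have "\<dots> = (1 + u) * (1 - u + u\<^sup>2)"
    by (simp add: power2_eq_square power3_eq_cube algebra_simps)
  also have "\<dots> \<le> exp u * (1 - u + u\<^sup>2)"
  proof (intro mult_right_mono exp_ge_add_one_self)
    have "0 \<le> (1 - u)\<^sup>2" by simp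
    then show "0 \<le> 1 - u + u\<^sup>2"
      using u by (simp add: power2_diff)
  qed
  finally have "exp (- u) * 1 \<le> exp (- u) * (exp u * (1 - u + u\<^sup>2))"
    by (intro mult_left_mono) auto
  also have "\<dots> = 1 - u + u\<^sup>2"
    by (simp add: exp_minus)
  finally show ?thesis
    by (simp add: u_def)
qed

text \<open>The degree is binomial with \<open>N - 1\<close> trials; independence factorises its
  moment generating function.\<close>

lemma expectation_exp_degree:
  assumes p: "0 \<le> p" "p \<le> 1" and i: "i \<in> {1..N}"
  shows "measure_pmf.expectation (erdos_renyi N p) (\<lambda>E. exp (s * vertex_degree N E i)) \<le>
    exp (real (N - 1) * p * (exp s - 1))"
proof -
  let ?V = "vertex_pairs N"
  let ?f = "\<lambda>e b. if i \<in> e \<and> b then exp s else 1"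
  have "measure_pmf.expectation (erdos_renyi N p) (\<lambda>E. exp (s * vertex_degree N E i)) =
      measure_pmf.expectation (Pi_pmf ?V False (\<lambda>_. bernoulli_pmf p)) (\<lambda>X. \<Prod>e\<in>?V. ?f e (X e))"
    unfolding erdos_renyi_def integral_map_pmf
  proof (intro Bochner_Integration.integral_cong refl)
    fix X :: "nat set \<Rightarrow> bool"
    have "exp (s * vertex_degree N {e \<in> ?V. X e} i) =
        (\<Prod>e | e \<in> ?V \<and> i \<in> e. if X e then exp s else 1)"
      unfolding degree_eq_sum_incident[OF i] sum_distrib_left
      by (subst exp_sum) (auto simp: finite_vertex_pairs intro!: prod.cong)
    also have "\<dots> = (\<Prod>e\<in>?V. ?f e (X e))"
      by (rule prod.mono_neutral_cong_left) (auto simp: finite_vertex_pairs)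
    finally show "exp (s * vertex_degree N {e \<in> ?V. X e} i) = (\<Prod>e\<in>?V. ?f e (X e))" .
  qed
  also have "\<dots> = (\<Prod>e\<in>?V. measure_pmf.expectation (bernoulli_pmf p) (?f e))"
    by (rule expectation_prod_Pi_pmf)
      (auto simp: finite_vertex_pairs intro!: integrable_measure_pmf_finite)
  also have "\<dots> = (\<Prod>e\<in>?V. if i \<in> e then 1 + p * (exp s - 1) else 1)"
    using p by (intro prod.cong) (auto simp: algebra_simps)
  also have "\<dots> = (\<Prod>e | e \<in> ?V \<and> i \<in> e. 1 + p * (exp s - 1))"
    by (rule prod.mono_neutral_cong_right) (auto simp: finite_vertex_pairs)
  also have "\<dots> = (1 + p * (exp s - 1)) ^ (N - 1)"
    unfolding prod_constant incident_pairs[OF i] card_image[OF inj_on_pair]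
    using i by (simp add: card_Diff_subset)
  also have "\<dots> \<le> exp (p * (exp s - 1)) ^ (N - 1)"
  proof (intro power_mono exp_ge_add_one_self)
    have "0 \<le> (1 - p) + p * exp s"
      using p by (intro add_nonneg_nonneg) auto
    then show "0 \<le> 1 + p * (exp s - 1)"
      by (simp add: algebra_simps)
  qed
  also have "\<dots> = exp (real (N - 1) * p * (exp s - 1))"
    by (simp add: mult.assoc flip: exp_of_nat_mult)
  finally show ?thesis .
qed

text \<open>A two-sided Chernoff bound, centred at \<open>N * p\<close> rather than at the mean
  \<open>(N - 1) * p\<close>.\<close>

lemma degree_tail:
  assumes p: "0 \<le> p" "p \<le> 1" and i: "i \<in> {1..N}" and \<epsilon>: "0 < \<epsilon>" "\<epsilon> \<le> 1"
  shows "measure_pmf.prob (erdos_renyi N p) {E. \<epsilon> * (N * p) < \<bar>vertex_degree N E i - N * p\<bar>} \<le>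
    4 * exp (- (N * p * \<epsilon>\<^sup>2 / 4))"
proof -
  let ?M = "erdos_renyi N p"
  \<comment> \<open>The minimiser of \<open>s\<^sup>2 - s * \<epsilon>\<close>, with minimum
    \<open>- \<epsilon>\<^sup>2 / 4\<close>.\<close>
  define s where "s = \<epsilon> / 2"
  have s: "0 < s" "s \<le> 1 / 2"
    using \<epsilon> by (auto simp: s_def)
  have N: "1 \<le> N" using i by simp
  let ?g = "\<lambda>r E. exp (r * vertex_degree N E i) * exp (- (r * (N * p)) - s * \<epsilon> * (N * p))"
  have int: "integrable (measure_pmf ?M) f" for f :: "nat set set \<Rightarrow> real"
    by (rule integrable_measure_pmf_finite[OF finite_set_erdos_renyi])
  have expect: "measure_pmf.expectation ?M (?g r) \<le> 2 * exp (- (N * p * \<epsilon>\<^sup>2 / 4))"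
    if r: "\<bar>r\<bar> = s" for r
  proof -
    have "measure_pmf.expectation ?M (?g r) \<le>
        exp (real (N - 1) * p * (exp r - 1)) * exp (- (r * (N * p)) - s * \<epsilon> * (N * p))"
      unfolding integral_mult_left_zero
      by (intro mult_right_mono expectation_exp_degree[OF p i]) auto
    also have "\<dots> = exp (real (N - 1) * p * (exp r - 1) + (- (r * (N * p)) - s * \<epsilon> * (N * p)))"
      by (simp only: exp_add)
    also have "\<dots> \<le> exp (1 / 2 + - (N * p * \<epsilon>\<^sup>2 / 4))"
    proof -
      have "exp r \<le> 1 + r + r\<^sup>2"
        using r s by (intro exp_le_quadratic) auto
      then have "real (N - 1) * p * (exp r - 1) \<le> real (N - 1) * p * (r + r\<^sup>2)"
        using p by (intro mult_left_mono) auto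
      also have "\<dots> = N * p * r + N * p * r\<^sup>2 - p * r - p * r\<^sup>2"
        using N by (simp add: of_nat_diff algebra_simps)
      also have "\<dots> \<le> N * p * r + N * p * r\<^sup>2 + 1 / 2"
      \<comment> \<open>The shift of the centre costs at most 1/2 in the exponent; exp (1/2) is at
        most 2, and the two tails together give the factor 4.\<close>
      proof -
        have "\<bar>p * r\<bar> \<le> 1 * (1 / 2)"
          unfolding abs_mult r using p s by (intro mult_mono) auto
        moreover have "0 \<le> p * r\<^sup>2"
          using p by simp
        ultimately show ?thesis by linarith
      qed
      finally have "real (N - 1) * p * (exp r - 1) \<le> N * p * r + N * p * r\<^sup>2 + 1 / 2" .
      moreover have "r\<^sup>2 = s\<^sup>2"
        using r by (metis power2_abs)
      then have "N * p * r\<^sup>2 - s * \<epsilon> * (N * p) = - (N * p * \<epsilon>\<^sup>2 / 4)"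
        by (simp add: s_def power2_eq_square field_simps)
      ultimately show ?thesis
        by (simp add: algebra_simps)
    qed
    also have "\<dots> \<le> 2 * exp (- (N * p * \<epsilon>\<^sup>2 / 4))"
      unfolding exp_add using exp_bound[of "1 / 2"]
      by (intro mult_right_mono) (auto simp: power2_eq_square)
    finally show ?thesis .
  qed
  have "measure_pmf.prob ?M {E. \<epsilon> * (N * p) < \<bar>vertex_degree N E i - N * p\<bar>} =
      measure_pmf.expectation ?M (indicator {E. \<epsilon> * (N * p) < \<bar>vertex_degree N E i - N * p\<bar>})"
    by simp
  also have "\<dots> \<le> measure_pmf.expectation ?M (\<lambda>E. ?g s E + ?g (- s) E)"
  proof (intro integral_mono int)
    fix E
    show "indicator {E. \<epsilon> * (N * p) < \<bar>vertex_degree N E i - N * p\<bar>} E \<le> ?g s E + ?g (- s) E"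
    proof (cases "\<epsilon> * (N * p) < \<bar>vertex_degree N E i - N * p\<bar>")
      case True
      have g: "?g r E = exp (r * (vertex_degree N E i - N * p) - s * (\<epsilon> * (N * p)))" for r
        by (simp add: algebra_simps flip: exp_add)
      have "s * (\<epsilon> * (N * p)) \<le> s * \<bar>vertex_degree N E i - N * p\<bar>"
        using True s by (intro mult_left_mono) auto
      then have "0 \<le> s * (vertex_degree N E i - N * p) - s * (\<epsilon> * (N * p)) \<or>
          0 \<le> - s * (vertex_degree N E i - N * p) - s * (\<epsilon> * (N * p))"
        by (cases "0 \<le> vertex_degree N E i - N * p") (simp_all only: abs_of_nonneg abs_of_neg
            not_le diff_ge_0_iff_ge mult_minus_left mult_minus_right simp_thms)
      then have "1 \<le> ?g s E \<or> 1 \<le> ?g (- s) E"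
        unfolding g by simp
      moreover have "0 \<le> ?g s E" "0 \<le> ?g (- s) E" by auto
      ultimately have "1 \<le> ?g s E + ?g (- s) E"
        by linarith
      then show ?thesis
        using True by (simp add: indicator_def)
    qed (auto simp: indicator_def intro!: add_nonneg_nonneg)
  qed
  also have "\<dots> = measure_pmf.expectation ?M (?g s) + measure_pmf.expectation ?M (?g (- s))"
    by (intro Bochner_Integration.integral_add int)
  also have "\<dots> \<le> 4 * exp (- (N * p * \<epsilon>\<^sup>2 / 4))"
    using expect[of s] expect[of "- s"] s by simp
  finally show ?thesis .
qed

text \<open>The inclusion in \<open>vertex_pairs N\<close> holds for every graph in the support and
  gives the coupling its zero diagonal.\<close>

definition regular_graph :: "nat \<Rightarrow> real \<Rightarrow> real \<Rightarrow> nat set set \<Rightarrow> bool" where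
  "regular_graph N p \<epsilon> E \<longleftrightarrow>
    E \<subseteq> vertex_pairs N \<and> (\<forall>i\<in>{1..N}. \<bar>(\<Sum>j\<in>{1..N}. coupling N p E i j) - 1\<bar> \<le> \<epsilon>)"

lemma not_regular_graph_prob:
  assumes p: "0 < p" "p \<le> 1" and \<epsilon>: "0 < \<epsilon>" "\<epsilon> \<le> 1" and N: "0 < N"
  shows "measure_pmf.prob (erdos_renyi N p) {E. \<not> regular_graph N p \<epsilon> E} \<le>
    4 * real N * exp (- (N * p * \<epsilon>\<^sup>2 / 4))"
proof -
  let ?B = "\<lambda>i. {E. \<epsilon> * (N * p) < \<bar>vertex_degree N E i - N * p\<bar>}"
  let ?M = "erdos_renyi N p"
  have Np: "0 < N * p" using N p by simp
  have "measure_pmf.prob ?M {E. \<not> regular_graph N p \<epsilon> E} \<le> measure_pmf.prob ?M (\<Union>i\<in>{1..N}. ?B i)"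
  proof (rule measure_pmf.finite_measure_mono_AE)
    show "AE E in ?M. E \<in> {E. \<not> regular_graph N p \<epsilon> E} \<longrightarrow> E \<in> (\<Union>i\<in>{1..N}. ?B i)"
    proof (intro AE_pmfI impI)
      fix E assume "E \<in> set_pmf ?M" "E \<in> {E. \<not> regular_graph N p \<epsilon> E}"
      then obtain i where i: "i \<in> {1..N}" "\<epsilon> < \<bar>(\<Sum>j\<in>{1..N}. coupling N p E i j) - 1\<bar>"
        using set_erdos_renyi by (auto simp: regular_graph_def not_le)
      have "(\<Sum>j\<in>{1..N}. coupling N p E i j) - 1 = (vertex_degree N E i - N * p) / (N * p)"
        using Np N p by (simp add: coupling_def vertex_degree_def diff_divide_distrib sum_divide_distrib)
      then have "\<epsilon> < \<bar>vertex_degree N E i - N * p\<bar> / (N * p)"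
        using i(2) Np by (simp add: abs_divide)
      then have "\<epsilon> * (N * p) < \<bar>vertex_degree N E i - N * p\<bar>"
        using Np by (simp add: pos_less_divide_eq)
      then show "E \<in> (\<Union>i\<in>{1..N}. ?B i)"
        using i(1) by auto
    qed
  qed auto
  also have "\<dots> \<le> (\<Sum>i\<in>{1..N}. measure_pmf.prob ?M (?B i))"
    by (intro measure_pmf.finite_measure_subadditive_finite) auto
  also have "\<dots> \<le> (\<Sum>i\<in>{1..N}. 4 * exp (- (N * p * \<epsilon>\<^sup>2 / 4)))"
    using p \<epsilon> by (intro sum_mono degree_tail) auto
  finally show ?thesis by simp
qed

text \<open>Once ln N is below \<epsilon>^2/8 times the mean degree, each vertex fails with
  probability at most 4 / N^2, which beats the union bound over \<open>N\<close> vertices.\<close>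

lemma eventually_regular_graph:
  assumes p: "\<And>N. 1 \<le> N \<Longrightarrow> 0 < p N \<and> p N \<le> 1"
    and lim: "(\<lambda>N. ln (real N) / (real N * p N)) \<longlonglongrightarrow> 0"
    and \<epsilon>: "0 < \<epsilon>" "\<epsilon> \<le> 1" and \<eta>: "0 < \<eta>"
  shows "\<forall>\<^sub>F N in sequentially.
    measure_pmf.prob (erdos_renyi N (p N)) {E. \<not> regular_graph N (p N) \<epsilon> E} \<le> \<eta>"
proof -
  have "\<forall>\<^sub>F N in sequentially. ln (real N) / (real N * p N) < \<epsilon>\<^sup>2 / 8"
    using \<epsilon> by (intro order_tendstoD(2)[OF lim]) auto
  moreover have "\<forall>\<^sub>F N in sequentially. 4 / \<eta> < real N"
    by real_asymp
  ultimately show ?thesis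
    using eventually_gt_at_top[of 0]
  proof eventually_elim
    case (elim N)
    then have pN: "0 < p N" "p N \<le> 1" and Np: "0 < real N * p N"
      using p[of N] by auto
    have "measure_pmf.prob (erdos_renyi N (p N)) {E. \<not> regular_graph N (p N) \<epsilon> E} \<le>
        4 * real N * exp (- (N * p N * \<epsilon>\<^sup>2 / 4))"
      using pN \<epsilon> elim by (intro not_regular_graph_prob) auto
    also have "ln (real N) < \<epsilon>\<^sup>2 / 8 * (real N * p N)"
      using elim(1) Np by (simp add: pos_divide_less_eq)
    then have "exp (- (N * p N * \<epsilon>\<^sup>2 / 4)) \<le> exp (- (2 * ln (real N)))"
      by (simp add: algebra_simps)
    also have "exp (- (2 * ln (real N))) = 1 / (real N)\<^sup>2"
      using elim(3) by (simp add: exp_minus exp_double field_simps)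
    finally have "measure_pmf.prob (erdos_renyi N (p N)) {E. \<not> regular_graph N (p N) \<epsilon> E} \<le>
        4 * real N * (1 / (real N)\<^sup>2)"
      by (simp add: mult_left_mono)
    also have "\<dots> = 4 / N"
      by (simp add: power2_eq_square)
    also have "\<dots> \<le> \<eta>"
      using elim(2,3) \<eta> by (simp add: field_simps)
    finally show ?case .
  qed
qed

text \<open>Condition on the graph: bad graphs are charged a conditional probability of one, good
  graphs at most \<open>\<eta>\<^sub>2\<close>.\<close>

lemma joint_law_prob_le:
  assumes bad: "measure_pmf.prob (erdos_renyi N p) {E. \<not> G E} \<le> \<eta>\<^sub>1"
    and good: "\<And>E. G E \<Longrightarrow> measure_pmf.prob (ising N (coupling N p E) \<beta>) {\<sigma>. (E, \<sigma>) \<in> S} \<le> \<eta>\<^sub>2"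
    and \<eta>\<^sub>2: "0 \<le> \<eta>\<^sub>2"
  shows "measure_pmf.prob (joint_law N p \<beta>) S \<le> \<eta>\<^sub>1 + \<eta>\<^sub>2"
proof -
  let ?M = "erdos_renyi N p" and ?I = "\<lambda>E. ising N (coupling N p E) \<beta>"
  have "emeasure (joint_law N p \<beta>) S = (\<integral>\<^sup>+E. emeasure (map_pmf (Pair E) (?I E)) S \<partial>?M)"
    by (simp add: joint_law_def)
  also have "\<dots> \<le> (\<integral>\<^sup>+E. indicator {E. \<not> G E} E + ennreal \<eta>\<^sub>2 \<partial>?M)"
  proof (intro nn_integral_mono)
    fix E
    have eq: "emeasure (map_pmf (Pair E) (?I E)) S =
        ennreal (measure_pmf.prob (?I E) {\<sigma>. (E, \<sigma>) \<in> S})"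
      by (simp add: measure_pmf.emeasure_eq_measure vimage_def)
    show "emeasure (map_pmf (Pair E) (?I E)) S \<le> indicator {E. \<not> G E} E + ennreal \<eta>\<^sub>2"
    proof (cases "G E")
      case True
      then show ?thesis
        unfolding eq using good by (auto simp: indicator_def intro: ennreal_leI)
    next
      case False
      have "emeasure (map_pmf (Pair E) (?I E)) S \<le> 1"
        by (rule measure_pmf.emeasure_le_1)
      then show ?thesis
        using False by (auto simp: indicator_def intro: add_increasing2)
    qed
  qed
  also have "\<dots> = ennreal (measure_pmf.prob ?M {E. \<not> G E}) + ennreal \<eta>\<^sub>2"
    by (simp add: nn_integral_add measure_pmf.emeasure_eq_measure)
  also have "\<dots> \<le> ennreal \<eta>\<^sub>1 + ennreal \<eta>\<^sub>2"
    using bad by (intro add_right_mono ennreal_leI)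
  also have "\<dots> = ennreal (\<eta>\<^sub>1 + \<eta>\<^sub>2)"
    using \<eta>\<^sub>2 order_trans[OF measure_nonneg bad] by simp
  finally show ?thesis
    using \<eta>\<^sub>2 order_trans[OF measure_nonneg bad]
    by (simp add: measure_pmf.emeasure_eq_measure ennreal_le_iff del: ennreal_plus)
qed

lemma rate_consistentI:
  assumes "\<And>\<eta>. 0 < \<eta> \<Longrightarrow> \<exists>K\<^sub>0. \<forall>K\<ge>K\<^sub>0. \<forall>\<^sub>F N in sequentially.
    measure_pmf.prob (M N) {\<omega>. ereal (b N) * \<bar>est N \<omega> - ereal \<beta>\<bar> > ereal K} \<le> \<eta>"
  shows "rate_consistent b M est \<beta>"
proof -
  define P where "P K N = ereal (measure_pmf.prob (M N)
    {\<omega>. ereal (b N) * \<bar>est N \<omega> - ereal \<beta>\<bar> > ereal K})" for K N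
  have "Limsup at_top (\<lambda>K. limsup (P K)) \<le> 0"
  proof (rule ereal_le_epsilon2)
    fix \<eta> :: real assume \<eta>: "0 < \<eta>"
    obtain K\<^sub>0 where K\<^sub>0: "\<And>K. K \<ge> K\<^sub>0 \<Longrightarrow> \<forall>\<^sub>F N in sequentially. P K N \<le> ereal \<eta>"
      using assms[OF \<eta>] by (auto simp: P_def)
    have "\<forall>\<^sub>F K in at_top. limsup (P K) \<le> ereal \<eta>"
      using eventually_ge_at_top[of K\<^sub>0] by eventually_elim (intro Limsup_bounded K\<^sub>0)
    then show "Limsup at_top (\<lambda>K. limsup (P K)) \<le> 0 + ereal \<eta>"
      by (simp add: Limsup_bounded)
  qed
  moreover have "0 \<le> Limsup at_top (\<lambda>K. limsup (P K))"
    by (intro le_Limsup always_eventually allI trivial_limit_at_top_linorder) (auto simp: P_def)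
  ultimately show ?thesis
    unfolding rate_consistent_def P_def by (rule antisym)
qed

section \<open>Fluctuations at fixed graph\<close>

lemma prob_ising_union_le:
  assumes "\<And>\<tau>. \<tau> \<in> spins N \<Longrightarrow> \<tau> \<in> A \<Longrightarrow> \<tau> \<in> B \<or> \<tau> \<in> C"
  shows "measure_pmf.prob (ising N J \<beta>) A \<le>
    measure_pmf.prob (ising N J \<beta>) B + measure_pmf.prob (ising N J \<beta>) C"
proof -
  have "measure_pmf.prob (ising N J \<beta>) A \<le> measure_pmf.prob (ising N J \<beta>) (B \<union> C)"
    using assms by (intro measure_pmf.finite_measure_mono_AE AE_pmfI) (auto simp: set_pmf_ising)
  also have "\<dots> \<le> measure_pmf.prob (ising N J \<beta>) B + measure_pmf.prob (ising N J \<beta>) C"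
    by (intro measure_Un_le) auto
  finally show ?thesis .
qed

lemma exp_neg_le_inverse:
  fixes x :: real
  assumes "0 < x"
  shows "exp (- x) \<le> 1 / x"
proof -
  have "x \<le> exp x"
    using exp_ge_add_one_self[of x] by linarith
  then show ?thesis
    using assms by (simp add: exp_minus field_simps)
qed

context ising_system
begin

lemma M2_nonneg: "0 \<le> M2 \<tau>" and M4_nonneg: "0 \<le> M4 \<tau>"
  unfolding M2_def M4_def by (auto intro: sum_nonneg)

text \<open>\<open>H\<close> and \<open>Q\<close> differ by the sum of the m i tanh (\<beta> m i).
  Hence a large \<open>H\<close> together with a moderate \<open>Q\<close> forces a large
  \<open>M2\<close>.\<close>

lemma hamiltonian_le: "H \<tau> \<le> \<bar>Q \<tau>\<bar> + \<beta> * M2 \<tau>"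
proof -
  have "H \<tau> = Q \<tau> + (\<Sum>i\<in>{1..N}. m \<tau> i * tanh (\<beta> * m \<tau> i))"
    unfolding hamiltonian_local_field Q_def sum.distrib[symmetric]
    by (intro sum.cong) (auto simp: algebra_simps)
  moreover have "(\<Sum>i\<in>{1..N}. m \<tau> i * tanh (\<beta> * m \<tau> i)) \<le> \<beta> * M2 \<tau>"
    unfolding M2_def sum_distrib_left
  proof (intro sum_mono)
    fix i
    have "m \<tau> i * tanh (\<beta> * m \<tau> i) \<le> \<bar>m \<tau> i\<bar> * \<bar>tanh (\<beta> * m \<tau> i)\<bar>"
      by (simp flip: abs_mult)
    also have "\<dots> \<le> \<bar>m \<tau> i\<bar> * (\<beta> * \<bar>m \<tau> i\<bar>)"
      by (intro mult_left_mono abs_tanh_field_le) auto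
    finally show "m \<tau> i * tanh (\<beta> * m \<tau> i) \<le> \<beta> * (m \<tau> i)\<^sup>2"
      by (simp add: power2_eq_square mult_ac flip: abs_mult)
  qed
  ultimately show ?thesis by linarith
qed

lemma Q_large_prob:
  assumes "0 < a" "E (\<lambda>\<tau>. (Q \<tau>)\<^sup>2) \<le> V"
  shows "measure_pmf.prob (ising N J \<beta>) {\<tau>. a \<le> \<bar>Q \<tau>\<bar>} \<le> V / a\<^sup>2"
proof -
  have "measure_pmf.prob (ising N J \<beta>) {\<tau>. a \<le> \<bar>Q \<tau>\<bar>} \<le> E (\<lambda>\<tau>. (Q \<tau>)\<^sup>2) / a\<^sup>2"
  proof (rule gibbs_markov)
    fix \<tau> assume "\<tau> \<in> {\<tau>. a \<le> \<bar>Q \<tau>\<bar>}"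
    then show "a\<^sup>2 \<le> (Q \<tau>)\<^sup>2"
      using assms(1) by (auto simp flip: abs_le_square_iff)
  qed (use assms in auto)
  also have "\<dots> \<le> V / a\<^sup>2"
    using assms by (intro divide_right_mono) auto
  finally show ?thesis .
qed

lemma H_small_prob:
  "measure_pmf.prob (ising N J \<beta>) {\<tau>. H \<tau> \<le> C} \<le> exp (1 / 2 * \<beta> * C - log_partition N J \<beta>)"
  using prob_ising_le_card[OF \<beta>_nonneg, of N J UNIV C] by (simp add: card_spins)

text \<open>A small \<open>M2\<close> means that \<open>H\<close> is at most \<open>a\<close>,
  unlikely when the free energy is large, or that |Q| is at least \<open>a / 2\<close>, unlikely by
  Chebyshev.\<close>

lemma M2_small_prob:
  assumes "0 < \<beta>" "0 < a" "E (\<lambda>\<tau>. (Q \<tau>)\<^sup>2) \<le> V"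
  shows "measure_pmf.prob (ising N J \<beta>) {\<tau>. M2 \<tau> < a / (2 * \<beta>)} \<le>
    exp (1 / 2 * \<beta> * a - log_partition N J \<beta>) + 4 * V / a\<^sup>2"
proof -
  have "measure_pmf.prob (ising N J \<beta>) {\<tau>. M2 \<tau> < a / (2 * \<beta>)} \<le>
      measure_pmf.prob (ising N J \<beta>) {\<tau>. H \<tau> \<le> a} +
      measure_pmf.prob (ising N J \<beta>) {\<tau>. a / 2 \<le> \<bar>Q \<tau>\<bar>}"
  proof (rule prob_ising_union_le)
    fix \<tau> assume "\<tau> \<in> {\<tau>. M2 \<tau> < a / (2 * \<beta>)}"
    then have "\<beta> * M2 \<tau> < a / 2"
      using assms(1) by (simp add: field_simps)
    then show "\<tau> \<in> {\<tau>. H \<tau> \<le> a} \<or> \<tau> \<in> {\<tau>. a / 2 \<le> \<bar>Q \<tau>\<bar>}"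
      using hamiltonian_le[of \<tau>] by auto
  qed
  also have "\<dots> \<le> exp (1 / 2 * \<beta> * a - log_partition N J \<beta>) + V / (a / 2)\<^sup>2"
    using assms by (intro add_mono H_small_prob Q_large_prob) auto
  finally show ?thesis
    by (simp add: power_divide mult.commute)
qed

end

text \<open>The assumption \<open>J_square\<close> says that the couplings take the values \<open>0\<close> and \<open>1 / (N p)\<close> only.\<close>

locale regular_ising = ising_system +
  fixes p \<epsilon> :: real
  assumes p: "0 < p" "p \<le> 1" and N: "0 < N" and Np: "1 \<le> N * p"
    and \<epsilon>: "0 < \<epsilon>" "\<epsilon> \<le> 1 / 2" and R_eq: "R = 1 + \<epsilon>"
    and J_le: "J i j \<le> 1 / (N * p)"
    and J_square: "(J i j)\<^sup>2 = 1 / (N * p) * J i j"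
    and row_sum_ge: "i \<in> {1..N} \<Longrightarrow> 1 - \<epsilon> \<le> (\<Sum>j\<in>{1..N}. J i j)"
begin

lemma R_le: "0 \<le> R" "R \<le> 2"
  using \<epsilon> by (auto simp: R_eq)

lemma J_le_1: "J i j \<le> 1"
proof -
  have "1 / (N * p) \<le> 1"
    using Np by simp
  then show ?thesis
    using J_le order_trans by blast
qed

lemma J_sum_ge: "(1 - \<epsilon>) * N \<le> (\<Sum>i\<in>{1..N}. \<Sum>j\<in>{1..N}. J i j)"
  using sum_mono[of "{1..N}" "\<lambda>_. 1 - \<epsilon>", OF row_sum_ge] by (simp add: mult.commute)

lemma J2_eq: "J2 = 1 / (N * p) * (\<Sum>i\<in>{1..N}. \<Sum>j\<in>{1..N}. J i j)"
  by (simp add: J2_def J_square sum_distrib_left)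

lemma J2_le: "J2 \<le> 2 / p"
proof -
  have "(\<Sum>i\<in>{1..N}. \<Sum>j\<in>{1..N}. J i j) \<le> (\<Sum>i\<in>{1..N}. 2)"
    using row_sum R_le by (intro sum_mono) (rule order_trans)
  then have "J2 \<le> 1 / (N * p) * (N * 2)"
    unfolding J2_eq using p by (intro mult_left_mono) auto
  then show ?thesis
    using N by simp
qed

lemma J2_ge: "1 / (2 * p) \<le> J2"
proof -
  have "1 / (N * p) * (1 / 2 * N) \<le> 1 / (N * p) * ((1 - \<epsilon>) * N)"
    using p \<epsilon> by (intro mult_left_mono mult_right_mono) auto
  also have "\<dots> \<le> J2"
    unfolding J2_eq using p by (intro mult_left_mono J_sum_ge) auto
  finally show ?thesis
    using N by simp
qed

end

section \<open>A fixed regular graph at \<beta> < 1\<close>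

locale high_temperature = regular_ising +
  assumes \<beta>_pos: "0 < \<beta>" and \<beta>_less: "\<beta> < 1" and \<epsilon>_eq: "\<epsilon> = (1 - \<beta>) / 2"
begin

text \<open>With this \<open>\<epsilon>\<close> the factor \<open>1 - \<beta> * R\<close> of the
  moment bounds stays above \<open>\<epsilon>\<close>, so they can be divided out.\<close>

lemma contraction: "\<epsilon> \<le> 1 - \<beta> * R"
proof -
  have "1 - \<beta> * R - \<epsilon> = (1 - \<beta>)\<^sup>2 / 2"
    unfolding R_eq \<epsilon>_eq by (simp add: power2_eq_square field_simps)
  then show ?thesis
    using zero_le_power2[of "1 - \<beta>"] by linarith
qed

lemma E_M2_le: "E M2 \<le> 4 / \<epsilon> / p"
proof -
  have "0 \<le> E M2"
    using gibbs_mono[of N "\<lambda>_. 0" M2 J \<beta>] M2_nonneg by simp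
  then have "\<epsilon> * E M2 \<le> (1 - \<beta> * R) * E M2"
    using contraction by (intro mult_right_mono)
  also have "\<dots> \<le> 2 * J2"
    by (rule second_moment_le)
  also have "\<dots> \<le> 4 / p"
    using J2_le by simp
  finally have "E M2 \<le> 4 / p / \<epsilon>"
    using \<epsilon> by (subst pos_le_divide_eq) (auto simp: mult.commute)
  then show ?thesis by (simp add: mult.commute)
qed

lemma E_Q2_le: "E (\<lambda>\<tau>. (Q \<tau>)\<^sup>2) \<le> 46 / \<epsilon> / p"
proof -
  have *: "0 \<le> 4 / \<epsilon> / p" using \<epsilon> p by simp
  have "E (\<lambda>\<tau>. (Q \<tau>)\<^sup>2) \<le> (6 + 5 * \<beta> * R) * E M2 + \<beta> * J2"
    by (rule score_second_moment_le[OF J_le_1])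
  \<comment> \<open>Since \<open>\<beta> * R\<close> is at most 1, the coefficient is at most 6 + 5;
    the final 46 is 11 * 4 + 2.\<close>
  also have "\<dots> \<le> 11 * (4 / \<epsilon> / p) + 1 * (2 / p)"
  proof (intro add_mono mult_mono E_M2_le J2_le)
    show "6 + 5 * \<beta> * R \<le> 11"
      using contraction \<epsilon> by simp
    show "0 \<le> E M2"
      using gibbs_mono[of N "\<lambda>_. 0" M2 J \<beta>] M2_nonneg by simp
    show "0 \<le> J2"
      unfolding J2_def by (intro sum_nonneg) auto
  qed (use \<beta>_less in auto)
  also have "1 * (2 / p) \<le> 2 / \<epsilon> / p"
    using \<epsilon> p by (simp add: field_simps)
  finally show ?thesis by (simp add: field_simps)
qed

lemma E_M4_le: "E M4 \<le> (20 * (4 / \<epsilon>) + 12) / \<epsilon> * (1 / (N * p)) / p"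
proof -
  let ?\<kappa> = "1 / (N * p)"
  have \<kappa>: "0 \<le> ?\<kappa>" "?\<kappa> \<le> 1"
    using Np by auto
  have "0 \<le> E M4"
    using gibbs_mono[of N "\<lambda>_. 0" M4 J \<beta>] M4_nonneg by simp
  then have "\<epsilon> * E M4 \<le> (1 - \<beta> * R) * E M4"
    using contraction by (intro mult_right_mono)
  also have "\<dots> \<le> 10 * ?\<kappa> * R * E M2 + 6 * ?\<kappa> ^ 3 * R * N"
    by (rule fourth_moment_le[OF J_le])
  also have "\<dots> \<le> 10 * ?\<kappa> * 2 * (4 / \<epsilon> / p) + 6 * ?\<kappa> ^ 3 * 2 * N"
  proof (intro add_mono mult_mono mult_left_mono mult_right_mono E_M2_le R_le)
    show "0 \<le> E M2"
      using gibbs_mono[of N "\<lambda>_. 0" M2 J \<beta>] M2_nonneg by simp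
  qed (use p in auto)
  \<comment> \<open>Because \<open>N * ?\<kappa> = 1 / p\<close>, this term has the same order as
    the other one.\<close>
  also have "6 * ?\<kappa> ^ 3 * 2 * N = 12 * ?\<kappa> * (?\<kappa> / p)"
    using N p by (simp add: power3_eq_cube field_simps)
  also have "\<dots> \<le> 12 * ?\<kappa> * (1 / p)"
    using \<kappa> p by (intro mult_left_mono divide_right_mono) auto
  also have "10 * ?\<kappa> * 2 * (4 / \<epsilon> / p) + 12 * ?\<kappa> * (1 / p) = (20 * (4 / \<epsilon>) + 12) * ?\<kappa> / p"
    by (simp add: add_divide_distrib distrib_right)
  finally have "E M4 \<le> ((20 * (4 / \<epsilon>) + 12) * ?\<kappa> / p) / \<epsilon>"
    using \<epsilon> by (subst pos_le_divide_eq) (auto simp: mult.commute)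
  then show ?thesis
    by (simp add: mult_ac)
qed

lemma log_partition_lower: "\<beta>\<^sup>2 / (32 * p) \<le> log_partition N J \<beta>"
proof -
  have "\<beta>\<^sup>2 / (32 * p) = \<beta>\<^sup>2 / 16 * (1 / (2 * p))"
    by simp
  also have "\<dots> \<le> \<beta>\<^sup>2 / 16 * J2"
    by (intro mult_left_mono J2_ge) auto
  also have "\<dots> \<le> log_partition N J \<beta>"
  proof (rule log_partition_ge)
    fix i j
    have "\<beta> * J i j \<le> 1 * 1"
      using \<beta>_less \<beta>_pos J_le_1 J_nonneg by (intro mult_mono) auto
    then show "1 / 2 * \<beta> * J i j \<le> 1" by simp
  qed
  finally show ?thesis .
qed

text \<open>With \<open>a = \<beta> / 32 / p\<close> the exponent \<open>\<beta> * a / 2\<close> is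
  half of the free-energy bound. Chebyshev compares a variance of order 1/p with a square of order
  1/p^2, so the total is of order \<open>p\<close>: useful only for small \<open>p\<close>.\<close>

lemma M2_small_prob_sparse:
  "measure_pmf.prob (ising N J \<beta>) {\<tau>. M2 \<tau> < 1 / 64 / p} \<le>
    (64 / \<beta>\<^sup>2 + 4 * (46 / \<epsilon>) * (32 / \<beta>)\<^sup>2) * p"
proof -
  let ?a = "\<beta> / 32 / p"
  have "measure_pmf.prob (ising N J \<beta>) {\<tau>. M2 \<tau> < ?a / (2 * \<beta>)} \<le>
      exp (1 / 2 * \<beta> * ?a - log_partition N J \<beta>) + 4 * (46 / \<epsilon> / p) / ?a\<^sup>2"
    using \<beta>_pos p by (intro M2_small_prob E_Q2_le) auto
  also have "exp (1 / 2 * \<beta> * ?a - log_partition N J \<beta>) \<le> exp (- (\<beta>\<^sup>2 / (64 * p)))"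
    using log_partition_lower by (simp add: power2_eq_square)
  also have "exp (- (\<beta>\<^sup>2 / (64 * p))) \<le> 1 / (\<beta>\<^sup>2 / (64 * p))"
    using \<beta>_pos p by (intro exp_neg_le_inverse) auto
  also have "1 / (\<beta>\<^sup>2 / (64 * p)) + 4 * (46 / \<epsilon> / p) / ?a\<^sup>2 =
      (64 / \<beta>\<^sup>2 + 4 * (46 / \<epsilon>) * (32 / \<beta>)\<^sup>2) * p"
    using \<beta>_pos p by (simp add: power_divide power2_eq_square field_simps)
  also have "?a / (2 * \<beta>) = 1 / 64 / p"
    using \<beta>_pos by simp
  finally show ?thesis by simp
qed

text \<open>On \<open>H \<le> C\<close> the Gibbs measure is at most exp (\<beta> C / 2) times the
  uniform one, as the free energy is nonnegative, so the small-ball estimate applies;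
  \<open>H\<close> exceeds \<open>C\<close> rarely by Markov. Effective when \<open>p\<close> is
  bounded below.\<close>

lemma M2_small_prob_dense:
  fixes k :: nat
  assumes k: "0 < k" "64 * k\<^sup>2 \<le> N" and C: "0 < C"
  shows "measure_pmf.prob (ising N J \<beta>) {\<tau>. M2 \<tau> < 1 / (16 * k\<^sup>2)} \<le>
    exp (1 / 2 * \<beta> * C) * (16 / k) + (1 + 50 / \<epsilon> / p) / C"
proof -
  have "measure_pmf.prob (ising N J \<beta>) {\<tau>. M2 \<tau> < 1 / (16 * k\<^sup>2)} \<le>
      measure_pmf.prob (ising N J \<beta>) {\<tau>. \<tau> \<in> {\<tau>. M2 \<tau> < 1 / (16 * k\<^sup>2)} \<and> H \<tau> \<le> C} +
      measure_pmf.prob (ising N J \<beta>) {\<tau>. C \<le> H \<tau>}"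
    by (rule prob_ising_union_le) auto
  \<comment> \<open>\<open>H\<close> may be negative, so Markov is applied to a nonnegative majorant
    of it.\<close>
  also have "measure_pmf.prob (ising N J \<beta>) {\<tau>. C \<le> H \<tau>} \<le> E (\<lambda>\<tau>. 1 + (Q \<tau>)\<^sup>2 + M2 \<tau>) / C"
  proof (rule gibbs_markov[OF _ C])
    fix \<tau>
    show "0 \<le> 1 + (Q \<tau>)\<^sup>2 + M2 \<tau>"
      using M2_nonneg by (intro add_nonneg_nonneg) auto
    assume "\<tau> \<in> {\<tau>. C \<le> H \<tau>}"
    moreover have "\<bar>Q \<tau>\<bar> \<le> 1 + (Q \<tau>)\<^sup>2"
      using sum_squares_bound[of 1 "\<bar>Q \<tau>\<bar>"] by simp
    moreover have "\<beta> * M2 \<tau> \<le> 1 * M2 \<tau>"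
      using \<beta>_less M2_nonneg by (intro mult_right_mono) auto
    ultimately show "C \<le> 1 + (Q \<tau>)\<^sup>2 + M2 \<tau>"
      using hamiltonian_le[of \<tau>] by auto
  qed
  also have "E (\<lambda>\<tau>. 1 + (Q \<tau>)\<^sup>2 + M2 \<tau>) \<le> 1 + 46 / \<epsilon> / p + 4 / \<epsilon> / p"
    unfolding gibbs_add gibbs_const by (intro add_mono E_Q2_le E_M2_le order_refl)
  also have "1 + 46 / \<epsilon> / p + 4 / \<epsilon> / p = 1 + 50 / \<epsilon> / p"
    by (simp add: field_simps)
  also have "measure_pmf.prob (ising N J \<beta>) {\<tau>. \<tau> \<in> {\<tau>. M2 \<tau> < 1 / (16 * k\<^sup>2)} \<and> H \<tau> \<le> C} \<le>
      exp (1 / 2 * \<beta> * C - log_partition N J \<beta>) *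
        (card ({\<tau>. M2 \<tau> < 1 / (16 * k\<^sup>2)} \<inter> spins N) / 2 ^ N)"
    by (rule prob_ising_le_card[OF \<beta>_nonneg])
  also have "\<dots> \<le> exp (1 / 2 * \<beta> * C) * (16 / k)"
  proof (intro mult_mono M2_small_ball[OF k _ R_le(2)])
    have "0 \<le> \<beta>\<^sup>2 / (32 * p)" using p by simp
    then show "exp (1 / 2 * \<beta> * C - log_partition N J \<beta>) \<le> exp (1 / 2 * \<beta> * C)"
      using log_partition_lower by simp
    show "1 / 2 \<le> (\<Sum>j\<in>{1..N}. J i j)" if "i \<in> {1..N}" for i
      using row_sum_ge[OF that] \<epsilon> by linarith
  qed auto
  finally show ?thesis
    using C by (simp add: divide_right_mono)
qed

text \<open>Three bad events: \<open>M2\<close> small, \<open>M4\<close> large, |Q| large. Outside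
  them the curvature is at least \<open>c / (2 * p)\<close>, which contradicts a large
  error.\<close>

lemma error_prob_le:
  assumes c: "0 < c" and K: "0 < K"
    and M2: "measure_pmf.prob (ising N J \<beta>) {\<tau>. M2 \<tau> < c / p} \<le> \<eta>"
  shows "measure_pmf.prob (ising N J \<beta>)
      {\<tau>. ereal K < ereal (sqrt (1 / p)) * \<bar>mple N J \<tau> - ereal \<beta>\<bar>} \<le>
    \<eta> + (2 * (\<beta> + K)\<^sup>2 / c * ((20 * (4 / \<epsilon>) + 12) / \<epsilon>)) * (1 / (N * p)) + 4 * (46 / \<epsilon>) / c\<^sup>2 / K\<^sup>2"
proof -
  let ?P = "measure_pmf.prob (ising N J \<beta>)"
  let ?b = "sqrt (1 / p)"
  \<comment> \<open>The threshold at which the quartic correction uses up half of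
    \<open>c / p\<close>.\<close>
  let ?A = "{\<tau>. c / (2 * p) / (\<beta> + K)\<^sup>2 \<le> M4 \<tau>}"
  let ?B = "{\<tau>. K / ?b * (c / (2 * p)) \<le> \<bar>Q \<tau>\<bar>}"
  have b: "1 \<le> ?b" "0 < ?b"
    using p by auto
  have "?P {\<tau>. ereal K < ereal ?b * \<bar>mple N J \<tau> - ereal \<beta>\<bar>} \<le>
      ?P {\<tau>. M2 \<tau> < c / p} + ?P (?A \<union> ?B)"
  proof (rule prob_ising_union_le)
    fix \<tau> assume "\<tau> \<in> {\<tau>. ereal K < ereal ?b * \<bar>mple N J \<tau> - ereal \<beta>\<bar>}"
    then have large: "K / ?b * curvature (\<beta> + K / ?b) \<tau> \<le> \<bar>Q \<tau>\<bar>"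
      using mple_error_imp_score_large[OF N b(2) K] by auto
    show "\<tau> \<in> {\<tau>. M2 \<tau> < c / p} \<or> \<tau> \<in> ?A \<union> ?B"
    proof (rule ccontr)
      assume "\<not> ?thesis"
      then have neg: "c / p \<le> M2 \<tau>" "M4 \<tau> < c / (2 * p) / (\<beta> + K)\<^sup>2"
          "\<bar>Q \<tau>\<bar> < K / ?b * (c / (2 * p))"
        by auto
      have "K / ?b \<le> K / 1"
        using b K by (intro divide_left_mono) auto
      then have "(\<beta> + K / ?b)\<^sup>2 * M4 \<tau> \<le> (\<beta> + K)\<^sup>2 * M4 \<tau>"
        using K b \<beta>_nonneg M4_nonneg by (intro mult_right_mono power_mono) auto
      also have "\<dots> \<le> (\<beta> + K)\<^sup>2 * (c / (2 * p) / (\<beta> + K)\<^sup>2)"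
        using neg(2) by (intro mult_left_mono) auto
      also have "\<dots> = c / (2 * p)"
        using K \<beta>_pos by simp
      finally have "c / (2 * p) \<le> curvature (\<beta> + K / ?b) \<tau>"
        using curvature_ge_moments[of \<tau> "\<beta> + K / ?b"] neg(1) by simp
      then have "K / ?b * (c / (2 * p)) \<le> K / ?b * curvature (\<beta> + K / ?b) \<tau>"
        using K b by (intro mult_left_mono) auto
      then show False
        using large neg(3) by linarith
    qed
  qed
  also have "?P (?A \<union> ?B) \<le> ?P ?A + ?P ?B"
    by (intro measure_Un_le) auto
  also have "?P ?A \<le> E M4 / (c / (2 * p) / (\<beta> + K)\<^sup>2)"
    using M4_nonneg c p K \<beta>_pos by (intro gibbs_markov) auto
  also have "\<dots> \<le> ((20 * (4 / \<epsilon>) + 12) / \<epsilon> * (1 / (N * p)) / p) / (c / (2 * p) / (\<beta> + K)\<^sup>2)"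
    using c p by (intro divide_right_mono E_M4_le) auto
  also have "\<dots> = (2 * (\<beta> + K)\<^sup>2 / c * ((20 * (4 / \<epsilon>) + 12) / \<epsilon>)) * (1 / (N * p))"
  proof -
    have "D * x / p / (c / (2 * p) / y) = (2 * y / c * D) * x" for D x y
      using c p by simp
    then show ?thesis .
  qed
  \<comment> \<open>The squared threshold is of order K^2 / p, and so is the second moment apart
    from K: the powers of \<open>p\<close> cancel, which is why the rate is the square root of
    1/p.\<close>
  also have "?P ?B \<le> (46 / \<epsilon> / p) / (K / ?b * (c / (2 * p)))\<^sup>2"
    using K b c p by (intro Q_large_prob E_Q2_le) auto
  also have "\<dots> = 4 * (46 / \<epsilon>) / c\<^sup>2 / K\<^sup>2"
    using K c p by (simp add: power_mult_distrib power_divide real_sqrt_divide)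
      (simp add: power2_eq_square field_simps)
  finally show ?thesis
    using M2 by simp
qed

end

section \<open>A fixed regular graph at \<beta> > 1\<close>

locale low_temperature = regular_ising +
  assumes \<beta>_gt: "1 < \<beta>" and \<epsilon>_eq: "\<epsilon> = (\<beta> - 1) / (2 * \<beta>)"
begin

text \<open>The mean spin of the trial product measure, small enough that the quartic entropy term
  leaves a fixed share of the quadratic energy gain.\<close>

definition tilt :: real where
  "tilt = min (1 / 2) ((\<beta> - 1) / 2)"

text \<open>A lower bound for the free energy per spin.\<close>

definition gap :: real where
  "gap = tilt\<^sup>2 * (\<beta> - 1) / 6"

lemma tilt: "0 < tilt" "tilt < 1" "tilt\<^sup>2 \<le> (\<beta> - 1) / 4"
proof -
  show t: "0 < tilt" "tilt < 1"
    using \<beta>_gt by (auto simp: tilt_def)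
  have "tilt \<le> 1 / 2" "tilt \<le> (\<beta> - 1) / 2"
    unfolding tilt_def by (rule min.cobounded1, rule min.cobounded2)
  then have "tilt * tilt \<le> 1 / 2 * ((\<beta> - 1) / 2)"
    using t(1) by (intro mult_mono) auto
  then show "tilt\<^sup>2 \<le> (\<beta> - 1) / 4"
    by (simp add: power2_eq_square)
qed

lemma gap_pos: "0 < gap"
  using tilt \<beta>_gt by (simp add: gap_def)

lemma log_partition_lower: "gap * N \<le> log_partition N J \<beta>"
proof -
  have "gap \<le> tilt\<^sup>2 / 2 * ((\<beta> - 1) / 2 - 2 / 3 * tilt\<^sup>2)"
  proof -
    have "tilt\<^sup>2 / 2 * ((\<beta> - 1) / 3) \<le> tilt\<^sup>2 / 2 * ((\<beta> - 1) / 2 - 2 / 3 * tilt\<^sup>2)"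
    proof (intro mult_left_mono)
      show "(\<beta> - 1) / 3 \<le> (\<beta> - 1) / 2 - 2 / 3 * tilt\<^sup>2"
        using tilt(3) by (simp add: field_simps)
    qed auto
    then show ?thesis by (simp add: gap_def)
  qed
  \<comment> \<open>The choice of \<open>\<epsilon>\<close> gives
    \<open>\<beta> * (1 - \<epsilon>) = (\<beta> + 1) / 2\<close>, still above the critical value
    1.\<close>
  also have "\<dots> = 1 / 2 * \<beta> * tilt\<^sup>2 * (1 - \<epsilon>) - (tilt\<^sup>2 / 2 + tilt ^ 4 / 3)"
    using \<beta>_gt unfolding \<epsilon>_eq by (simp add: field_simps power2_eq_square power4_eq_xxxx)
  finally have "gap * N \<le> (1 / 2 * \<beta> * tilt\<^sup>2 * (1 - \<epsilon>) - (tilt\<^sup>2 / 2 + tilt ^ 4 / 3)) * N"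
    by (intro mult_right_mono) auto
  also have "\<dots> = 1 / 2 * \<beta> * tilt\<^sup>2 * ((1 - \<epsilon>) * N) - N * (tilt\<^sup>2 / 2 + tilt ^ 4 / 3)"
    by (simp add: algebra_simps)
  also have "\<dots> \<le> 1 / 2 * \<beta> * tilt\<^sup>2 * (\<Sum>i\<in>{1..N}. \<Sum>j\<in>{1..N}. J i j) -
      N * (tilt\<^sup>2 / 2 + tilt ^ 4 / 3)"
    using \<beta>_gt by (intro diff_right_mono mult_left_mono J_sum_ge) auto
  also have "\<dots> \<le> log_partition N J \<beta>"
    using tilt by (intro log_partition_ge_mean_field)
  finally show ?thesis .
qed

text \<open>The contraction fails for \<beta> > 1, but the deterministic bound |m i| \<le> 2 already
  gives \<open>M2\<close> the right order \<open>N\<close>, and 1/p is at most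
  \<open>N\<close>.\<close>

lemma E_Q2_le: "E (\<lambda>\<tau>. (Q \<tau>)\<^sup>2) \<le> (24 + 42 * \<beta>) * N"
proof -
  have "E M2 \<le> E (\<lambda>_. 4 * N)"
  proof (rule gibbs_mono)
    fix \<tau> assume \<tau>: "\<tau> \<in> spins N"
    have "M2 \<tau> \<le> (\<Sum>i\<in>{1..N}. 4)"
      unfolding M2_def
    proof (intro sum_mono)
      fix i assume i: "i \<in> {1..N}"
      have "\<bar>m \<tau> i\<bar>\<^sup>2 \<le> 2\<^sup>2"
        using abs_field_le[OF \<tau> i] R_le by (intro power_mono) auto
      then show "(m \<tau> i)\<^sup>2 \<le> 4" by simp
    qed
    then show "M2 \<tau> \<le> 4 * N" by simp
  qed
  then have M2: "E M2 \<le> 4 * N" by simp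
  have "J2 \<le> 2 / p"
    by (rule J2_le)
  also have "\<dots> \<le> 2 * N"
    using Np p by (simp add: field_simps)
  finally have J2: "J2 \<le> 2 * N" .
  have "E (\<lambda>\<tau>. (Q \<tau>)\<^sup>2) \<le> (6 + 5 * \<beta> * R) * E M2 + \<beta> * J2"
    by (rule score_second_moment_le[OF J_le_1])
  also have "\<dots> \<le> (6 + 5 * \<beta> * 2) * (4 * N) + \<beta> * (2 * N)"
  proof (intro add_mono mult_mono M2 J2 mult_left_mono R_le)
    show "0 \<le> E M2"
      using gibbs_mono[of N "\<lambda>_. 0" M2 J \<beta>] M2_nonneg by simp
    show "0 \<le> J2"
      unfolding J2_def by (intro sum_nonneg) auto
  qed (use \<beta>_gt in auto)
  finally show ?thesis by (simp add: algebra_simps)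
qed

lemma error_prob_le:
  fixes K :: real
  assumes K: "0 < K" "K\<^sup>2 \<le> N"
  shows "measure_pmf.prob (ising N J \<beta>)
      {\<tau>. ereal K < ereal (sqrt N) * \<bar>mple N J \<tau> - ereal \<beta>\<bar>} \<le>
    (2 / gap + 4 * (24 + 42 * \<beta>) / (gap / \<beta>)\<^sup>2) / N +
    (24 + 42 * \<beta>) / ((1 - (tanh ((\<beta> + 1) * R))\<^sup>2) * (gap / \<beta> / (2 * \<beta>)))\<^sup>2 / K\<^sup>2"
proof -
  let ?P = "measure_pmf.prob (ising N J \<beta>)"
  let ?\<theta> = "1 - (tanh ((\<beta> + 1) * R))\<^sup>2"
  let ?e = "gap / \<beta>" and ?V = "(24 + 42 * \<beta>) * N"
  let ?c = "?e / (2 * \<beta>)"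
  let ?B = "{\<tau>. K / sqrt N * (?\<theta> * (?c * N)) \<le> \<bar>Q \<tau>\<bar>}"
  have N0: "0 < real N" using N by simp
  have e: "0 < ?e" "0 < ?c" using gap_pos \<beta>_gt by auto
  have \<theta>: "0 < ?\<theta>"
    using tanh_real_lt_1[of "(\<beta> + 1) * R"] tanh_real_gt_neg1[of "(\<beta> + 1) * R"]
    by (simp add: abs_square_less_1 abs_less_iff)
  \<comment> \<open>The assumption \<open>K\<^sup>2 \<le> N\<close> keeps the shifted parameter
    below \<open>\<beta> + 1\<close>, so \<open>?\<theta>\<close> is a lower factor independent of
    \<open>N\<close>.\<close>
  have h: "0 < K / sqrt N" "K / sqrt N \<le> 1"
    using K N0 real_le_rsqrt[of K N] by auto
  have "?P {\<tau>. ereal K < ereal (sqrt N) * \<bar>mple N J \<tau> - ereal \<beta>\<bar>} \<le>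
      ?P {\<tau>. M2 \<tau> < ?e * N / (2 * \<beta>)} + ?P ?B"
  proof (rule prob_ising_union_le)
    fix \<tau> assume \<tau>: "\<tau> \<in> spins N"
      and "\<tau> \<in> {\<tau>. ereal K < ereal (sqrt N) * \<bar>mple N J \<tau> - ereal \<beta>\<bar>}"
    then have large: "K / sqrt N * curvature (\<beta> + K / sqrt N) \<tau> \<le> \<bar>Q \<tau>\<bar>"
      using mple_error_imp_score_large[where b = "sqrt N" and K = K and \<tau> = \<tau>] N N0 K(1) by auto
    show "\<tau> \<in> {\<tau>. M2 \<tau> < ?e * N / (2 * \<beta>)} \<or> \<tau> \<in> ?B"
    proof (cases "M2 \<tau> < ?e * N / (2 * \<beta>)")
      case False
      then have "?\<theta> * (?c * N) \<le> ?\<theta> * M2 \<tau>"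
        using \<theta> by (intro mult_left_mono) auto
      also have "\<dots> \<le> curvature (\<beta> + K / sqrt N) \<tau>"
        using h \<beta>_nonneg by (intro curvature_ge_bounded_field[OF \<tau>]) auto
      finally have "K / sqrt N * (?\<theta> * (?c * N)) \<le> K / sqrt N * curvature (\<beta> + K / sqrt N) \<tau>"
        using h by (intro mult_left_mono) auto
      then show ?thesis
        using large by auto
    qed auto
  qed
  \<comment> \<open>Here \<open>a = gap * N / \<beta>\<close>, so that
    \<open>\<beta> * a / 2\<close> is half of the free-energy bound \<open>gap * N\<close>.\<close>
  also have "?P {\<tau>. M2 \<tau> < ?e * N / (2 * \<beta>)} \<le>
      exp (1 / 2 * \<beta> * (?e * N) - log_partition N J \<beta>) + 4 * ?V / (?e * N)\<^sup>2"
    using \<beta>_gt gap_pos N0 by (intro M2_small_prob E_Q2_le) auto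
  also have "exp (1 / 2 * \<beta> * (?e * N) - log_partition N J \<beta>) \<le> exp (- (gap * N / 2))"
    using log_partition_lower \<beta>_gt by simp
  also have "exp (- (gap * N / 2)) \<le> 1 / (gap * N / 2)"
    using gap_pos N0 by (intro exp_neg_le_inverse) auto
  also have "1 / (gap * N / 2) + 4 * ?V / (?e * N)\<^sup>2 =
      (2 / gap + 4 * (24 + 42 * \<beta>) / ?e\<^sup>2) / N"
  proof -
    have "1 / (g * x / 2) + 4 * (D * x) / (e * x)\<^sup>2 = (2 / g + 4 * D / e\<^sup>2) / x"
      if "0 < x" for g x D e :: real
      using that by (simp add: power2_eq_square add_divide_distrib)
    from this[OF N0] show ?thesis .
  qed
  also have "?P ?B \<le> ?V / (K / sqrt N * (?\<theta> * (?c * N)))\<^sup>2"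
    by (intro Q_large_prob E_Q2_le mult_pos_pos h \<theta> e N0)
  also have "K / sqrt N * (?\<theta> * (?c * N)) = (K * (?\<theta> * ?c)) * sqrt N"
  proof -
    have "K / sqrt N * (t * (d * N)) = K * (t * d) * (N / sqrt N)" for t d :: real
      by simp
    then show ?thesis
      by (simp only: real_div_sqrt of_nat_0_le_iff)
  qed
  also have "?V / ((K * (?\<theta> * ?c)) * sqrt N)\<^sup>2 = (24 + 42 * \<beta>) / (?\<theta> * ?c)\<^sup>2 / K\<^sup>2"
  proof -
    have "D * N / (K * t * sqrt N)\<^sup>2 = D / t\<^sup>2 / K\<^sup>2" for D t :: real
      using N0 by (simp add: power_mult_distrib mult.commute)
    then show ?thesis .
  qed
  finally show ?thesis by simp
qed

end

section \<open>Consistency\<close>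

lemma regular_ising_coupling:
  assumes reg: "regular_graph N p \<epsilon> E" and p: "0 < p" "p \<le> 1" and N: "0 < N" "1 \<le> N * p"
    and \<epsilon>: "0 < \<epsilon>" "\<epsilon> \<le> 1 / 2" and \<beta>: "0 \<le> \<beta>"
  shows "regular_ising N (coupling N p E) \<beta> (1 + \<epsilon>) p \<epsilon>"
proof
  have E: "E \<subseteq> vertex_pairs N"
    and rows: "\<bar>(\<Sum>j\<in>{1..N}. coupling N p E i j) - 1\<bar> \<le> \<epsilon>" if "i \<in> {1..N}" for i
    using reg that by (auto simp: regular_graph_def)
  show "0 \<le> coupling N p E i j" for i j
    using p by (simp add: coupling_def adjacency_def)
  show "coupling N p E i j = coupling N p E j i" for i j
    by (simp add: coupling_def adjacency_def insert_commute)
  show "coupling N p E i i = 0" for i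
    using reg adjacency_diag[of E N i] by (simp add: coupling_def regular_graph_def)
  show "(\<Sum>j\<in>{1..N}. coupling N p E i j) \<le> 1 + \<epsilon>" if "i \<in> {1..N}" for i
    using rows[OF that] by linarith
  show "1 - \<epsilon> \<le> (\<Sum>j\<in>{1..N}. coupling N p E i j)" if "i \<in> {1..N}" for i
    using rows[OF that] by linarith
  show "coupling N p E i j \<le> 1 / (N * p)" for i j
    using p by (simp add: coupling_def adjacency_def)
  show "(coupling N p E i j)\<^sup>2 = 1 / (N * p) * coupling N p E i j" for i j
    by (simp add: coupling_def adjacency_def power2_eq_square)
qed (use assms in auto)

lemma eventually_inverse_mean_degree_le:
  assumes p: "\<And>N. 1 \<le> N \<Longrightarrow> 0 < p N \<and> p N \<le> 1"
    and lim: "(\<lambda>N. ln (real N) / (real N * p N)) \<longlonglongrightarrow> 0" and \<delta>: "0 < \<delta>"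
  shows "\<forall>\<^sub>F N in sequentially. 1 / (real N * p N) \<le> \<delta>"
proof -
  have "\<forall>\<^sub>F N in sequentially. ln (real N) / (real N * p N) < \<delta>"
    by (rule order_tendstoD(2)[OF lim \<delta>])
  then show ?thesis
    using eventually_ge_at_top[of 3]
  proof eventually_elim
    case (elim N)
    \<comment> \<open>From \<open>N = 3\<close> on the logarithm is at least one, so it dominates
      the numerator.\<close>
    have "exp 1 \<le> real N"
      using exp_le elim(2) by (meson numeral_le_real_of_nat_iff order_trans)
    then have "1 \<le> ln (real N)"
      using elim(2) by (simp add: ln_ge_iff)
    then have "1 / (real N * p N) \<le> ln (real N) / (real N * p N)"
      using p[of N] elim(2) by (intro divide_right_mono) auto
    then show ?case
      using elim(1) by linarith
  qed
qed

lemma high_temperature_consistent: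
  assumes \<beta>: "0 < \<beta>" "\<beta> < 1"
    and p: "\<And>N. 1 \<le> N \<Longrightarrow> 0 < p N \<and> p N \<le> 1"
    and lim: "(\<lambda>N. ln (real N) / (real N * p N)) \<longlonglongrightarrow> 0"
  shows "rate_consistent (\<lambda>N. sqrt (1 / p N)) (\<lambda>N. joint_law N (p N) \<beta>) (\<lambda>N. er_mple N (p N)) \<beta>"
proof (rule rate_consistentI)
  fix \<eta> :: real assume \<eta>: "0 < \<eta>"
  define \<epsilon> where "\<epsilon> = (1 - \<beta>) / 2"
  have \<epsilon>: "0 < \<epsilon>" "\<epsilon> \<le> 1 / 2"
    using \<beta> by (auto simp: \<epsilon>_def)
  have high: "high_temperature N (coupling N q G) \<beta> (1 + \<epsilon>) q \<epsilon>"
    if "regular_graph N q \<epsilon> G" "0 < q" "q \<le> 1" "0 < N" "1 \<le> N * q" for N q G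
  proof -
    interpret regular_ising N "coupling N q G" \<beta> "1 + \<epsilon>" q \<epsilon>
      using that \<epsilon> \<beta> by (intro regular_ising_coupling) auto
    show ?thesis
      by unfold_locales (use \<beta> in \<open>auto simp: \<epsilon>_def\<close>)
  qed
  define A where "A = 64 / \<beta>\<^sup>2 + 4 * (46 / \<epsilon>) * (32 / \<beta>)\<^sup>2"
  \<comment> \<open>\<open>p\<^sub>0\<close> is where the sparse bound \<open>A * q\<close> reaches
    \<open>\<eta> / 4\<close>. For larger edge probabilities \<open>C\<close> makes the Markov term
    \<open>\<eta> / 8\<close>, and then \<open>k\<close> makes the small-ball term at most
    \<open>\<eta> / 8\<close>.\<close>
  define p\<^sub>0 where "p\<^sub>0 = \<eta> / 4 / A"
  define C where "C = (1 + 50 / \<epsilon> / p\<^sub>0) * 8 / \<eta>"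
  have A: "0 < A"
    unfolding A_def using \<beta> \<epsilon> by (intro add_pos_nonneg) auto
  have p\<^sub>0: "0 < p\<^sub>0"
    using A \<eta> by (simp add: p\<^sub>0_def)
  have C: "0 < C"
    unfolding C_def using p\<^sub>0 \<epsilon> \<eta> by (intro divide_pos_pos mult_pos_pos add_pos_nonneg) auto
  obtain k :: nat where k: "exp (1 / 2 * \<beta> * C) * 16 * 8 / \<eta> < k"
    using reals_Archimedean2 by blast
  have k_pos: "0 < real k"
    using k \<eta> by (intro le_less_trans[OF _ k]) auto
  \<comment> \<open>One constant for both regimes, so that \<open>p N\<close> may move between them
    as \<open>N\<close> varies.\<close>
  define c where "c = min (1 / 64) (p\<^sub>0 / (16 * k\<^sup>2))"
  have c: "0 < c"
    using p\<^sub>0 k_pos by (simp add: c_def)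
  have M2_small: "measure_pmf.prob (ising N (coupling N q G) \<beta>)
      {\<tau>. ising_system.M2 N (coupling N q G) \<tau> < c / q} \<le> \<eta> / 4"
    if q: "regular_graph N q \<epsilon> G" "0 < q" "q \<le> 1" "0 < N" "1 \<le> N * q" and large: "64 * k\<^sup>2 \<le> N"
    for N q G
  proof -
    interpret high_temperature N "coupling N q G" \<beta> "1 + \<epsilon>" q \<epsilon>
      by (rule high[OF q])
    let ?P = "measure_pmf.prob (ising N (coupling N q G) \<beta>)"
    show ?thesis
    proof (cases "q \<le> p\<^sub>0")
      case True
      have "c / q \<le> 1 / 64 / q"
        using q by (intro divide_right_mono) (auto simp: c_def)
      then have "?P {\<tau>. M2 \<tau> < c / q} \<le> ?P {\<tau>. M2 \<tau> < 1 / 64 / q}"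
        by (intro measure_pmf.finite_measure_mono) auto
      also have "\<dots> \<le> A * q"
        unfolding A_def by (rule M2_small_prob_sparse)
      also have "\<dots> \<le> A * p\<^sub>0"
        using True A by (intro mult_left_mono) auto
      finally show ?thesis
        using A by (simp add: p\<^sub>0_def)
    next
      case False
      have "c / q \<le> (p\<^sub>0 / (16 * k\<^sup>2)) / q"
        using q by (intro divide_right_mono) (auto simp: c_def)
      also have "\<dots> \<le> (p\<^sub>0 / (16 * k\<^sup>2)) / p\<^sub>0"
        using False p\<^sub>0 by (intro divide_left_mono) auto
      also have "\<dots> = 1 / (16 * k\<^sup>2)"
        using p\<^sub>0 by simp
      finally have "?P {\<tau>. M2 \<tau> < c / q} \<le> ?P {\<tau>. M2 \<tau> < 1 / (16 * k\<^sup>2)}"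
        by (intro measure_pmf.finite_measure_mono) auto
      also have "\<dots> \<le> exp (1 / 2 * \<beta> * C) * (16 / k) + (1 + 50 / \<epsilon> / q) / C"
        using k_pos large C by (intro M2_small_prob_dense) auto
      also have "exp (1 / 2 * \<beta> * C) * (16 / k) \<le> \<eta> / 8"
        using k \<eta> k_pos by (simp add: field_simps)
      also have "(1 + 50 / \<epsilon> / q) / C \<le> (1 + 50 / \<epsilon> / p\<^sub>0) / C"
        using False p\<^sub>0 \<epsilon> C by (intro divide_right_mono add_left_mono divide_left_mono) auto
      also have "\<dots> = \<eta> / 8"
      proof -
        have "0 < 1 + 50 / \<epsilon> / p\<^sub>0"
          using p\<^sub>0 \<epsilon> by (intro add_pos_nonneg) auto
        moreover have "x / (x * 8 / \<eta>) = \<eta> / 8" if "0 < x" for x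
          using that \<eta> by simp
        ultimately show ?thesis
          unfolding C_def by blast
      qed
      finally show ?thesis by simp
    qed
  qed
  define V where "V = 4 * (46 / \<epsilon>) / c\<^sup>2"
  define K\<^sub>0 where "K\<^sub>0 = max 1 (V * 4 / \<eta>)"
  show "\<exists>K\<^sub>0. \<forall>K\<ge>K\<^sub>0. \<forall>\<^sub>F N in sequentially. measure_pmf.prob (joint_law N (p N) \<beta>)
      {\<omega>. ereal K < ereal (sqrt (1 / p N)) * \<bar>er_mple N (p N) \<omega> - ereal \<beta>\<bar>} \<le> \<eta>"
  proof (intro exI[of _ K\<^sub>0] allI impI)
    fix K assume "K\<^sub>0 \<le> K"
    then have K: "1 \<le> K" "V * 4 / \<eta> \<le> K"
      by (auto simp: K\<^sub>0_def)
    have "K * 1 \<le> K * K"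
      using K by (intro mult_left_mono) auto
    then have "V * 4 / \<eta> \<le> K\<^sup>2"
      using K unfolding power2_eq_square by linarith
    then have V: "V / K\<^sup>2 \<le> \<eta> / 4"
      using K \<eta> by (simp add: field_simps)
    \<comment> \<open>\<open>D\<close> depends on \<open>K\<close>, but \<open>K\<close> is fixed
      before \<open>N\<close> grows, so the inverse mean degree makes this term vanish.\<close>
    define D where "D = 2 * (\<beta> + K)\<^sup>2 / c * ((20 * (4 / \<epsilon>) + 12) / \<epsilon>)"
    have D: "0 < D"
      unfolding D_def using c \<epsilon> \<beta> K by (intro mult_pos_pos divide_pos_pos add_pos_pos) auto
    have ev1: "\<forall>\<^sub>F N in sequentially. 1 / (real N * p N) \<le> \<eta> / 4 / D"
      using D \<eta> by (intro eventually_inverse_mean_degree_le[OF p lim]) auto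
    have ev2: "\<forall>\<^sub>F N in sequentially. 1 / (real N * p N) \<le> 1"
      by (intro eventually_inverse_mean_degree_le[OF p lim]) auto
    have ev3: "\<forall>\<^sub>F N in sequentially.
        measure_pmf.prob (erdos_renyi N (p N)) {G. \<not> regular_graph N (p N) \<epsilon> G} \<le> \<eta> / 4"
      using \<epsilon> \<eta> by (intro eventually_regular_graph[OF p lim]) auto
    show "\<forall>\<^sub>F N in sequentially. measure_pmf.prob (joint_law N (p N) \<beta>)
        {\<omega>. ereal K < ereal (sqrt (1 / p N)) * \<bar>er_mple N (p N) \<omega> - ereal \<beta>\<bar>} \<le> \<eta>"
      using ev1 ev2 ev3 eventually_ge_at_top[of "64 * k\<^sup>2"] eventually_ge_at_top[of 1]
    proof eventually_elim
      case (elim N)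
      have pN: "0 < p N" "p N \<le> 1"
        using p[of N] elim by auto
      have Np: "1 \<le> N * p N"
        using elim(2,5) pN by (simp add: field_simps)
      \<comment> \<open>A quarter of \<open>\<eta>\<close> each for an irregular graph, small
        \<open>M2\<close>, large \<open>M4\<close> and large |Q|.\<close>
      have "measure_pmf.prob (joint_law N (p N) \<beta>)
          {\<omega>. ereal K < ereal (sqrt (1 / p N)) * \<bar>er_mple N (p N) \<omega> - ereal \<beta>\<bar>} \<le> \<eta> / 4 + 3 * \<eta> / 4"
      proof (rule joint_law_prob_le[OF elim(3)])
        fix G assume G: "regular_graph N (p N) \<epsilon> G"
        interpret high_temperature N "coupling N (p N) G" \<beta> "1 + \<epsilon>" "p N" \<epsilon>
          using elim by (intro high G pN Np) auto
        have "measure_pmf.prob (ising N (coupling N (p N) G) \<beta>) {\<tau>. M2 \<tau> < c / p N} \<le> \<eta> / 4"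
          using elim by (intro M2_small G pN Np) auto
        then have "measure_pmf.prob (ising N (coupling N (p N) G) \<beta>)
            {\<tau>. ereal K < ereal (sqrt (1 / p N)) * \<bar>mple N (coupling N (p N) G) \<tau> - ereal \<beta>\<bar>} \<le>
            \<eta> / 4 + D * (1 / (N * p N)) + V / K\<^sup>2"
          unfolding D_def V_def using K by (intro error_prob_le[OF c]) auto
        also have "D * (1 / (N * p N)) \<le> D * (\<eta> / 4 / D)"
          using D elim(1) by (intro mult_left_mono) auto
        also have "D * (\<eta> / 4 / D) = \<eta> / 4"
          using D by simp
        finally have "measure_pmf.prob (ising N (coupling N (p N) G) \<beta>)
            {\<tau>. ereal K < ereal (sqrt (1 / p N)) * \<bar>mple N (coupling N (p N) G) \<tau> - ereal \<beta>\<bar>} \<le>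
            3 * \<eta> / 4"
          using V by linarith
        then show "measure_pmf.prob (ising N (coupling N (p N) G) \<beta>)
            {\<sigma>. (G, \<sigma>) \<in> {\<omega>. ereal K < ereal (sqrt (1 / p N)) * \<bar>er_mple N (p N) \<omega> - ereal \<beta>\<bar>}} \<le>
            3 * \<eta> / 4"
          by (simp add: er_mple_def)
      qed (use \<eta> in auto)
      then show ?case by simp
    qed
  qed
qed

lemma low_temperature_consistent:
  assumes \<beta>: "1 < \<beta>"
    and p: "\<And>N. 1 \<le> N \<Longrightarrow> 0 < p N \<and> p N \<le> 1"
    and lim: "(\<lambda>N. ln (real N) / (real N * p N)) \<longlonglongrightarrow> 0"
  shows "rate_consistent (\<lambda>N. sqrt (real N)) (\<lambda>N. joint_law N (p N) \<beta>) (\<lambda>N. er_mple N (p N)) \<beta>"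
proof (rule rate_consistentI)
  fix \<eta> :: real assume \<eta>: "0 < \<eta>"
  define \<epsilon> where "\<epsilon> = (\<beta> - 1) / (2 * \<beta>)"
  have \<epsilon>: "0 < \<epsilon>" "\<epsilon> \<le> 1 / 2"
    using \<beta> by (auto simp: \<epsilon>_def field_simps)
  \<comment> \<open>The gap depends on \<open>\<beta>\<close> alone, so the constants are fixed
    before \<open>N\<close> and the graph are chosen.\<close>
  define g where "g = low_temperature.gap \<beta>"
  define A where "A = 2 / g + 4 * (24 + 42 * \<beta>) / (g / \<beta>)\<^sup>2"
  define V where "V = (24 + 42 * \<beta>) /
    ((1 - (tanh ((\<beta> + 1) * (1 + \<epsilon>)))\<^sup>2) * (g / \<beta> / (2 * \<beta>)))\<^sup>2"
  define K\<^sub>0 where "K\<^sub>0 = max 1 (V * 4 / \<eta>)"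
  show "\<exists>K\<^sub>0. \<forall>K\<ge>K\<^sub>0. \<forall>\<^sub>F N in sequentially. measure_pmf.prob (joint_law N (p N) \<beta>)
      {\<omega>. ereal K < ereal (sqrt (real N)) * \<bar>er_mple N (p N) \<omega> - ereal \<beta>\<bar>} \<le> \<eta>"
  proof (intro exI[of _ K\<^sub>0] allI impI)
    fix K assume "K\<^sub>0 \<le> K"
    then have K: "1 \<le> K" "V * 4 / \<eta> \<le> K"
      by (auto simp: K\<^sub>0_def)
    have "K * 1 \<le> K * K"
      using K by (intro mult_left_mono) auto
    then have "V * 4 / \<eta> \<le> K\<^sup>2"
      using K unfolding power2_eq_square by linarith
    then have V: "V / K\<^sup>2 \<le> \<eta> / 4"
      using K \<eta> by (simp add: field_simps)
    have ev1: "\<forall>\<^sub>F N in sequentially. A / real N < \<eta> / 4"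
      using \<eta> by (intro order_tendstoD(2)[OF lim_const_over_n]) auto
    have ev2: "\<forall>\<^sub>F N in sequentially. 1 / (real N * p N) \<le> 1"
      by (intro eventually_inverse_mean_degree_le[OF p lim]) auto
    have ev3: "\<forall>\<^sub>F N in sequentially.
        measure_pmf.prob (erdos_renyi N (p N)) {G. \<not> regular_graph N (p N) \<epsilon> G} \<le> \<eta> / 4"
      using \<epsilon> \<eta> by (intro eventually_regular_graph[OF p lim]) auto
    have ev4: "\<forall>\<^sub>F N in sequentially. K\<^sup>2 \<le> real N"
      using filterlim_real_sequentially by (simp add: filterlim_at_top)
    show "\<forall>\<^sub>F N in sequentially. measure_pmf.prob (joint_law N (p N) \<beta>)
        {\<omega>. ereal K < ereal (sqrt (real N)) * \<bar>er_mple N (p N) \<omega> - ereal \<beta>\<bar>} \<le> \<eta>"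
      using ev1 ev2 ev3 ev4 eventually_ge_at_top[of 1]
    proof eventually_elim
      case (elim N)
      have pN: "0 < p N" "p N \<le> 1"
        using p[of N] elim by auto
      have Np: "1 \<le> N * p N"
        using elim(2,5) pN by (simp add: field_simps)
      have "measure_pmf.prob (joint_law N (p N) \<beta>)
          {\<omega>. ereal K < ereal (sqrt (real N)) * \<bar>er_mple N (p N) \<omega> - ereal \<beta>\<bar>} \<le> \<eta> / 4 + \<eta> / 2"
      proof (rule joint_law_prob_le[OF elim(3)])
        fix G assume G: "regular_graph N (p N) \<epsilon> G"
        interpret regular_ising N "coupling N (p N) G" \<beta> "1 + \<epsilon>" "p N" \<epsilon>
          using elim \<beta> by (intro regular_ising_coupling G pN Np \<epsilon>) auto
        interpret low_temperature N "coupling N (p N) G" \<beta> "1 + \<epsilon>" "p N" \<epsilon>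
          by unfold_locales (use \<beta> in \<open>auto simp: \<epsilon>_def\<close>)
        have "measure_pmf.prob (ising N (coupling N (p N) G) \<beta>)
            {\<tau>. ereal K < ereal (sqrt (real N)) * \<bar>mple N (coupling N (p N) G) \<tau> - ereal \<beta>\<bar>} \<le>
            A / N + V / K\<^sup>2"
          unfolding A_def V_def g_def using K elim(4) by (intro error_prob_le) auto
        then have "measure_pmf.prob (ising N (coupling N (p N) G) \<beta>)
            {\<tau>. ereal K < ereal (sqrt (real N)) * \<bar>mple N (coupling N (p N) G) \<tau> - ereal \<beta>\<bar>} \<le>
            \<eta> / 2"
          using V elim(1) by linarith
        then show "measure_pmf.prob (ising N (coupling N (p N) G) \<beta>)
            {\<sigma>. (G, \<sigma>) \<in> {\<omega>. ereal K < ereal (sqrt (real N)) * \<bar>er_mple N (p N) \<omega> - ereal \<beta>\<bar>}} \<le>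
            \<eta> / 2"
          by (simp add: er_mple_def)
      qed (use \<eta> in auto)
      then show ?case using \<eta> by simp
    qed
  qed
qed

theorem corollary3p2:
  fixes \<beta>\<^sub>0 :: real and p :: "nat \<Rightarrow> real"
  assumes "0 < \<beta>\<^sub>0"
    and "\<And>N. 1 \<le> N \<Longrightarrow> 0 < p N \<and> p N \<le> 1"
    and "(\<lambda>N. ln (real N) / (real N * p N)) \<longlonglongrightarrow> 0"
  shows "(\<beta>\<^sub>0 < 1 \<longrightarrow>
           rate_consistent (\<lambda>N. sqrt (1 / p N))
             (\<lambda>N. joint_law N (p N) \<beta>\<^sub>0) (\<lambda>N. er_mple N (p N)) \<beta>\<^sub>0) \<and>
         (1 < \<beta>\<^sub>0 \<longrightarrow>
           rate_consistent (\<lambda>N. sqrt (real N))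
             (\<lambda>N. joint_law N (p N) \<beta>\<^sub>0) (\<lambda>N. er_mple N (p N)) \<beta>\<^sub>0)"
  using high_temperature_consistent[OF assms(1) _ assms(2,3)]
    low_temperature_consistent[OF _ assms(2,3)] by blast

end
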